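(* Let $\Lambda=(\Lambda_R)_{R\in\mathbb{N}}$ be any exhaustion of $\mathbb{Z}^4$ and let $\mu$ be a critical offspring distribution with finite variance. The infinite snake in $\mathbb{Z}^4$ (with offspring distribution $\mu$, started at $x\in\mathbb{Z}^4\setminus\{0\}$) conditioned to hit $\Lambda_R^c$ before $0$ converges in distribution as $R\to\infty$ towards a limiting process which takes values almost surely in $(\mathbb{Z}^4)^{\mathbb{T}^\infty}$ (i.e. which is a $\mathbb{Z}^4$-valued function indexed by the vertices of a random tree in $\mathbb{T}^\infty$). More precisely, there exists a function $a:\mathbb{Z}^4\to\mathbb{R}$, positive on $\mathbb{Z}^4\setminus\{0\}$, such that for all $x\in\mathbb{Z}^4\setminus\{0\}$, all $n\in\mathbb{N}$, all $s_0,\dots,s_n\in\mathbb{Z}^4\setminus\{0\}$, all $t_0,\dots,t_{n-1}\in\mathbb{T}$ and all $x_{t_0}:V(t_0)\to\mathbb{Z}^4\setminus\{0\},\dots,x_{t_{n-1}}:V(t_{n-1})\to\mathbb{Z}^4\setminus\{0\}$ such that $x_{t_i}$ takes the value $s_i$ at the root of $t_i$ for all $0\le i\le n-1$, $$\mathbb{P}_x\big[\forall\,0\le i\le n,\ S_i=s_i;\ \forall\,0\le i\le n-1,\ b_i=t_i,\ X_{b_i}=x_{t_i}\,\big|\,X_{T^\infty}\text{ hits }\Lambda_R^c\text{ before }0\big]$$ $$\xrightarrow[R\to\infty]{}\ \frac{a(s_n)}{a(s_0)}\,\mathbb{P}_x\big[S_0^{\mathbf{k}}=s_0,\dots,S_n^{\mathbf{k}}=s_n\big]\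 \prod_{i=0}^{n-1}\mathbb{P}_{s_i}\big[X_{T^\star}=x_{t_i}\,\big|\,X_{T^\star}\text{ does not hit }0\big],$$ where $X_{T^\star}$ is a simple random walk indexed by a multitype $\mu$-Galton–Watson tree $T^\star$ and $S^{\mathbf{k}}$ is the four-dimensional killed random walk with killing function $\mathbf{k}(z)=\mathbb{P}_z[X_{T^\star}\text{ reaches }0]$.
   Context: An exhaustion of $\mathbb{Z}^4$ is an increasing sequence $(\Lambda_R)_{R\in\mathbb{N}}$ of finite subsets such that every point of $\mathbb{Z}^4$ belongs to some $\Lambda_R$; $\Lambda_R^c=\mathbb{Z}^4\setminus\Lambda_R$. $x\sim y$ means $|x-y|=1$ (Euclidean norm). Trees. A rooted tree $(t,r)$ is a directed graph with vertex set $V(t)$ and a marked vertex $r$ (the root) such that each vertex is reached from the root by a unique path; the offspring of $u$ are the $v$ such that $(uv)$ is an edge. $\mathbb{T}$ is the class of finite rooted trees and $\mathbb{T}^\infty$ the class of infinite rooted trees with exactly one infinite path from the root, called the spine, with vertices $u_0=r,u_1,u_2,\dots$. For $t\in\mathbb{T}^\infty$, the bush $b_i=b_i(t)$ is the finite tree rooted at $u_i$ induced by the vertices $u$ such that there is a path from $u_i$ to $u$ but not from $u_{i+1}$ to $u$. (To give meaning to equalities of trees such as $b_i=t_i$, trees are encoded in a fixed way, e.g. as ordered trees with Ulam–Harris labels.) Tree-indexed walk. For a rooted tree $t$, a simple random walk (SRW) indexed by $t$ started at $x$ is a random function $X_t:V(t)\to\mathbb{Z}^4$ with $X_t(r)=x$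 whose increments along the edges of $t$ are i.i.d. uniform on the $8$ unit vectors $\pm e_j$. When $t$ is random, $X_t$ is, conditionally on $t$, a SRW indexed by $t$. $\mathbb{P}_x$ refers to walks started at $x$. Random trees. $\mu:\mathbb{N}\to[0,\infty)$ is a critical offspring distribution if $\sum_n\mu(n)=1$ and $\sum_n n\mu(n)=1$. The size-biased law is $\mu^\star(i)=i\mu(i)$. A multitype $\mu$-Galton–Watson tree $T^\star$ is a random rooted tree in which the root has $i$ offspring with probability $\mu^\star(i+1)$ and all other vertices have, independently, a number of offspring with law $\mu$. The Kesten tree $T^\infty$ is the random element of $\mathbb{T}^\infty$ obtained from an infinite path $u_0,u_1,\dots$ (the spine, rooted at $u_0$) by grafting to each $u_i$ an independent multitype $\mu$-Galton–Watson tree (the bush $b_i$). Infinite snake. The infinite snake started at $x$ is $X_{T^\infty}$, the SRW started at $x$ indexed by the Kesten tree. One writes $S_i=X_{T^\infty}(u_i)$ (a SRW on $\mathbb{Z}^4$) and $X_{b_i}$ for the restriction of $X_{T^\infty}$ to $b_i$. Hitting order. On $V(t)$, $t\in\mathbb{T}^\infty$, consider the partial order: for $u\in b_i$, $v\in b_j$, $u<v$ if $i<j$. For $A\subset\mathbb{Z}^4$, one says that $x_t:V(t)\to\mathbb{Z}^4$ "hits $A$ before $0$" if there is $j\ge0$ such that $x_t(u_j)\in A$ and $x_t(u)\ne0$ for all $u\le u_j$. Killed random walk. For $\mathbf{k}:\mathbb{Z}^4\to[0,1]$, $S^{\mathbf{k}}$ is the Markov chain on $\mathbb{Z}^4\cup\{\Delta\}$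 with $\Delta$ absorbing, $Q(z,\Delta)=\mathbf{k}(z)$ and $Q(z,w)=\frac{1-\mathbf{k}(z)}{8}\mathbf 1_{z\sim w}$ for $z,w\in\mathbb{Z}^4$. *)

theory Defs
  imports "HOL-Probability.Probability"
begin

section \<open>The lattice\<close>

type_synonym site = "int ^ 4"

definition real_site :: "site \<Rightarrow> real ^ 4" where
  "real_site z = (\<chi> j. of_int (z $ j))"

definition adjacent :: "site \<Rightarrow> site \<Rightarrow> bool" where
  "adjacent x y \<longleftrightarrow> dist (real_site x) (real_site y) = 1"

definition unit_vectors :: "site set" where
  "unit_vectors = range (\<lambda>j. axis j 1) \<union> range (\<lambda>j. axis j (- 1))"

definition step_pmf :: "site pmf" where
  "step_pmf = pmf_of_set unit_vectors"

definition exhaustion :: "(nat \<Rightarrow> site set) \<Rightarrow> bool" where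
  "exhaustion \<Lambda> \<longleftrightarrow> incseq \<Lambda> \<and> (\<forall>R. finite (\<Lambda> R)) \<and> (\<Union>R. \<Lambda> R) = UNIV"


section \<open>Trees\<close>

definition finite_trees :: "nat list set set" where
  "finite_trees = {t. finite t \<and> [] \<in> t \<and>
     (\<forall>u k. u @ [k] \<in> t \<longrightarrow> u \<in> t \<and> (\<forall>j<k. u @ [j] \<in> t))}"

definition is_path :: "('v \<times> 'v) set \<Rightarrow> 'v \<Rightarrow> 'v \<Rightarrow> 'v list \<Rightarrow> bool" where
  "is_path E u v p \<longleftrightarrow> p \<noteq> [] \<and> hd p = u \<and> last p = v \<and> successively (\<lambda>a b. (a, b) \<in> E) p"

definition rooted_tree :: "'v set \<Rightarrow> ('v \<times> 'v) set \<Rightarrow> 'v \<Rightarrow> bool" where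
  "rooted_tree V E r \<longleftrightarrow> r \<in> V \<and> E \<subseteq> V \<times> V \<and> (\<forall>v\<in>V. \<exists>!p. is_path E r v p)"

definition is_infinite_path :: "('v \<times> 'v) set \<Rightarrow> 'v \<Rightarrow> (nat \<Rightarrow> 'v) \<Rightarrow> bool" where
  "is_infinite_path E r p \<longleftrightarrow> p 0 = r \<and> (\<forall>i. (p i, p (Suc i)) \<in> E)"

definition bush_vertices :: "('v \<times> 'v) set \<Rightarrow> (nat \<Rightarrow> 'v) \<Rightarrow> nat \<Rightarrow> 'v set" where
  "bush_vertices E p i = {v. (\<exists>q. is_path E (p i) v q) \<and> \<not> (\<exists>q. is_path E (p (Suc i)) v q)}"

text \<open>
  Infinite trees with one spine are encoded by their vertex sets: the pair \<open>(i, u)\<close> is the vertex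
  with Ulam--Harris label \<open>u\<close> of the bush attached to the \<open>i\<close>-th spine vertex, which is itself
  \<open>(i, [])\<close>.
\<close>

type_synonym vertex = "nat \<times> nat list"

definition spine :: "nat \<Rightarrow> vertex" where
  "spine i = (i, [])"

definition edges :: "vertex set \<Rightarrow> (vertex \<times> vertex) set" where
  "edges V = {(v, w) \<in> V \<times> V.
     (\<exists>i. v = spine i \<and> w = spine (Suc i)) \<or> (\<exists>i u k. v = (i, u) \<and> w = (i, u @ [k]))}"

definition infinite_trees :: "vertex set set" where
  "infinite_trees = {V. rooted_tree V (edges V) (spine 0) \<and>
     (\<exists>!p. is_infinite_path (edges V) (spine 0) p) \<and>
     is_infinite_path (edges V) (spine 0) spine \<and>
     (\<forall>i. \<exists>t\<in>finite_trees. bush_vertices (edges V) spine i = {i} \<times> t)}"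


section \<open>Galton--Watson trees and tree-indexed walks\<close>

definition critical :: "nat pmf \<Rightarrow> bool" where
  "critical \<mu> \<longleftrightarrow> (\<lambda>n. real n * pmf \<mu> n) sums 1"

definition finite_variance :: "nat pmf \<Rightarrow> bool" where
  "finite_variance \<mu> \<longleftrightarrow>
     integrable (measure_pmf \<mu>) (\<lambda>n. (real n - measure_pmf.expectation \<mu> real)\<^sup>2)"

definition size_biased :: "nat pmf \<Rightarrow> nat \<Rightarrow> real" where
  "size_biased \<mu> i = real i * pmf \<mu> i"

definition root_offspring :: "nat pmf \<Rightarrow> nat pmf" where
  "root_offspring \<mu> = embed_pmf (\<lambda>i. size_biased \<mu> (i + 1))"

text \<open>
  Every label \<open>u\<close> carries an offspring number and an increment, which belongs to the edge leading to
  \<open>u\<close> from its parent. All of them are independent; only those on the resulting tree are used.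
\<close>

definition label_pmf :: "nat pmf \<Rightarrow> nat list \<Rightarrow> (nat \<times> site) pmf" where
  "label_pmf \<mu> u = pair_pmf (if u = [] then root_offspring \<mu> else \<mu>) step_pmf"

definition gw_tree :: "(nat list \<Rightarrow> nat) \<Rightarrow> nat list set" where
  "gw_tree N = {u. \<forall>k<length u. u ! k < N (take k u)}"

text \<open>A walk indexed by a random tree is the partial map whose domain is the tree.\<close>

definition tree_walk :: "site \<Rightarrow> (nat list \<Rightarrow> nat \<times> site) \<Rightarrow> nat list \<rightharpoonup> site" where
  "tree_walk x \<omega> u =
     (if u \<in> gw_tree (\<lambda>v. fst (\<omega> v)) then Some (x + (\<Sum>k=1..length u. snd (\<omega> (take k u)))) else None)"

definition star_space :: "nat pmf \<Rightarrow> (nat list \<Rightarrow> nat \<times> site) measure" where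
  "star_space \<mu> = PiM UNIV (\<lambda>u. measure_pmf (label_pmf \<mu> u))"

definition star_law :: "nat pmf \<Rightarrow> site \<Rightarrow> (nat list \<rightharpoonup> site) measure" where
  "star_law \<mu> x = distr (star_space \<mu>) (PiM UNIV (\<lambda>_. count_space UNIV)) (tree_walk x)"

text \<open>
  At a spine vertex \<open>(j, [])\<close> with \<open>j \<ge> 1\<close> the increment belongs to the spine edge leading to it.
\<close>

definition snake :: "site \<Rightarrow> (vertex \<Rightarrow> nat \<times> site) \<Rightarrow> vertex \<rightharpoonup> site" where
  "snake x \<omega> = (\<lambda>(i, u).
     tree_walk (x + (\<Sum>j=1..i. snd (\<omega> (spine j)))) (\<lambda>v. \<omega> (i, v)) u)"

definition kesten_space :: "nat pmf \<Rightarrow> (vertex \<Rightarrow> nat \<times> site) measure" where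
  "kesten_space \<mu> = PiM UNIV (\<lambda>(i, u). measure_pmf (label_pmf \<mu> u))"

definition snake_space :: "(vertex \<rightharpoonup> site) measure" where
  "snake_space = PiM UNIV (\<lambda>_. count_space UNIV)"

definition snake_law :: "nat pmf \<Rightarrow> site \<Rightarrow> (vertex \<rightharpoonup> site) measure" where
  "snake_law \<mu> x = distr (kesten_space \<mu>) snake_space (snake x)"

definition bush :: "(vertex \<rightharpoonup> site) \<Rightarrow> nat \<Rightarrow> (nat list \<rightharpoonup> site)" where
  "bush w i = (\<lambda>u. w (i, u))"

definition is_walk_on :: "(nat list \<rightharpoonup> site) \<Rightarrow> nat list set \<Rightarrow> (nat list \<Rightarrow> site) \<Rightarrow> bool" where
  "is_walk_on w t y \<longleftrightarrow> dom w = t \<and> (\<forall>u\<in>t. w u = Some (y u))"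


section \<open>Hitting before zero, conditioning and convergence\<close>

text \<open>The index of the bush containing a vertex is its first component.\<close>

definition before :: "vertex \<Rightarrow> vertex \<Rightarrow> bool" where
  "before u v \<longleftrightarrow> fst u < fst v"

definition hits_before_0 :: "site set \<Rightarrow> (vertex \<rightharpoonup> site) \<Rightarrow> bool" where
  "hits_before_0 A w \<longleftrightarrow> (\<exists>j. (\<exists>z\<in>A. w (spine j) = Some z) \<and>
     (\<forall>u\<in>dom w. before u (spine j) \<or> u = spine j \<longrightarrow> w u \<noteq> Some 0))"

definition hits_0 :: "(nat list \<rightharpoonup> site) \<Rightarrow> bool" where
  "hits_0 w \<longleftrightarrow> (\<exists>u. w u = Some 0)"

definition conditioned_law :: "nat pmf \<Rightarrow> site \<Rightarrow> site set \<Rightarrow> (vertex \<rightharpoonup> site) measure" where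
  "conditioned_law \<mu> x A =
     uniform_measure (snake_law \<mu> x) {w \<in> space snake_space. hits_before_0 A w}"

text \<open>
  Local convergence: a snake is viewed through the presence and the value of each of its vertices.
  On partial maps whose bushes are finite trees, this is also the topology generated by
  the events that the first \<open>n\<close> bushes together with their values are prescribed.
\<close>

definition snake_topology :: "(vertex \<rightharpoonup> site) topology" where
  "snake_topology = product_topology (\<lambda>_. discrete_topology UNIV) UNIV"

definition converges_in_distribution ::
    "(nat \<Rightarrow> (vertex \<rightharpoonup> site) measure) \<Rightarrow> (vertex \<rightharpoonup> site) measure \<Rightarrow> bool" where
  "converges_in_distribution P L \<longleftrightarrow>
     (\<forall>f. continuous_map snake_topology euclideanreal f \<and> bounded (range f) \<longrightarrow>
        (\<lambda>R. \<integral>w. f w \<partial>P R) \<longlonglongrightarrow> (\<integral>w. f w \<partial>L))"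


section \<open>The killed random walk\<close>

text \<open>The absorbing state is \<open>None\<close>.\<close>

definition killed_transition :: "(site \<Rightarrow> real) \<Rightarrow> site option \<Rightarrow> site option \<Rightarrow> real" where
  "killed_transition k a b = (case (a, b) of
      (None, None) \<Rightarrow> 1
    | (None, Some w) \<Rightarrow> 0
    | (Some z, None) \<Rightarrow> k z
    | (Some z, Some w) \<Rightarrow> (1 - k z) / 8 * (if adjacent z w then 1 else 0))"

definition killed_kernel :: "(site \<Rightarrow> real) \<Rightarrow> site option \<Rightarrow> site option pmf" where
  "killed_kernel k a = embed_pmf (killed_transition k a)"

text \<open>The law of the first \<open>n + 1\<close> states of the Markov chain with kernel \<open>K\<close> started at \<open>a\<close>.\<close>

primrec trajectory :: "('s \<Rightarrow> 's pmf) \<Rightarrow> nat \<Rightarrow> 's \<Rightarrow> 's list pmf" where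
  "trajectory K 0 a = return_pmf [a]"
| "trajectory K (Suc n) a = bind_pmf (K a) (\<lambda>b. map_pmf (Cons a) (trajectory K n b))"

definition killing :: "nat pmf \<Rightarrow> site \<Rightarrow> real" where
  "killing \<mu> z = \<P>(w in star_law \<mu> z. hits_0 w)"


section \<open>Consistency of the encodings\<close>

lemma unit_vectors_eq_image: "unit_vectors = (\<lambda>(j, c). axis j c) ` (UNIV \<times> {1, - 1})"
  unfolding unit_vectors_def by auto

lemma finite_unit_vectors: "finite unit_vectors"
  unfolding unit_vectors_def by simp

lemma card_unit_vectors: "card unit_vectors = 8"
proof -
  have "inj_on (\<lambda>(j::4, c::int). axis j c) (UNIV \<times> {1, - 1})"
    by (auto simp: inj_on_def axis_eq_axis)
  then show ?thesis
    unfolding unit_vectors_eq_image by (subst card_image) (auto simp: card_cartesian_product)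
qed

lemma adjacent_iff: "adjacent z w \<longleftrightarrow> w - z \<in> unit_vectors"
proof -
  define d where "d = w - z"
  have "dist (real_site z) (real_site w) = L2_set (\<lambda>j. of_int (d $ j)) UNIV"
    unfolding dist_vec_def real_site_def d_def
    by (simp add: dist_real_def L2_set_def power2_commute)
  also have "\<dots> = sqrt (of_int (\<Sum>j\<in>UNIV. (d $ j)\<^sup>2))"
    by (simp add: L2_set_def)
  finally have *: "adjacent z w \<longleftrightarrow> (\<Sum>j\<in>UNIV. (d $ j)\<^sup>2) = 1"
    unfolding adjacent_def by (simp del: of_int_sum)
  have "(\<Sum>j\<in>UNIV. (d $ j)\<^sup>2) = 1 \<longleftrightarrow> d \<in> unit_vectors"
  proof
    assume s: "(\<Sum>j\<in>UNIV. (d $ j)\<^sup>2) = 1"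
    then obtain j where j: "d $ j \<noteq> 0"
      by (metis (no_types, lifting) sum.neutral zero_neq_one zero_power2)
    have split: "(\<Sum>j\<in>UNIV. (d $ j)\<^sup>2) = (d $ j)\<^sup>2 + (\<Sum>i\<in>UNIV - {j}. (d $ i)\<^sup>2)"
      by (subst sum.remove[of _ j]) auto
    have nn: "(\<Sum>i\<in>UNIV - {j}. (d $ i)\<^sup>2) \<ge> 0"
      by (intro sum_nonneg) auto
    have "(d $ j)\<^sup>2 \<ge> 1"
      using j by (simp add: int_one_le_iff_zero_less)
    with s split nn have dj: "(d $ j)\<^sup>2 = 1" and r: "(\<Sum>i\<in>UNIV - {j}. (d $ i)\<^sup>2) = 0"
      by linarith+
    have "\<forall>i\<in>UNIV - {j}. (d $ i)\<^sup>2 = 0"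
      using r by (subst (asm) sum_nonneg_eq_0_iff) auto
    then have "d = axis j (d $ j)"
      by (auto simp: vec_eq_iff axis_def)
    moreover from dj have "d $ j = 1 \<or> d $ j = - 1"
      by (simp add: power2_eq_1_iff)
    ultimately show "d \<in> unit_vectors"
      unfolding unit_vectors_def by (metis UnI1 UnI2 rangeI)
  next
    assume "d \<in> unit_vectors"
    then obtain j c where d: "d = axis j c" "c = 1 \<or> c = - 1"
      unfolding unit_vectors_def by auto
    have "(\<Sum>i\<in>UNIV. (d $ i)\<^sup>2) = (\<Sum>i\<in>UNIV. if i = j then c\<^sup>2 else 0)"
      by (rule sum.cong) (auto simp: d axis_def)
    then show "(\<Sum>i\<in>UNIV. (d $ i)\<^sup>2) = 1"
      using d(2) by auto
  qed
  with * show ?thesis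
    by (simp add: d_def)
qed

lemma pmf_root_offspring:
  assumes "critical \<mu>"
  shows "pmf (root_offspring \<mu>) i = size_biased \<mu> (i + 1)"
  unfolding root_offspring_def
proof (rule pmf_embed_pmf)
  show "0 \<le> size_biased \<mu> (j + 1)" for j
    by (simp add: size_biased_def)
  have "size_biased \<mu> sums 1"
    using assms by (simp add: critical_def size_biased_def[abs_def])
  then have s: "(\<lambda>j. size_biased \<mu> (j + 1)) sums 1"
    using sums_Suc_iff[of "size_biased \<mu>" 1] by (simp add: size_biased_def)
  have "(\<integral>\<^sup>+ j. ennreal (size_biased \<mu> (j + 1)) \<partial>count_space UNIV)
      = (\<Sum>j. ennreal (size_biased \<mu> (j + 1)))"
    by (rule nn_integral_count_space_nat)
  also have "\<dots> = ennreal 1"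
    using s by (intro suminf_ennreal_eq) (auto simp: size_biased_def)
  finally show "(\<integral>\<^sup>+ j. ennreal (size_biased \<mu> (j + 1)) \<partial>count_space UNIV) = 1"
    by simp
qed

lemma adjacent_eq_image: "{w. adjacent z w} = (+) z ` unit_vectors"
  by (force simp: adjacent_iff image_iff algebra_simps)

lemma pmf_killed_kernel:
  assumes "\<And>z. 0 \<le> k z \<and> k z \<le> 1"
  shows "pmf (killed_kernel k a) b = killed_transition k a b"
  unfolding killed_kernel_def
proof (rule pmf_embed_pmf)
  show nn: "0 \<le> killed_transition k a b" for b
    using assms by (auto simp: killed_transition_def split: option.splits)
  show "(\<integral>\<^sup>+ b. ennreal (killed_transition k a b) \<partial>count_space UNIV) = 1"
  proof (cases a)
    case None
    have "(\<lambda>b. ennreal (killed_transition k a b)) = indicator {None}"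
      by (auto simp: fun_eq_iff None killed_transition_def split: option.splits)
    then show ?thesis by simp
  next
    case (Some z)
    let ?B = "insert None (Some ` {w. adjacent z w})"
    have fin: "finite {w. adjacent z w}"
      unfolding adjacent_eq_image using finite_unit_vectors by simp
    have card: "card {w. adjacent z w} = 8"
      unfolding adjacent_eq_image using card_unit_vectors by (subst card_image) auto
    have "(\<integral>\<^sup>+ b. ennreal (killed_transition k a b) \<partial>count_space UNIV)
        = (\<Sum>b\<in>?B. ennreal (killed_transition k a b))"
      using fin
      by (intro nn_integral_count_space'[where A = ?B])
        (auto simp: Some killed_transition_def split: option.splits)
    also have "\<dots> = ennreal (\<Sum>b\<in>?B. killed_transition k a b)"
      using nn by (intro sum_ennreal) auto
    also have "(\<Sum>b\<in>?B. killed_transition k a b)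
        = k z + (\<Sum>w | adjacent z w. killed_transition k a (Some w))"
      using fin by (subst sum.insert) (auto simp: sum.reindex Some killed_transition_def)
    also have "(\<Sum>w | adjacent z w. killed_transition k a (Some w))
        = (\<Sum>w | adjacent z w. (1 - k z) / 8)"
      by (intro sum.cong) (auto simp: Some killed_transition_def)
    also have "k z + (\<Sum>w | adjacent z w. (1 - k z) / 8) = 1"
      using card by (simp add: field_simps)
    finally show ?thesis by simp
  qed
qed

text \<open>In the encoding, the infinite trees with one spine are the sequences of finite bushes.\<close>

lemma ex_is_path_iff: "(\<exists>q. is_path E u v q) \<longleftrightarrow> (u, v) \<in> E\<^sup>*"
proof
  assume "\<exists>q. is_path E u v q"
  then obtain q where "is_path E u v q" ..
  then show "(u, v) \<in> E\<^sup>*"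
  proof (induction q arbitrary: u)
    case Nil
    then show ?case by (simp add: is_path_def)
  next
    case (Cons a q)
    show ?case
    proof (cases q)
      case Nil
      with Cons.prems show ?thesis by (auto simp: is_path_def)
    next
      case (Cons b q')
      with Cons.prems have "is_path E b v q" "a = u" "(a, b) \<in> E"
        by (auto simp: is_path_def)
      with Cons.IH show ?thesis by (metis converse_rtrancl_into_rtrancl)
    qed
  qed
next
  assume "(u, v) \<in> E\<^sup>*"
  then show "\<exists>q. is_path E u v q"
  proof (induction rule: converse_rtrancl_induct)
    case base
    have "is_path E v v [v]" by (simp add: is_path_def)
    then show ?case ..
  next
    case (step u w)
    then obtain q where "is_path E w v q" by blast
    with step have "is_path E u v (u # q)"
      by (cases q) (auto simp: is_path_def)
    then show ?case ..
  qed
qed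

lemma is_path_snoc:
  "is_path E r v (p @ [x]) \<longleftrightarrow> x = v \<and> (if p = [] then r = v else \<exists>w. is_path E r w p \<and> (w, v) \<in> E)"
  by (cases "p = []") (auto simp: is_path_def successively_append_iff)

lemma edge_cases:
  assumes "(v, w) \<in> edges V"
  obtains i where "v = (i, [])" "w = (Suc i, [])" "v \<in> V" "w \<in> V"
  | i u k where "v = (i, u)" "w = (i, u @ [k])" "v \<in> V" "w \<in> V"
  using assms unfolding edges_def spine_def by auto

lemma edges_reach:
  assumes "(v, w) \<in> (edges V)\<^sup>*"
  shows "fst v \<le> fst w \<and> (v \<noteq> w \<longrightarrow> w \<in> V)"
  using assms
proof (induction rule: rtrancl_induct)
  case base
  then show ?case by simp
next
  case (step a b)
  from step.hyps(2) show ?case using step.IH by (cases rule: edge_cases) auto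
qed

lemma edges_reach_bush:
  assumes "(spine i, w) \<in> (edges V)\<^sup>*" "spine i \<in> V"
  shows "(spine (fst w), w) \<in> (edges V)\<^sup>* \<and> spine (fst w) \<in> V"
  using assms
proof (induction rule: rtrancl_induct)
  case base
  then show ?case by (simp add: spine_def)
next
  case (step a b)
  then have a: "(spine (fst a), a) \<in> (edges V)\<^sup>*" "spine (fst a) \<in> V" by auto
  from step.hyps(2) show ?case
  proof (cases rule: edge_cases)
    case 1
    then show ?thesis by (simp add: spine_def)
  next
    case 2
    with a step.hyps(2) show ?thesis using rtrancl_into_rtrancl[OF a(1) step.hyps(2)] by simp
  qed
qed

lemma edges_in_unique:
  assumes "(v, w) \<in> edges V" "(v', w) \<in> edges V"
  shows "v = v'"
  using assms unfolding edges_def spine_def by auto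

lemma infinite_trees_iff: "V \<in> infinite_trees \<longleftrightarrow> (\<forall>i. {u. (i, u) \<in> V} \<in> finite_trees)"
proof
  assume V: "V \<in> infinite_trees"
  show "\<forall>i. {u. (i, u) \<in> V} \<in> finite_trees"
  proof
    fix i
    from V obtain t where t: "t \<in> finite_trees" "bush_vertices (edges V) spine i = {i} \<times> t"
      unfolding infinite_trees_def by blast
    have "(spine j, spine (Suc j)) \<in> edges V" for j
      using V by (simp add: infinite_trees_def is_infinite_path_def)
    then have sp: "spine j \<in> V" for j
      by (meson edge_cases)
    have reach: "(spine 0, v) \<in> (edges V)\<^sup>*" if "v \<in> V" for v
    proof -
      have "rooted_tree V (edges V) (spine 0)"
        using V by (simp add: infinite_trees_def)
      then have "\<exists>q. is_path (edges V) (spine 0) v q"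
        using that unfolding rooted_tree_def by blast
      then show ?thesis by (simp only: ex_is_path_iff)
    qed
    have "u \<in> t \<longleftrightarrow> (i, u) \<in> V" for u
    proof
      assume "u \<in> t"
      then have "(spine i, (i, u)) \<in> (edges V)\<^sup>*"
        using t(2) unfolding bush_vertices_def ex_is_path_iff by blast
      then show "(i, u) \<in> V"
        using edges_reach[of "spine i" "(i, u)" V] sp[of i] by auto
    next
      assume "(i, u) \<in> V"
      then have "(spine i, (i, u)) \<in> (edges V)\<^sup>*"
        using edges_reach_bush[of 0 "(i, u)" V] reach[of "(i, u)"] sp[of 0] by simp
      moreover have "(spine (Suc i), (i, u)) \<notin> (edges V)\<^sup>*"
        using edges_reach[of "spine (Suc i)" "(i, u)" V] by (auto simp: spine_def)
      ultimately show "u \<in> t"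
        using t(2) unfolding bush_vertices_def ex_is_path_iff by blast
    qed
    then have "{u. (i, u) \<in> V} = t" by blast
    with t show "{u. (i, u) \<in> V} \<in> finite_trees" by simp
  qed
next
  assume F: "\<forall>i. {u. (i, u) \<in> V} \<in> finite_trees"
  have sp: "spine j \<in> V" for j
    using F unfolding finite_trees_def spine_def by blast
  have pre: "(i, u) \<in> V" if "(i, u @ [k]) \<in> V" for i u k
    using F that unfolding finite_trees_def by blast
  have fin: "finite {u. (i, u) \<in> V}" for i
    using F unfolding finite_trees_def by blast
  have spe: "(spine i, spine (Suc i)) \<in> edges V" for i
    using sp unfolding edges_def by auto
  have bush: "(spine i, (i, u)) \<in> (edges V)\<^sup>*" if "(i, u) \<in> V" for i u
    using that
  proof (induction u rule: rev_induct)
    case Nil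
    then show ?case by (simp add: spine_def)
  next
    case (snoc k u)
    then have "((i, u), (i, u @ [k])) \<in> edges V"
      using pre[of i u k] unfolding edges_def by auto
    with snoc.IH[OF pre[OF snoc.prems]] show ?case by (rule rtrancl_into_rtrancl)
  qed
  have spine_reach: "(spine i, spine (i + d)) \<in> (edges V)\<^sup>*" for i d
  proof (induction d)
    case (Suc d)
    then show ?case using spe[of "i + d"] by (simp add: rtrancl_into_rtrancl)
  qed simp
  have all: "(spine i, (j, u)) \<in> (edges V)\<^sup>* \<longleftrightarrow> (j, u) \<in> V \<and> i \<le> j" for i j u
  proof
    assume r: "(spine i, (j, u)) \<in> (edges V)\<^sup>*"
    show "(j, u) \<in> V \<and> i \<le> j"
      using edges_reach[OF r] sp[of i] by (auto simp: spine_def)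
  next
    assume "(j, u) \<in> V \<and> i \<le> j"
    then show "(spine i, (j, u)) \<in> (edges V)\<^sup>*"
      using rtrancl_trans[OF spine_reach[of i "j - i"], of "(j, u)"] bush[of j u] by simp
  qed
  have no_root: "(v, spine 0) \<notin> edges V" for v
    unfolding edges_def spine_def by auto
  have unique: "p = q" if "is_path (edges V) (spine 0) v p" "is_path (edges V) (spine 0) v q" for v p q
    using that
  proof (induction p arbitrary: q v rule: rev_induct)
    case Nil
    then show ?case by (simp add: is_path_def)
  next
    case (snoc x p)
    obtain q' z where q: "q = q' @ [z]"
      using snoc.prems(2) by (cases q rule: rev_cases) (auto simp: is_path_def)
    have x: "x = v" and z: "z = v"
      using snoc.prems by (simp_all only: q is_path_snoc)
    have P: "if p = [] then spine 0 = v
        else \<exists>w. is_path (edges V) (spine 0) w p \<and> (w, v) \<in> edges V"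
      using snoc.prems(1) unfolding is_path_snoc by (rule conjunct2)
    have Q: "if q' = [] then spine 0 = v
        else \<exists>w. is_path (edges V) (spine 0) w q' \<and> (w, v) \<in> edges V"
      using snoc.prems(2) unfolding q is_path_snoc by (rule conjunct2)
    have "p = q'"
    proof (cases "spine 0 = v")
      case True
      then have "p = []" "q' = []"
        using P Q no_root by metis+
      then show ?thesis by simp
    next
      case False
      then obtain w w' where w: "is_path (edges V) (spine 0) w p" "(w, v) \<in> edges V"
        "is_path (edges V) (spine 0) w' q'" "(w', v) \<in> edges V"
        using P Q by metis
      have "w = w'" using w(2,4) by (rule edges_in_unique)
      with w(1,3) show ?thesis by (intro snoc.IH) simp_all
    qed
    then show ?case by (simp add: q x z)
  qed
  have rt: "rooted_tree V (edges V) (spine 0)"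
    unfolding rooted_tree_def
  proof (intro conjI ballI)
    show "spine 0 \<in> V" by (rule sp)
    show "edges V \<subseteq> V \<times> V" unfolding edges_def by blast
    fix v assume "v \<in> V"
    then have "(spine 0, v) \<in> (edges V)\<^sup>*" by (cases v) (simp add: all)
    then show "\<exists>!p. is_path (edges V) (spine 0) v p"
      unfolding ex_is_path_iff[symmetric] using unique by (elim exE) (rule ex1I)
  qed
  have ip: "is_infinite_path (edges V) (spine 0) spine"
    using spe by (simp add: is_infinite_path_def)
  have only: "p = spine" if p: "is_infinite_path (edges V) (spine 0) p" for p
  proof
    fix i show "p i = spine i"
    proof (induction i)
      case 0
      then show ?case using p by (simp add: is_infinite_path_def)
    next
      case (Suc i)
      have e: "(p m, p (Suc m)) \<in> edges V" for m
        using p by (simp add: is_infinite_path_def)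
      show ?case
      proof (rule ccontr)
        assume ne: "p (Suc i) \<noteq> spine (Suc i)"
        have stay: "\<exists>u. p (Suc i + m) = (i, u) \<and> (i, u) \<in> V \<and> length u = Suc m" for m
        proof (induction m)
          case 0
          show ?case
            using e[of i] ne Suc by (cases rule: edge_cases) (auto simp: spine_def)
        next
          case (Suc m)
          then obtain u where u: "p (Suc i + m) = (i, u)" "length u = Suc m" by blast
          show ?case
            using e[of "Suc i + m"] u by (cases rule: edge_cases) auto
        qed
        have "range Suc \<subseteq> length ` {u. (i, u) \<in> V}"
        proof
          fix l assume "l \<in> range Suc"
          then obtain m where "l = Suc m" by blast
          with stay[of m] show "l \<in> length ` {u. (i, u) \<in> V}" by force
        qed
        moreover have "infinite (range Suc)"
          by (simp add: range_inj_infinite)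
        ultimately show False
          using fin finite_subset by blast
      qed
    qed
  qed
  have "bush_vertices (edges V) spine i = {i} \<times> {u. (i, u) \<in> V}" for i
    unfolding bush_vertices_def ex_is_path_iff by (auto simp: all not_less_eq_eq dest: le_antisym)
  moreover have "\<exists>!p. is_infinite_path (edges V) (spine 0) p"
    using ip only by (rule ex1I)
  ultimately show "V \<in> infinite_trees"
    unfolding infinite_trees_def using rt ip F by auto
qed

end

theory Submission
  imports Defs
begin

text \<open>
  Prescribing the first \<open>n\<close> bushes and spine positions multiplies the probability of the event
  by an explicit product and leaves the factor \<open>h R (s n) / h R x\<close>, where \<open>h R z\<close> is the
  probability that the walk killed at rate \<open>k\<close> leaves \<open>\<Lambda> R\<close>. So everything rests on the convergence
  of the ratios \<open>h R x / h R y\<close>, for arbitrary exhaustions. The functions \<open>h R\<close> are positive and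
  harmonic for the killed walk on growing boxes. By a many-to-one computation and a bound on the
  Green function, \<open>k z\<close> is at most a constant over \<open>|z|\<^sup>2\<close>; this is the scale at which a
  Harnack inequality holds on every sphere with a constant independent of the radius. Between two
  consecutive dyadic boxes the oscillation of the ratio of two positive harmonic functions then
  contracts by a fixed factor, which forces convergence.

  The limit \<open>a\<close> of the ratios is harmonic for the killed walk, so the limiting weights have
  total mass one: the limiting snake has as spine the Doob transform of the killed walk by \<open>a\<close>, and
  its bushes are independent conditionally on the spine, each conditioned not to hit \<open>0\<close>. Since no
  mass is lost, convergence of the weights implies convergence in distribution.
\<close>

section \<open>Comparison functions for the simple random walk\<close>

text \<open>The bound \<open>\<kappa> / nsq z\<close> on the killing is of critical order: it allows
  a constant amount of killing at each dyadic scale, so on this bound alone the killed walk is no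
  small perturbation of the simple walk. On a ball of radius \<epsilon> |z| around z, with
  \<epsilon> small in terms of \<kappa>, little killing accumulates. There the Harnack inequality is
  proved directly, and balls are then chained along a sphere, their number depending on \<epsilon>
  only. Cubes serve as spheres because their boundaries can be followed in coordinate directions.
  Instead of asymptotics of the Green function, explicit perturbations of |x|^-2 with exact
  inequalities are used; they lose only constants. The origin, where the killing probability is 1,
  is an interior site like any other, and the maximum principle works on full cubes. The contraction
  uses only positivity and harmonicity on a large cube, never the shape of \<Lambda> R or the values
  of h R near its boundary; this is why the exhaustion can be arbitrary.\<close>

definition avg :: "(site \<Rightarrow> real) \<Rightarrow> site \<Rightarrow> real" where
  "avg u z = (\<Sum>e\<in>unit_vectors. u (z + e)) / 8"

definition nsq :: "site \<Rightarrow> real" where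
  "nsq z = (\<Sum>j\<in>UNIV. (real_of_int (z $ j))\<^sup>2)"

lemma sum_unit_vectors:
  "(\<Sum>e\<in>unit_vectors. f e) = (\<Sum>j\<in>UNIV. f (axis j 1) + (f (axis j (- 1)) :: 'a::comm_monoid_add))"
proof -
  have inj: "inj_on (\<lambda>(j::4, c::int). axis j c) (UNIV \<times> {1, - 1})"
    by (auto simp: inj_on_def axis_eq_axis)
  have "(\<Sum>j\<in>UNIV. \<Sum>c\<in>{1, - 1}. f (axis j c)) = (\<Sum>x\<in>UNIV \<times> {1, - 1}. f (axis (fst x) (snd x)))"
    by (subst sum.cartesian_product) (simp add: case_prod_unfold)
  then show ?thesis
    unfolding unit_vectors_eq_image
    by (subst sum.reindex[OF inj]) (simp add: case_prod_unfold o_def)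
qed

lemma avg_axis: "avg u z = (\<Sum>j\<in>UNIV. u (z + axis j 1) + u (z + axis j (- 1))) / 8"
  by (simp add: avg_def sum_unit_vectors)

lemma avg_mono: "(\<And>e. e \<in> unit_vectors \<Longrightarrow> u (z + e) \<le> v (z + e)) \<Longrightarrow> avg u z \<le> avg v z"
  unfolding avg_def by (intro divide_right_mono sum_mono) auto

lemma avg_cong: "(\<And>e. e \<in> unit_vectors \<Longrightarrow> u (z + e) = v (z + e)) \<Longrightarrow> avg u z = avg v z"
  unfolding avg_def by simp

lemma avg_const [simp]: "avg (\<lambda>_. c) z = c"
  unfolding avg_def using card_unit_vectors by simp

lemma avg_diff: "avg (\<lambda>y. u y - v y) z = avg u z - avg v z"
  unfolding avg_def by (simp add: sum_subtractf diff_divide_distrib)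

lemma avg_cmult: "avg (\<lambda>y. c * u y) z = c * avg u z"
  unfolding avg_def by (simp add: sum_distrib_left)

lemma avg_sum: "avg (\<lambda>y. \<Sum>w\<in>W. g w y) z = (\<Sum>w\<in>W. avg (g w) z)"
  unfolding avg_def by (subst sum.swap) (simp add: sum_divide_distrib)

lemma avg_nonneg: "(\<And>e. e \<in> unit_vectors \<Longrightarrow> 0 \<le> u (z + e)) \<Longrightarrow> 0 \<le> avg u z"
  unfolding avg_def by (intro divide_nonneg_nonneg sum_nonneg) auto

lemma avg_shift: "avg (\<lambda>y. u (y - w)) z = avg u (z - w)"
  unfolding avg_def by (simp add: algebra_simps)

lemma nsq_nonneg: "0 \<le> nsq z"
  unfolding nsq_def by (intro sum_nonneg) auto

lemma coord_le_nsq: "(real_of_int (z $ j))\<^sup>2 \<le> nsq z"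
  unfolding nsq_def by (rule member_le_sum) auto

lemma nsq_axis: "nsq (z + axis j c) = nsq z + 2 * c * (z $ j) + c\<^sup>2"
proof -
  have "nsq (z + axis j c) = (\<Sum>i\<in>UNIV. (real_of_int (z $ i))\<^sup>2 + (if i = j then real_of_int (2 * c * (z $ j) + c\<^sup>2) else (0::real)))"
    unfolding nsq_def by (intro sum.cong) (auto simp: axis_def power2_eq_square algebra_simps)
  then show ?thesis
    by (simp add: sum.distrib nsq_def)
qed

lemma nsq_eq_int: "nsq z = of_int (\<Sum>j\<in>UNIV. (z $ j)\<^sup>2)"
  unfolding nsq_def by simp

lemma nsq_ge_1: "z \<noteq> 0 \<Longrightarrow> 1 \<le> nsq z"
proof -
  assume "z \<noteq> 0"
  then obtain j where "z $ j \<noteq> 0" by (auto simp: vec_eq_iff)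
  then have "1 \<le> (real_of_int (z $ j))\<^sup>2"
    by (metis of_int_1 of_int_le_iff of_int_power int_one_le_iff_zero_less zero_less_power2)
  then show ?thesis using coord_le_nsq[of z j] by linarith
qed

lemma sum_sq_coords: "(\<Sum>j\<in>UNIV. (real_of_int (z $ j))\<^sup>2) = nsq z"
  by (simp add: nsq_def)

text \<open>
  In dimension four \<open>|x|\<^sup>-\<^sup>2\<close> is harmonic in the continuum. On the lattice, replacing \<open>|x|\<^sup>2\<close> by
  \<open>|x|\<^sup>2 + 7\<close> makes it superharmonic everywhere, and by \<open>|x|\<^sup>2 - 3\<close> subharmonic away from the origin.
\<close>

lemma superharmonic_inverse: "avg (\<lambda>y. 1 / (nsq y + 7)) z \<le> 1 / (nsq z + 7)"
proof -
  define s where "s = nsq z"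
  \<comment> \<open>Centred so that the two neighbours along axis j contribute 1 / (T + 2x) and 1 /
    (T - 2x).\<close>
  define T where "T = s + 8"
  have s: "s \<ge> 0" using nsq_nonneg s_def by simp
  \<comment> \<open>T^2 / (T^2 - 4Y) is convex in the squared coordinate Y, hence below its chord
    over [0, s]. The chord has slope 4 / D with D = T^2 - 4s, and being linear in Y it can be summed
    over j knowing only that the squared coordinates add up to s.\<close>
  define D where "D = T\<^sup>2 - 4 * T + 32"
  have D: "D > 0"
  proof -
    have "D = (T - 2)\<^sup>2 + 28" by (simp add: D_def power2_eq_square algebra_simps)
    then show ?thesis using zero_le_power2[of "T - 2"] by linarith
  qed
  have T: "T \<ge> 8" using s T_def by simp
  have trm: "1 / (nsq (z + axis j 1) + 7) + 1 / (nsq (z + axis j (- 1)) + 7)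
      \<le> 2 / T * (1 + 4 * (real_of_int (z $ j))\<^sup>2 / D)" for j
  proof -
    define x where "x = real_of_int (z $ j)"
    define Y where "Y = x\<^sup>2"
    have Y: "0 \<le> Y" "Y \<le> T - 8" using coord_le_nsq[of z j] by (auto simp: Y_def x_def T_def s_def)
    have p: "T + 2 * x > 0" "T - 2 * x > 0"
      using Y T zero_le_power2[of "x + 1"] zero_le_power2[of "x - 1"]
      by (auto simp: Y_def power2_eq_square algebra_simps)
    have TT: "T\<^sup>2 - 4 * Y = (T + 2 * x) * (T - 2 * x)" by (simp add: Y_def power2_eq_square algebra_simps)
    have pos: "T\<^sup>2 - 4 * Y > 0" unfolding TT using p by simp
    have e: "1 / (T + 2 * x) + 1 / (T - 2 * x) = 2 * T / (T\<^sup>2 - 4 * Y)"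
      unfolding TT using p by (simp add: field_simps)
    have "0 \<le> 4 * Y * (4 * (T - 8 - Y))" using Y by simp
    then have k: "T\<^sup>2 * D \<le> (T\<^sup>2 - 4 * Y) * (D + 4 * Y)"
      by (simp add: D_def algebra_simps power2_eq_square)
    have "2 * T / (T\<^sup>2 - 4 * Y) \<le> 2 / T * (1 + 4 * Y / D)"
    proof -
      have "2 / T * (1 + 4 * Y / D) = 2 * (D + 4 * Y) / (T * D)" using D T by (simp add: field_simps)
      moreover have k2: "D * (T * (T * 2)) \<le> (T * T - Y * 4) * (D * 2 + Y * 8)"
        using k by (simp add: algebra_simps power2_eq_square)
      moreover have "2 * T / (T\<^sup>2 - 4 * Y) \<le> 2 * (D + 4 * Y) / (T * D)"
        using k2 pos D T by (simp add: divide_simps mult_ac power2_eq_square)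
      ultimately show ?thesis by simp
    qed
    moreover have n: "nsq (z + axis j 1) + 7 = T + 2 * x" "nsq (z + axis j (- 1)) + 7 = T - 2 * x"
      by (simp_all add: nsq_axis T_def s_def x_def)
    ultimately show ?thesis unfolding n e by (simp only: Y_def x_def)
  qed
  have "avg (\<lambda>y. 1 / (nsq y + 7)) z \<le> (\<Sum>j\<in>(UNIV::4 set). 2 / T * (1 + 4 * (real_of_int (z $ j))\<^sup>2 / D)) / 8"
    unfolding avg_axis by (intro divide_right_mono sum_mono trm) auto
  also have "\<dots> = (1 / T) * (1 + s / D)"
  proof -
    have "(\<Sum>j\<in>(UNIV::4 set). 2 / T * (1 + 4 * (real_of_int (z $ j))\<^sup>2 / D)) = 2 / T * (4 + 4 * s / D)"
      by (simp add: sum_distrib_left[symmetric] sum.distrib sum_divide_distrib[symmetric] s_def sum_sq_coords)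
    then show ?thesis using T D by (simp add: field_simps)
  qed
  also have "\<dots> \<le> 1 / (s + 7)"
  proof -
    have "(D + s) * (s + 7) \<le> T * D" unfolding D_def T_def using s by (simp add: algebra_simps power2_eq_square)
    moreover have "(1 / T) * (1 + s / D) = (D + s) / (T * D)" using T D by (simp add: field_simps)
    ultimately show ?thesis using T D s by (simp add: divide_simps mult_ac)
  qed
  finally show ?thesis by (simp add: s_def)
qed

text \<open>The neighbours of 0 have squared norm 1, so the defect is 1/7 - 1/8. Thus 56 times the
  function dominates the potential of a unit charge at the origin; every factor 56 below comes from
  here.\<close>

lemma superharmonic_inverse_at_0: "1 / (nsq 0 + 7) - avg (\<lambda>y. 1 / (nsq y + 7)) 0 = 1 / 56"
proof -
  have "nsq 0 = 0" by (simp add: nsq_def)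
  moreover have "nsq (0 + axis j c) = c\<^sup>2" for j c using nsq_axis[of 0 j c] \<open>nsq 0 = 0\<close> by simp
  ultimately show ?thesis by (simp add: avg_axis)
qed

text \<open>For \<open>nsq z \<ge> 16\<close> all neighbours have \<open>nsq\<close> at least 9, so
  the cut-off at 6 has no effect there, and 1 / (1 - y) \<ge> 1 + y gives subharmonicity. The second
  bound has the denominator of \<open>subharmonic_log\<close>, so that the loss by killing can be
  compared with the gain of the logarithm.\<close>

lemma subharmonic_inverse:
  assumes "nsq z \<ge> 16"
  shows "1 / max (nsq z - 3) 6 \<le> avg (\<lambda>y. 1 / max (nsq y - 3) 6) z"
    and "avg (\<lambda>y. 1 / max (nsq y - 3) 6) z \<le> 6 / (nsq z + 15)"
proof -
  define s where "s = nsq z"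
  define T where "T = s - 2"
  have s: "s \<ge> 16" using assms s_def by simp
  have T: "T \<ge> 14" using s T_def by simp
  have nb: "nsq (z + axis j c) - 3 \<ge> 6 \<and> 1 / max (nsq (z + axis j c) - 3) 6 \<le> 6 / (s + 15) \<and>
    max (nsq (z + axis j c) - 3) 6 = T + 2 * c * real_of_int (z $ j)"
    if c: "c = 1 \<or> c = -1" for j and c :: int
  proof -
    define x where "x = of_int c * real_of_int (z $ j)"
    have x2: "x\<^sup>2 \<le> s" using coord_le_nsq[of z j] c by (auto simp: x_def s_def)
    have n: "nsq (z + axis j c) = s + 2 * x + 1" using c by (auto simp: nsq_axis x_def s_def)
    have "x \<ge> - sqrt s" using x2 by (metis abs_le_D2 minus_le_iff real_le_rsqrt real_sqrt_abs real_sqrt_le_iff)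
    define r where "r = sqrt s"
    have r: "r \<ge> 4" "r\<^sup>2 = s" using s real_le_rsqrt[of 4 s] by (auto simp: r_def)
    have xr: "x \<ge> - r" using \<open>x \<ge> - sqrt s\<close> r_def by simp
    have "(r - 1)\<^sup>2 \<ge> 3\<^sup>2" using r by (intro power_mono) auto
    then have "s - 2 * r + 1 \<ge> 9" using r by (simp add: power2_eq_square algebra_simps)
    then have g6: "nsq (z + axis j c) - 3 \<ge> 6" using n xr by linarith
    have "0 \<le> (r - 4) * (5 * r + 8)" using r by simp
    then have "5 * s - 12 * r - 27 \<ge> 0"  using r by (simp add: power2_eq_square algebra_simps)
    then have "s + 15 \<le> 6 * (nsq (z + axis j c) - 3)" unfolding n using xr by (simp add: algebra_simps)
    then have "1 / (nsq (z + axis j c) - 3) \<le> 6 / (s + 15)" using s g6 by (simp add: divide_simps)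
    with g6 n show ?thesis by (simp add: x_def T_def max_absorb1)
  qed
  have trm: "2 / T * (1 + 4 * (real_of_int (z $ j))\<^sup>2 / T\<^sup>2)
     \<le> 1 / max (nsq (z + axis j 1) - 3) 6 + 1 / max (nsq (z + axis j (- 1)) - 3) 6" for j
  proof -
    define x where "x = real_of_int (z $ j)"
    have p: "T + 2 * x > 0" "T - 2 * x > 0" 
      using nb[of 1 j] nb[of "-1" j] by (auto simp: x_def)
    have TT: "T\<^sup>2 - 4 * x\<^sup>2 = (T + 2 * x) * (T - 2 * x)" by (simp add: power2_eq_square algebra_simps)
    have pos: "T\<^sup>2 - 4 * x\<^sup>2 > 0" unfolding TT using p by simp
    have e: "1 / (T + 2 * x) + 1 / (T - 2 * x) = 2 * T / (T\<^sup>2 - 4 * x\<^sup>2)"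
      unfolding TT using p by (simp add: field_simps)
    have "(T\<^sup>2 + 4 * x\<^sup>2) * (T\<^sup>2 - 4 * x\<^sup>2) \<le> T\<^sup>2 * T\<^sup>2" by (simp add: algebra_simps)
    then have "(T\<^sup>2 + 4 * x\<^sup>2) / T\<^sup>2 \<le> T\<^sup>2 / (T\<^sup>2 - 4 * x\<^sup>2)" using pos T by (simp add: divide_simps)
    then have "2 / T * ((T\<^sup>2 + 4 * x\<^sup>2) / T\<^sup>2) \<le> 2 / T * (T\<^sup>2 / (T\<^sup>2 - 4 * x\<^sup>2))"
      using T by (intro mult_left_mono) auto
    also have "\<dots> = 2 * T / (T\<^sup>2 - 4 * x\<^sup>2)" using T by (simp add: field_simps power2_eq_square)
    finally show ?thesis using nb[of 1 j] nb[of "-1" j] e T by (simp add: x_def add_divide_distrib)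
  qed
  have "1 / max (nsq z - 3) 6 = 1 / (T - 1)" using s by (simp add: T_def s_def max_def)
  also have "\<dots> \<le> (1 / T) * (1 + s / T\<^sup>2)"
  proof -
    have "(1 / T) * (1 + s / T\<^sup>2) = (T\<^sup>2 + s) / (T * T\<^sup>2)" using T by (simp add: field_simps)
    moreover have "T * T\<^sup>2 \<le> (T\<^sup>2 + s) * (T - 1)" unfolding T_def using s by (simp add: algebra_simps power2_eq_square)
    ultimately show ?thesis using T by (simp add: divide_simps)
  qed
  also have "\<dots> = (\<Sum>j\<in>(UNIV::4 set). 2 / T * (1 + 4 * (real_of_int (z $ j))\<^sup>2 / T\<^sup>2)) / 8"
  proof -
    have "(\<Sum>j\<in>(UNIV::4 set). 2 / T * (1 + 4 * (real_of_int (z $ j))\<^sup>2 / T\<^sup>2)) = 2 / T * (4 + 4 * s / T\<^sup>2)"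
      by (simp add: sum_distrib_left[symmetric] sum.distrib sum_divide_distrib[symmetric] s_def sum_sq_coords)
    then show ?thesis using T by (simp add: field_simps)
  qed
  also have "\<dots> \<le> avg (\<lambda>y. 1 / max (nsq y - 3) 6) z"
    unfolding avg_axis by (intro divide_right_mono sum_mono trm) auto
  finally show "1 / max (nsq z - 3) 6 \<le> avg (\<lambda>y. 1 / max (nsq y - 3) 6) z" .
  have "avg (\<lambda>y. 1 / max (nsq y - 3) 6) z \<le> (\<Sum>j\<in>(UNIV::4 set). 6 / (s + 15) + 6 / (s + 15)) / 8"
    unfolding avg_axis
    by (intro divide_right_mono sum_mono add_mono conjunct1[OF conjunct2[OF nb]]) auto
  also have "\<dots> = 6 / (s + 15)" using s by (simp add: divide_simps)
  finally show "avg (\<lambda>y. 1 / max (nsq y - 3) 6) z \<le> 6 / (nsq z + 15)" by (simp add: s_def)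
qed

text \<open>In dimension four the Laplacian of ln |x|^2 is 4 / |x|^2, and the average exceeds the
  value by about one eighth of it, that is 1 / (2 |x|^2). The shift by 15 produces a surplus 64 /
  s^2 in the sum over the axes, which covers the second-order errors 40 / s^2.\<close>

lemma subharmonic_log: "ln (nsq z + 15) + 1 / (2 * (nsq z + 15)) \<le> avg (\<lambda>y. ln (nsq y + 15)) z"
proof -
  define s where "s = nsq z + 15"
  have s: "s \<ge> 15" using nsq_nonneg s_def by simp
  \<comment> \<open>The values of \<open>nsq + 15\<close> at the two neighbours along axis j
    multiply to s^2 (1 + d j), so their logarithms add up to 2 ln s + ln (1 + d j).\<close>
  define d where "d j = (2 * s + 1 - 4 * (real_of_int (z $ j))\<^sup>2) / s\<^sup>2" for j
  have trm: "2 * ln s + d j - 10 / s\<^sup>2 \<le> ln (nsq (z + axis j 1) + 15) + ln (nsq (z + axis j (- 1)) + 15)" for j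
  proof -
    define x where "x = real_of_int (z $ j)"
    have x: "x\<^sup>2 \<le> s - 15" "0 \<le> x\<^sup>2" using coord_le_nsq[of z j] by (auto simp: s_def x_def)
    have p: "s + 1 + 2 * x > 0" "s + 1 - 2 * x > 0"
      using x zero_le_power2[of "x + 1"] zero_le_power2[of "x - 1"]
      by (auto simp: power2_eq_square algebra_simps)
    have n: "nsq (z + axis j 1) + 15 = s + 1 + 2 * x" "nsq (z + axis j (- 1)) + 15 = s + 1 - 2 * x"
      by (simp_all add: nsq_axis s_def x_def)
    have dx: "d j = (2 * s + 1 - 4 * x\<^sup>2) / s\<^sup>2" by (simp add: d_def x_def)
    have "\<bar>2 * s + 1 - 4 * x\<^sup>2\<bar> \<le> 2 * s + 1" using x s by (simp add: abs_le_iff)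
    also have "\<dots> \<le> (31 / 15) * s" using s by simp
    finally have a: "\<bar>d j\<bar> \<le> (31 / 15) / s" unfolding dx using s
      by (simp add: abs_divide divide_simps power2_eq_square)
    have b: "(31 / 15) / s \<le> 1 / 2" using s by (simp add: divide_simps)
    have d1: "\<bar>d j\<bar> \<le> 1 / 2" using a b by linarith
    then have "d j > -1" by linarith
    have "(d j)\<^sup>2 \<le> ((31 / 15) / s)\<^sup>2" using a by (metis abs_ge_zero power2_abs power_mono)
    also have "\<dots> = (961 / 225) / s\<^sup>2" by (simp add: power2_eq_square)
    also have "\<dots> \<le> 5 / s\<^sup>2" by (intro divide_right_mono) auto
    finally have c: "(d j)\<^sup>2 \<le> 5 / s\<^sup>2" .
    have "ln (s + 1 + 2 * x) + ln (s + 1 - 2 * x) = ln ((s + 1 + 2 * x) * (s + 1 - 2 * x))"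
      using p by (simp add: ln_mult_pos)
    also have "(s + 1 + 2 * x) * (s + 1 - 2 * x) = s\<^sup>2 * (1 + d j)"
      unfolding dx using s by (simp add: field_simps power2_eq_square)
    also have "ln \<dots> = 2 * ln s + ln (1 + d j)"
      using s \<open>d j > -1\<close> by (subst ln_mult_pos) (auto simp: ln_realpow)
    finally have e: "ln (s + 1 + 2 * x) + ln (s + 1 - 2 * x) = 2 * ln s + ln (1 + d j)" .
    have "\<bar>ln (1 + d j) - d j\<bar> \<le> 2 * (d j)\<^sup>2" using a b by (intro abs_ln_one_plus_x_minus_x_bound) linarith
    then have "ln (1 + d j) \<ge> d j - 10 / s\<^sup>2" using c by (simp add: abs_le_iff)
    then show ?thesis unfolding n e by simp
  qed
  have ds: "(\<Sum>j\<in>UNIV. d j) = (4 * s + 64) / s\<^sup>2"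
  proof -
    have "(\<Sum>j\<in>UNIV. d j) = (\<Sum>j\<in>(UNIV::4 set). 2 * s + 1 - 4 * (real_of_int (z $ j))\<^sup>2) / s\<^sup>2"
      unfolding d_def by (simp add: sum_divide_distrib)
    also have "(\<Sum>j\<in>(UNIV::4 set). 2 * s + 1 - 4 * (real_of_int (z $ j))\<^sup>2) = 8 * s + 4 - 4 * nsq z"
      by (simp add: sum_subtractf sum_distrib_left[symmetric] sum_sq_coords)
    finally show ?thesis by (simp add: s_def algebra_simps)
  qed
  have "ln s + 1 / (2 * s) \<le> (8 * ln s + (4 * s + 64) / s\<^sup>2 - 40 / s\<^sup>2) / 8"
    using s by (simp add: divide_simps power2_eq_square algebra_simps)
  also have "\<dots> = (\<Sum>j\<in>(UNIV::4 set). 2 * ln s + d j - 10 / s\<^sup>2) / 8"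
    by (simp add: sum_subtractf sum.distrib ds)
  also have "\<dots> \<le> avg (\<lambda>y. ln (nsq y + 15)) z"
    unfolding avg_axis by (intro divide_right_mono sum_mono trm) auto
  finally show ?thesis by (simp add: s_def)
qed

section \<open>The maximum principle and a barrier for the killed walk\<close>

definition nrm :: "site \<Rightarrow> real" where
  "nrm z = sqrt (nsq z)"

lemma nrm_eq_norm: "nrm z = norm (real_site z)"
  by (simp add: nrm_def nsq_def norm_vec_def L2_set_def real_site_def)

lemma nrm_triangle: "nrm (a + b) \<le> nrm a + nrm b"
proof -
  have "real_site (a + b) = real_site a + real_site b"
    by (simp add: real_site_def vec_eq_iff)
  then show ?thesis by (simp add: nrm_eq_norm norm_triangle_ineq)
qed

lemma nrm_minus: "nrm (- a) = nrm a"
  by (simp add: nrm_def nsq_def)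

lemma nrm_diff_commute: "nrm (a - b) = nrm (b - a)"
  using nrm_minus[of "a - b"] by simp

lemma nrm_triangle3: "nrm (a - c) \<le> nrm (a - b) + nrm (b - c)"
  using nrm_triangle[of "a - b" "b - c"] by simp

lemma nrm_nonneg [simp]: "0 \<le> nrm z"
  by (simp add: nrm_def nsq_nonneg)

lemma nrm_squared: "(nrm z)\<^sup>2 = nsq z"
  by (simp add: nrm_def nsq_nonneg)

lemma nrm_unit: "e \<in> unit_vectors \<Longrightarrow> nrm e = 1"
  unfolding unit_vectors_def nrm_def nsq_def by (auto simp: axis_def if_distrib[of "\<lambda>x. (real_of_int x)\<^sup>2"] cong: if_cong)

lemma coord_le_nrm: "\<bar>real_of_int (z $ j)\<bar> \<le> nrm z"
  unfolding nrm_def using coord_le_nsq[of z j] by (metis real_sqrt_abs real_sqrt_le_iff)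

lemma finite_coord_bounded: "finite {z::site. \<forall>j. \<bar>z $ j\<bar> \<le> B}"
proof -
  have "finite {f :: 4 \<Rightarrow> int. \<forall>j. f j \<in> {- B..B}}"
    using finite_set_of_finite_funs[of "UNIV :: 4 set" "{- B..B}" 0] by simp
  then have "finite ((\<lambda>f. \<chi> j. f j) ` {f :: 4 \<Rightarrow> int. \<forall>j. f j \<in> {- B..B}})" by simp
  moreover have "{z::site. \<forall>j. \<bar>z $ j\<bar> \<le> B} \<subseteq> (\<lambda>f. \<chi> j. f j) ` {f :: 4 \<Rightarrow> int. \<forall>j. f j \<in> {- B..B}}"
  proof
    fix z :: site assume z: "z \<in> {z. \<forall>j. \<bar>z $ j\<bar> \<le> B}"
    have "z = (\<chi> j. z $ j)" by simp
    moreover have "(\<lambda>j. z $ j) \<in> {f. \<forall>j. f j \<in> {- B..B}}" using z by (auto simp: abs_le_iff minus_le_iff)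
    ultimately show "z \<in> (\<lambda>f. \<chi> j. f j) ` {f. \<forall>j. f j \<in> {- B..B}}" by (rule image_eqI)
  qed
  ultimately show ?thesis by (rule finite_subset[rotated])
qed

lemma finite_nrm_ball: "finite {z. nrm (z - c) \<le> \<rho>}"
proof -
  have "{z. nrm z \<le> \<rho>} \<subseteq> {z. \<forall>j. \<bar>z $ j\<bar> \<le> \<lceil>\<rho>\<rceil>}"
  proof (clarsimp)
    fix z :: site and j assume "nrm z \<le> \<rho>"
    then have "real_of_int \<bar>z $ j\<bar> \<le> \<rho>" using coord_le_nrm[of z j] by simp
    then show "\<bar>z $ j\<bar> \<le> \<lceil>\<rho>\<rceil>" by linarith
  qed
  then have f: "finite {z. nrm z \<le> \<rho>}" using finite_coord_bounded finite_subset by blast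
  have "{z. nrm (z - c) \<le> \<rho>} \<subseteq> (\<lambda>z. z + c) ` {z. nrm z \<le> \<rho>}"
    by (auto simp: image_iff intro!: exI[of _ "_ - c"])
  with f show ?thesis using finite_subset by blast
qed

text \<open>If the maximum M over D were positive, then at a maximiser all neighbours would have the
  value M, because values outside are at most 0 and killing only lowers a positive average. A
  maximiser with the largest first coordinate contradicts this in the direction of the first
  axis.\<close>

lemma maximum_principle:
  fixes k :: "site \<Rightarrow> real"
  assumes fin: "finite D" and k: "\<And>z. z \<in> D \<Longrightarrow> 0 \<le> k z \<and> k z \<le> 1"
    and sub: "\<And>z. z \<in> D \<Longrightarrow> F z \<le> (1 - k z) * avg F z"
    and bd: "\<And>z e. z \<in> D \<Longrightarrow> e \<in> unit_vectors \<Longrightarrow> z + e \<notin> D \<Longrightarrow> F (z + e) \<le> 0"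
    and z: "z \<in> D"
  shows "F z \<le> 0"
proof (rule ccontr)
  assume pos: "\<not> F z \<le> 0"
  define M where "M = Max (F ` D)"
  have M: "\<And>y. y \<in> D \<Longrightarrow> F y \<le> M" using fin by (simp add: M_def)
  have M0: "M > 0" using M[OF z] pos by simp
  define E where "E = {y \<in> D. F y = M}"
  have "M \<in> F ` D" unfolding M_def using fin z by (intro Max_in) auto
  then have E: "finite E" "E \<noteq> {}" using fin by (auto simp: E_def)
  define c where "c = Max ((\<lambda>y. y $ (1::4)) ` E)"
  have "c \<in> (\<lambda>y. y $ (1::4)) ` E" unfolding c_def using E by (intro Max_in) auto
  then obtain y where y: "y \<in> E" "y $ 1 = c" by auto
  have cmax: "\<And>w. w \<in> E \<Longrightarrow> w $ 1 \<le> c" using E by (simp add: c_def)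
  have yD: "y \<in> D" "F y = M" using y by (auto simp: E_def)
  have le: "F (y + e) \<le> M" if "e \<in> unit_vectors" for e
    using M[of "y + e"] bd[OF yD(1) that] M0 by (cases "y + e \<in> D") auto
  define e1 :: site where "e1 = axis 1 1"
  have e1: "e1 \<in> unit_vectors" by (auto simp: e1_def unit_vectors_def)
  have "F (y + e1) < M"
  proof (cases "y + e1 \<in> D")
    case True
    have "y + e1 \<notin> E" using cmax[of "y + e1"] y(2) by (auto simp: e1_def axis_def)
    then show ?thesis using le[OF e1] True by (auto simp: E_def)
  next
    case False
    then show ?thesis using bd[OF yD(1) e1] M0 by simp
  qed
  then have "(\<Sum>e\<in>unit_vectors. F (y + e)) < (\<Sum>e\<in>unit_vectors. M)"
    by (intro sum_strict_mono_ex1 finite_unit_vectors) (use le e1 in auto)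
  then have "avg F y < M" unfolding avg_def using card_unit_vectors by simp
  moreover have "M \<le> (1 - k y) * avg F y" using sub[OF yD(1)] yD(2) by simp
  moreover have "(1 - k y) * avg F y \<le> (1 - k y) * M" using \<open>avg F y < M\<close> k[OF yD(1)]
    by (intro mult_left_mono) auto
  moreover have "(1 - k y) * avg F y < M"
  proof (cases "k y = 0")
    case False
    then have "(1 - k y) * M < 1 * M" using k[OF yD(1)] M0 by (intro mult_strict_right_mono) auto
    then show ?thesis using calculation by simp
  qed (use calculation in simp)
  ultimately show False by simp
qed

text \<open>
  The barrier bounds from below the Green function of the walk killed at rate at most \<open>lam\<close>: the
  logarithm compensates the killing, and the steep core function makes the origin the only
  point where the barrier fails to be subharmonic.
\<close>

definition barrier_main :: "real \<Rightarrow> real \<Rightarrow> site \<Rightarrow> real" where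
  "barrier_main lam Lam z = 1 / max (nsq z - 3) 6 - 12 * lam * (Lam - ln (nsq z + 15))"

text \<open>From z \<noteq> 0 some neighbour has \<open>nsq\<close> smaller by at least 1. With the
  ratio 10 this neighbour alone contributes 10/8 of the value at z to the average, which leaves room
  for killing up to 1/5. The factor 10^15 makes the core at least 1, hence larger than the main
  part, wherever \<open>nsq z \<le> 15\<close>.\<close>

definition barrier_core :: "site \<Rightarrow> real" where
  "barrier_core z = 10 ^ 15 / 10 ^ nat \<lfloor>nsq z\<rfloor>"

definition barrier :: "real \<Rightarrow> real \<Rightarrow> real \<Rightarrow> site \<Rightarrow> real" where
  "barrier lam Lam \<beta> z = max (barrier_main lam Lam z) (barrier_core z) - \<beta>"

text \<open>Killing costs at most \<open>lam\<close> times the average of the first term, that is 6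
  lam / (nsq z + 15). The coefficient 12 makes the gain 12 lam / (2 (nsq z + 15)) of the logarithm
  equal to this cost. Assumption \<open>nb\<close> keeps the logarithmic correction nonpositive on
  average, so the killed part is bounded by the first term alone.\<close>

lemma barrier_main_sub:
  assumes z: "nsq z \<ge> 16" and k: "0 \<le> k" "k \<le> lam" "lam \<le> 1"
    and nb: "\<And>e. e \<in> unit_vectors \<Longrightarrow> ln (nsq (z + e) + 15) \<le> Lam"
  shows "barrier_main lam Lam z \<le> (1 - k) * avg (barrier_main lam Lam) z"
proof -
  define \<phi> where "\<phi> = (\<lambda>z. 1 / max (nsq z - 3) 6)"
  define l where "l = (\<lambda>z. ln (nsq z + 15))"
  have bm: "barrier_main lam Lam = (\<lambda>y. \<phi> y - 12 * lam * (Lam - l y))"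
    by (auto simp: fun_eq_iff barrier_main_def \<phi>_def l_def)
  have av: "avg (barrier_main lam Lam) z = avg \<phi> z - 12 * lam * (Lam - avg l z)"
    unfolding bm by (simp add: avg_diff avg_cmult)
  have s: "nsq z + 15 > 0" using z by simp
  have a1: "\<phi> z \<le> avg \<phi> z" "avg \<phi> z \<le> 6 / (nsq z + 15)" unfolding \<phi>_def using subharmonic_inverse[OF z] by auto
  have a2: "l z + 1 / (2 * (nsq z + 15)) \<le> avg l z" unfolding l_def by (rule subharmonic_log)
  have a3: "avg l z \<le> Lam" using avg_mono[of l z "\<lambda>_. Lam"] nb by (simp add: l_def)
  have lam: "0 \<le> lam" using k by simp
  have p0: "0 \<le> avg \<phi> z" by (intro avg_nonneg) (auto simp: \<phi>_def)
  have up: "avg (barrier_main lam Lam) z \<le> avg \<phi> z" unfolding av using lam a3 by simp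
  have "k * avg (barrier_main lam Lam) z \<le> lam * avg \<phi> z"
  proof -
    have "k * avg (barrier_main lam Lam) z \<le> k * avg \<phi> z" using up k by (intro mult_left_mono) auto
    also have "\<dots> \<le> lam * avg \<phi> z" using k p0 by (intro mult_right_mono) auto
    finally show ?thesis .
  qed
  also have "\<dots> \<le> lam * (6 / (nsq z + 15))" using a1 lam by (intro mult_left_mono) auto
  also have "\<dots> = 12 * lam * (1 / (2 * (nsq z + 15)))" using s by (simp add: divide_simps)
  finally have kk: "k * avg (barrier_main lam Lam) z \<le> 12 * lam * (1 / (2 * (nsq z + 15)))" .
  have "12 * lam * (l z + 1 / (2 * (nsq z + 15))) \<le> 12 * lam * avg l z"
    using a2 lam by (intro mult_left_mono) auto
  then have ll: "12 * lam * l z + 12 * lam * (1 / (2 * (nsq z + 15))) \<le> 12 * lam * avg l z"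
    by (simp only: distrib_left)
  have "\<phi> z - 12 * lam * (Lam - l z) \<le> avg \<phi> z - 12 * lam * (Lam - avg l z) - k * avg (barrier_main lam Lam) z"
    using a1(1) kk ll by (simp add: right_diff_distrib)
  then show ?thesis using av by (simp add: bm left_diff_distrib)
qed

lemma barrier_core_nonneg [simp]: "0 \<le> barrier_core z"
  by (simp add: barrier_core_def)

lemma barrier_core_sub:
  assumes z: "z \<noteq> 0" and k: "k \<le> 1 / 5"
  shows "barrier_core z \<le> (1 - k) * avg barrier_core z"
proof -
  obtain j where j: "z $ j \<noteq> 0" using z by (auto simp: vec_eq_iff)
  define e :: site where "e = axis j (- sgn (z $ j))"
  have e: "e \<in> unit_vectors" using j by (auto simp: e_def unit_vectors_def sgn_if)
  obtain m :: int where m: "nsq z = of_int m" using nsq_eq_int by blast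
  have m1: "m \<ge> 1" using nsq_ge_1[OF z] m by simp
  have "nsq (z + e) = nsq z - 2 * \<bar>real_of_int (z $ j)\<bar> + 1"
    unfolding e_def nsq_axis using j by (auto simp: sgn_if)
  moreover have "\<bar>real_of_int (z $ j)\<bar> \<ge> 1" using j by linarith
  ultimately have le: "nsq (z + e) \<le> of_int (m - 1)" using m by simp
  then have fl: "nat \<lfloor>nsq (z + e)\<rfloor> \<le> nat (m - 1)" by (intro nat_mono) linarith
  have fl2: "nat \<lfloor>nsq z\<rfloor> = Suc (nat (m - 1))" using m m1 by simp
  have "10 * barrier_core z = 10 ^ 15 / 10 ^ nat (m - 1)" by (simp add: barrier_core_def fl2)
  also have "\<dots> \<le> barrier_core (z + e)" unfolding barrier_core_def
    by (intro divide_left_mono power_increasing fl mult_pos_pos) auto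
  also have "\<dots> \<le> (\<Sum>e\<in>unit_vectors. barrier_core (z + e))"
    using e finite_unit_vectors by (intro member_le_sum) auto
  finally have a: "10 / 8 * barrier_core z \<le> avg barrier_core z" by (simp add: avg_def)
  have "barrier_core z \<le> (4 / 5) * (10 / 8 * barrier_core z)" by simp
  also have "\<dots> \<le> (1 - k) * avg barrier_core z"
    using a k by (intro mult_mono) auto
  finally show ?thesis .
qed

text \<open>A maximum inherits the inequality at z from whichever function attains it there; the
  core is the larger one as long as \<open>nsq z < 16\<close>, where the main part is not
  controlled. Subtracting \<open>\<beta>\<close> is harmless because killing gives
  \<open>k * \<beta>\<close> back.\<close>

lemma barrier_sub:
  assumes z: "z \<noteq> 0" and k: "0 \<le> k" "k \<le> lam" "lam \<le> 1 / 5" and \<beta>: "\<beta> \<ge> 0"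
    and nb: "\<And>e. e \<in> unit_vectors \<Longrightarrow> ln (nsq (z + e) + 15) \<le> Lam" and zl: "ln (nsq z + 15) \<le> Lam"
  shows "barrier lam Lam \<beta> z \<le> (1 - k) * avg (barrier lam Lam \<beta>) z"
proof -
  define G where "G = (\<lambda>y. max (barrier_main lam Lam y) (barrier_core y))"
  have av: "avg (barrier lam Lam \<beta>) z = avg G z - \<beta>"
    unfolding barrier_def[abs_def] G_def by (simp add: avg_diff)
  have g: "avg (barrier_main lam Lam) z \<le> avg G z" "avg barrier_core z \<le> avg G z"
    by (auto intro!: avg_mono simp: G_def)
  have k1: "0 \<le> 1 - k" using k by simp
  have G: "G z \<le> (1 - k) * avg G z"
  proof (cases "barrier_main lam Lam z \<le> barrier_core z")
    case True
    then have "G z = barrier_core z" by (simp add: G_def)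
    also have "\<dots> \<le> (1 - k) * avg barrier_core z" using k by (intro barrier_core_sub z) auto
    also have "\<dots> \<le> (1 - k) * avg G z" using g k1 by (intro mult_left_mono)
    finally show ?thesis .
  next
    case False
    have "nsq z \<ge> 16"
    proof (rule ccontr)
      assume n: "\<not> nsq z \<ge> 16"
      obtain m :: int where m: "nsq z = of_int m" using nsq_eq_int by blast
      have "m \<le> 15" using n m by simp
      then have "nat \<lfloor>nsq z\<rfloor> \<le> 15" using m by simp
      then have "(10::real) ^ nat \<lfloor>nsq z\<rfloor> \<le> 10 ^ 15" by (intro power_increasing) auto
      then have "1 \<le> barrier_core z" by (simp add: barrier_core_def)
      moreover have "barrier_main lam Lam z \<le> 1 / max (nsq z - 3) 6"
        unfolding barrier_main_def using k zl by simp
      moreover have "1 / max (nsq z - 3) 6 \<le> 1 / 1" by (intro divide_left_mono) (auto simp: max_def)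
      ultimately show False using False by simp
    qed
    from False have "G z = barrier_main lam Lam z" by (simp add: G_def)
    also have "\<dots> \<le> (1 - k) * avg (barrier_main lam Lam) z"
      using k by (intro barrier_main_sub \<open>nsq z \<ge> 16\<close> nb) auto
    also have "\<dots> \<le> (1 - k) * avg G z" using g k1 by (intro mult_left_mono)
    finally show ?thesis .
  qed
  have "k * \<beta> \<ge> 0" using k \<beta> by simp
  with G show ?thesis unfolding av by (simp add: barrier_def G_def algebra_simps)
qed

lemma power10_ge: "m \<ge> 17 \<Longrightarrow> real m * 10 ^ 15 \<le> 10 ^ m"
proof (induction m rule: nat_induct_at_least)
  case (Suc n)
  then show ?case by simp
qed simp

text \<open>At distance 8 \<rho> both parts have dropped below 1 / (32 \<rho>^2). In
  \<open>harnack_ball\<close> this is a lower bound for the distance from the charge to the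
  complement of the domain.\<close>

lemma barrier_outside:
  assumes "nsq z \<ge> 64 * \<rho>\<^sup>2" "\<rho> \<ge> 1" "0 \<le> lam" "ln (nsq z + 15) \<le> Lam"
  shows "barrier lam Lam (1 / (32 * \<rho>\<^sup>2)) z \<le> 0"
proof -
  have r: "\<rho>\<^sup>2 \<ge> 1" using assms by simp
  obtain m :: int where m: "nsq z = of_int m" using nsq_eq_int by blast
  have m64: "m \<ge> 64" using m assms r by linarith
  have "barrier_main lam Lam z \<le> 1 / max (nsq z - 3) 6"
    unfolding barrier_main_def using assms by simp
  also have "\<dots> \<le> 1 / (32 * \<rho>\<^sup>2)" using assms(1) r by (intro divide_left_mono mult_pos_pos) (auto simp: max_def)
  finally have 1: "barrier_main lam Lam z \<le> 1 / (32 * \<rho>\<^sup>2)" .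
  have "real (nat m) * 10 ^ 15 \<le> 10 ^ nat m" using m64 by (intro power10_ge) auto
  then have "barrier_core z \<le> 1 / nsq z" using m m64 by (simp add: barrier_core_def divide_simps mult_ac)
  also have "\<dots> \<le> 1 / (32 * \<rho>\<^sup>2)"
  proof (intro divide_left_mono mult_pos_pos)
    show "32 * \<rho>\<^sup>2 \<le> nsq z" "0 < nsq z" using assms(1) r by linarith+
  qed (use r in auto)
  finally show ?thesis using 1 by (simp add: barrier_def)
qed

text \<open>In this range of distances the first term is at least 1 / (16 \<rho>^2). The logarithmic
  correction is at most 12 lam ln 1600 \<le> 120 lam, and 7680 = 120 * 64 makes it at most 1 / (64
  \<rho>^2). Removing this and the constant 1 / (32 \<rho>^2) leaves a quarter of the first
  term.\<close>

lemma barrier_lower: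
  assumes n: "\<rho>\<^sup>2 / 4 \<le> nsq z" "nsq z \<le> 16 * \<rho>\<^sup>2" and "\<rho> \<ge> 1" "0 \<le> lam" "lam * \<rho>\<^sup>2 \<le> 1 / 7680"
  shows "1 / (64 * \<rho>\<^sup>2) \<le> barrier lam (ln (400 * \<rho>\<^sup>2)) (1 / (32 * \<rho>\<^sup>2)) z"
proof -
  have r: "\<rho>\<^sup>2 \<ge> 1" using assms by simp
  have a: "1 / (16 * \<rho>\<^sup>2) \<le> 1 / max (nsq z - 3) 6" using n r by (intro divide_left_mono mult_pos_pos) (auto simp: max_def)
  have "ln (400 * \<rho>\<^sup>2) - ln (nsq z + 15) = ln (400 * \<rho>\<^sup>2 / (nsq z + 15))"
    using r nsq_nonneg[of z] by (subst ln_div) auto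
  also have "\<dots> \<le> ln 1600"
    using r nsq_nonneg[of z] n by (subst ln_le_cancel_iff) (auto simp: divide_simps add_pos_nonneg add_nonneg_pos)
  also have "\<dots> \<le> 10"
  proof -
    have "(5 / 2 :: real) \<le> exp 1" using exp_lower_Taylor_quadratic[of "1::real"] by simp
    then have "(5 / 2 :: real) ^ 10 \<le> exp 1 ^ 10" by (intro power_mono) auto
    also have "exp (1::real) ^ 10 = exp 10" using exp_of_nat_mult[of 10 "1::real"] by simp
    finally have "1600 \<le> exp (10::real)" by (simp add: power_divide)
    then show ?thesis by (metis ln_ge_iff ln_exp ln_le_cancel_iff exp_gt_zero zero_less_numeral)
  qed
  finally have l: "ln (400 * \<rho>\<^sup>2) - ln (nsq z + 15) \<le> 10" .
  have "12 * lam * (ln (400 * \<rho>\<^sup>2) - ln (nsq z + 15)) \<le> 12 * lam * 10"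
    using l assms by (intro mult_left_mono) auto
  also have "\<dots> \<le> 1 / (64 * \<rho>\<^sup>2)" using assms(3,5) by (simp add: divide_simps mult_ac)
  finally have b: "12 * lam * (ln (400 * \<rho>\<^sup>2) - ln (nsq z + 15)) \<le> 1 / (64 * \<rho>\<^sup>2)" .
  have "1 / (16 * \<rho>\<^sup>2) - 1 / (64 * \<rho>\<^sup>2) - 1 / (32 * \<rho>\<^sup>2) = 1 / (64 * \<rho>\<^sup>2)"
    using r by (simp add: field_simps)
  then show ?thesis using a b unfolding barrier_def barrier_main_def by linarith
qed

text \<open>By \<open>barrier_sub\<close> the positive charge of the barrier sits at the origin. Its
  mass is bounded here, so that the barrier divided by 10^15 can be compared with the potential of a
  unit charge.\<close>

lemma barrier_at_0: "0 \<le> \<beta> \<Longrightarrow> 0 \<le> lam \<Longrightarrow> ln 15 \<le> Lam \<Longrightarrow> 0 \<le> k \<Longrightarrow> k \<le> 1 \<Longrightarrow>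
  barrier lam Lam \<beta> 0 - (1 - k) * avg (barrier lam Lam \<beta>) 0 \<le> 10 ^ 15"
proof -
  assume a: "0 \<le> \<beta>" "0 \<le> lam" "ln 15 \<le> Lam" "0 \<le> k" "k \<le> 1"
  have n0: "nsq 0 = 0" by (simp add: nsq_def)
  have "barrier_main lam Lam 0 \<le> 1"
  proof -
    have "0 \<le> 12 * lam * (Lam - ln (0 + 15))" using a by (intro mult_nonneg_nonneg) auto
    moreover have "1 / max (0 - 3) 6 \<le> (1::real)" by simp
    ultimately show ?thesis unfolding barrier_main_def n0 by linarith
  qed
  then have 1: "barrier lam Lam \<beta> 0 \<le> 10 ^ 15 - \<beta>" by (simp add: barrier_def barrier_core_def n0)
  have "avg (\<lambda>_. - \<beta>) 0 \<le> avg (barrier lam Lam \<beta>) 0"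
    by (intro avg_mono) (auto simp: barrier_def intro: max.coboundedI2)
  then have "(1 - k) * (- \<beta>) \<le> (1 - k) * avg (barrier lam Lam \<beta>) 0" using a by (intro mult_left_mono) auto
  moreover have "k * \<beta> \<ge> 0" using a by simp
  ultimately show ?thesis using 1 by (simp add: algebra_simps)
qed

section \<open>The Harnack inequality for the killed walk\<close>

definition reduced_step :: "(site \<Rightarrow> real) \<Rightarrow> site set \<Rightarrow> site set \<Rightarrow> (site \<Rightarrow> real) \<Rightarrow> (site \<Rightarrow> real) \<Rightarrow> site \<Rightarrow> real" where
  "reduced_step k B D u g z = (if z \<in> B then u z else if z \<in> D then (1 - k z) * avg g z else 0)"

text \<open>\<open>v z\<close> is the expectation of \<open>u\<close> at the place where the killed
  walk enters B, on the event that this happens before it leaves D. It is the increasing limit of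
  the iterates of \<open>reduced_step\<close> from 0; they stay below \<open>u\<close> because one
  step applied to \<open>u\<close> does not exceed \<open>u\<close>.\<close>

lemma reduced_function:
  fixes k u :: "site \<Rightarrow> real"
  assumes k: "\<And>z. z \<in> D \<Longrightarrow> 0 \<le> k z \<and> k z \<le> 1" and u: "\<And>z. 0 \<le> u z"
    and harm: "\<And>z. z \<in> D \<Longrightarrow> u z = (1 - k z) * avg u z"
  obtains v where "\<And>z. z \<in> B \<Longrightarrow> v z = u z" "\<And>z. z \<in> D - B \<Longrightarrow> v z = (1 - k z) * avg v z"
    "\<And>z. z \<notin> B \<union> D \<Longrightarrow> v z = 0" "\<And>z. 0 \<le> v z" "\<And>z. v z \<le> u z"
proof -
  define T where "T = reduced_step k B D u"
  define g where "g n = (T ^^ n) (\<lambda>_. 0)" for n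
  have mono: "T f z \<le> T h z" if "\<And>z. f z \<le> h z" for f h z
    unfolding T_def reduced_step_def using k that by (auto intro!: mult_left_mono avg_mono)
  have Tu: "T u z \<le> u z" for z
    unfolding T_def reduced_step_def using harm u by auto
  have T0: "0 \<le> T (\<lambda>_. 0) z" for z
    unfolding T_def reduced_step_def using u by auto
  have gS: "g (Suc n) = T (g n)" for n by (simp add: g_def)
  have inc: "g n z \<le> g (Suc n) z" for n z
  proof (induction n arbitrary: z)
    case 0
    show ?case using T0 by (simp add: g_def)
  next
    case (Suc n)
    then show ?case unfolding gS[of "Suc n"] gS[of n] using mono Suc gS by metis
  qed
  have le: "g n z \<le> u z" for n z
  proof (induction n arbitrary: z)
    case 0
    show ?case using u by (simp add: g_def)
  next
    case (Suc n)
    then show ?case unfolding gS using mono[of "g n" u z] Tu[of z] by (meson order_trans)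
  qed
  have "convergent (\<lambda>n. g n z)" for z
  proof -
    have "incseq (\<lambda>n. g n z)" using inc by (rule incseq_SucI)
    moreover have "\<forall>n. g n z \<le> u z" using le by simp
    ultimately obtain L where "(\<lambda>n. g n z) \<longlonglongrightarrow> L" by (rule incseq_convergent)
    then show ?thesis by (rule convergentI)
  qed
  then have lim: "\<And>z. (\<lambda>n. g n z) \<longlonglongrightarrow> lim (\<lambda>n. g n z)" by (simp add: convergent_LIMSEQ_iff)
  define v where "v z = lim (\<lambda>n. g n z)" for z
  have lim: "(\<lambda>n. g n z) \<longlonglongrightarrow> v z" for z using lim by (simp add: v_def)
  have "T v z = v z" for z
  proof -
    have "(\<lambda>n. T (g n) z) \<longlonglongrightarrow> T v z"
      unfolding T_def reduced_step_def avg_def using lim by (auto intro!: tendsto_intros)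
    moreover have "(\<lambda>n. T (g n) z) \<longlonglongrightarrow> v z"
      using LIMSEQ_Suc[OF lim[of z]] by (simp add: gS)
    ultimately show ?thesis by (rule LIMSEQ_unique)
  qed
  moreover have "0 \<le> v z" for z
  proof -
    have "0 \<le> g n z" for n 
    proof (induction n)
      case (Suc n)
      then show ?case using inc[of n z] by simp
    qed (simp add: g_def)
    then show ?thesis using LIMSEQ_le_const[OF lim[of z]] by blast
  qed
  moreover have "v z \<le> u z" for z using LIMSEQ_le_const2[OF lim[of z]] le by blast
  ultimately show ?thesis
    by (intro that[of v]) (metis T_def reduced_step_def Diff_iff Un_iff)+
qed

text \<open>
  Replace \<open>u\<close> by its reduced function \<open>v\<close> on the ball of radius \<open>2 \<rho>\<close>. It is the potential of a
  positive charge \<open>\<nu>\<close> carried by the boundary of that ball, so that the maximum principle squeezes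
  \<open>v\<close> between sums, weighted by \<open>\<nu>\<close>, of translates of the superharmonic function and of the
  barrier. Both are of order \<open>\<rho>\<^sup>-\<^sup>2\<close> at the distances that occur.
\<close>

lemma harnack_ball:
  fixes k u :: "site \<Rightarrow> real" and \<rho> lam :: real
  assumes \<rho>: "\<rho> \<ge> 2" and k: "\<And>z. nrm (z - c) < 10 * \<rho> \<Longrightarrow> 0 \<le> k z \<and> k z \<le> lam"
    and lam: "lam * \<rho>\<^sup>2 \<le> 1 / 7680"
    and u: "\<And>z. 0 \<le> u z"
    and harm: "\<And>z. nrm (z - c) < 10 * \<rho> \<Longrightarrow> u z = (1 - k z) * avg u z"
    and x: "nrm (x - c) \<le> \<rho>" and y: "nrm (y - c) \<le> \<rho>"
  shows "u x \<le> 14336 * 10 ^ 15 * u y"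
proof -
  \<comment> \<open>The radii keep all relevant distances of order \<rho>: the charge lies further
    than 2 \<rho> - 1 from c, hence at least \<rho> / 2 from x and y since \<rho> \<ge> 2, and at
    least 8 \<rho> away from the complement of D.\<close>
  define D where "D = {z. nrm (z - c) < 10 * \<rho>}"
  define B where "B = {z. nrm (z - c) \<le> 2 * \<rho>}"
  define \<beta> where "\<beta> = 1 / (32 * \<rho>\<^sup>2)"
  \<comment> \<open>Sites up to one step outside D are within 13 \<rho> of the charge, and 169
    \<rho>^2 + 15 \<le> 400 \<rho>^2.\<close>
  define Lam where "Lam = ln (400 * \<rho>\<^sup>2)"
  have finD: "finite D" unfolding D_def by (rule finite_subset[OF _ finite_nrm_ball[of c "10 * \<rho>"]]) auto
  have finB: "finite B" unfolding B_def by (rule finite_nrm_ball)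
  have BD: "B \<subseteq> D" using \<rho> by (auto simp: B_def D_def)
  have r2: "\<rho>\<^sup>2 \<ge> 4" using power_mono[of 2 \<rho> 2] \<rho> by simp
  have lam0: "0 \<le> lam" using k[of c] \<rho> by (simp add: nrm_def nsq_def)
  have lam5: "lam \<le> 1 / 5"
  proof -
    have "lam * 4 \<le> lam * \<rho>\<^sup>2" using r2 lam0 by (intro mult_left_mono) auto
    then show ?thesis using lam by simp
  qed
  have kD: "\<And>z. z \<in> D \<Longrightarrow> 0 \<le> k z \<and> k z \<le> 1" using k lam5 by (force simp: D_def)
  have harmD: "\<And>z. z \<in> D \<Longrightarrow> u z = (1 - k z) * avg u z" using harm by (simp add: D_def)
  obtain v where vB: "\<And>z. z \<in> B \<Longrightarrow> v z = u z" and vDB: "\<And>z. z \<in> D - B \<Longrightarrow> v z = (1 - k z) * avg v z"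
    and vO: "\<And>z. z \<notin> B \<union> D \<Longrightarrow> v z = 0" and v0: "\<And>z. 0 \<le> v z" and vu: "\<And>z. v z \<le> u z"
    using reduced_function[of D k u B] kD u harmD by blast
  have vO: "\<And>z. z \<notin> D \<Longrightarrow> v z = 0" using vO BD by auto
  define \<nu> where "\<nu> z = v z - (1 - k z) * avg v z" for z
  \<comment> \<open>On B, v equals u at the site and is at most u at the neighbours, so harmonicity
    of u makes the charge nonnegative. It vanishes when all neighbours lie in B as well, and off B
    by harmonicity of v.\<close>
  have \<nu>0: "\<nu> z \<ge> 0" if "z \<in> D" for z
  proof (cases "z \<in> B")
    case True
    have "(1 - k z) * avg v z \<le> (1 - k z) * avg u z" using vu kD[OF that] by (intro mult_left_mono avg_mono) auto
    then show ?thesis using harmD[OF that] vB[OF True] by (simp add: \<nu>_def)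
  qed (use that vDB in \<open>simp add: \<nu>_def\<close>)
  define W where "W = {w \<in> B. nrm (w - c) > 2 * \<rho> - 1}"
  have finW: "finite W" using finB by (simp add: W_def)
  have WD: "W \<subseteq> D" using BD by (auto simp: W_def)
  have \<nu>W: "\<nu> z = 0" if z: "z \<in> D" "z \<notin> W" for z
  proof (cases "z \<in> B")
    case True
    have "z + e \<in> B" if e: "e \<in> unit_vectors" for e
      using nrm_triangle[of "z - c" e] nrm_unit[OF e] z(2) True by (auto simp: W_def B_def algebra_simps)
    then have "avg v z = avg u z" by (intro avg_cong vB) auto
    then show ?thesis using harmD[OF z(1)] vB[OF True] by (simp add: \<nu>_def)
  qed (use z vDB in \<open>simp add: \<nu>_def\<close>)
  define f where "f = (\<lambda>z. 1 / (nsq z + 7))"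
  define \<Phi> where "\<Phi> = barrier lam Lam \<beta>"
  have f0: "f z > 0" for z using nsq_nonneg[of z] by (simp add: f_def)
  have vW: "v z - (1 - k z) * avg v z = (\<Sum>w\<in>W. if w = z then \<nu> w else 0)" if "z \<in> D" for z
    using \<nu>W[OF that] finW by (auto simp: \<nu>_def sum.delta)
  have upper: "v z - (\<Sum>w\<in>W. 56 * \<nu> w * f (z - w)) \<le> 0" if z: "z \<in> D" for z
  proof (rule maximum_principle[OF finD kD _ _ z])
    fix z assume z: "z \<in> D"
    define U where "U = (\<lambda>z. \<Sum>w\<in>W. 56 * \<nu> w * f (z - w))"
    have "(1 - k z) * avg U z \<le> 1 * avg U z"
      using kD[OF z] \<nu>0 WD f0 by (intro mult_right_mono avg_nonneg) (auto simp: U_def intro!: sum_nonneg mult_nonneg_nonneg less_imp_le[OF f0])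
    then have 1: "U z - (1 - k z) * avg U z \<ge> U z - avg U z" by simp
    have "U z - avg U z = (\<Sum>w\<in>W. 56 * \<nu> w * (f (z - w) - avg f (z - w)))"
      unfolding U_def by (simp add: avg_sum avg_cmult avg_shift sum_subtractf right_diff_distrib)
    also have "\<dots> \<ge> (\<Sum>w\<in>W. if w = z then \<nu> w else 0)"
    proof (rule sum_mono)
      fix w assume "w \<in> W"
      then have w: "\<nu> w \<ge> 0" using \<nu>0 WD by auto
      show "(if w = z then \<nu> w else 0) \<le> 56 * \<nu> w * (f (z - w) - avg f (z - w))"
      proof (cases "w = z")
        case True
        have e: "f 0 - avg f 0 = 1 / 56" unfolding f_def by (rule superharmonic_inverse_at_0)
        have e': "56 * \<nu> w * (f (z - w) - avg f (z - w)) = \<nu> w" unfolding True diff_self e by simp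
        show ?thesis unfolding if_P[OF True] e' by (rule order_refl)
      next
        case False
        have "avg f (z - w) \<le> f (z - w)" unfolding f_def by (rule superharmonic_inverse)
        then show ?thesis using w False by simp
      qed
    qed
    finally have 2: "U z - avg U z \<ge> (\<Sum>w\<in>W. if w = z then \<nu> w else 0)" .
    have "avg (\<lambda>z. v z - U z) z = avg v z - avg U z" by (rule avg_diff)
    then show "v z - (\<Sum>w\<in>W. 56 * \<nu> w * f (z - w)) \<le> (1 - k z) * avg (\<lambda>z. v z - (\<Sum>w\<in>W. 56 * \<nu> w * f (z - w))) z"
      using 1 2 vW[OF z] unfolding U_def by (simp add: right_diff_distrib)
  next
    fix z e assume "z + e \<notin> D"
    then show "v (z + e) - (\<Sum>w\<in>W. 56 * \<nu> w * f (z + e - w)) \<le> 0"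
      using vO \<nu>0 WD by (auto intro!: sum_nonneg mult_nonneg_nonneg less_imp_le[OF f0])
  qed
  have near: "nsq (z - w) + 15 \<le> 400 * \<rho>\<^sup>2" "ln (nsq (z - w) + 15) \<le> Lam" if "w \<in> W" "nrm (z - c) \<le> 10 * \<rho> + 1" for z w
  proof -
    have "nrm (z - w) \<le> 13 * \<rho>"
      using nrm_triangle3[of z w c] nrm_diff_commute[of c w] that \<rho> by (auto simp: W_def B_def)
    then have "(nrm (z - w))\<^sup>2 \<le> (13 * \<rho>)\<^sup>2" by (intro power_mono) auto
    then have "nsq (z - w) \<le> 169 * \<rho>\<^sup>2" by (simp add: nrm_squared power_mult_distrib)
    then show g: "nsq (z - w) + 15 \<le> 400 * \<rho>\<^sup>2" using r2 by simp
    show "ln (nsq (z - w) + 15) \<le> Lam" unfolding Lam_def using g nsq_nonneg[of "z - w"] r2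
      by (subst ln_le_cancel_iff) auto
  qed
  have nbD: "nrm (z + e - c) \<le> 10 * \<rho> + 1" if "z \<in> D" "e \<in> unit_vectors" for z e
    using nrm_triangle[of "z - c" e] nrm_unit[OF that(2)] that(1) by (auto simp: D_def algebra_simps)
  have lower: "(\<Sum>w\<in>W. \<nu> w / 10 ^ 15 * \<Phi> (z - w)) - v z \<le> 0" if z: "z \<in> D" for z
  proof (rule maximum_principle[OF finD kD _ _ z])
    fix z assume z: "z \<in> D"
    define U where "U = (\<lambda>z. \<Sum>w\<in>W. \<nu> w / 10 ^ 15 * \<Phi> (z - w))"
    have avU: "avg U z = (\<Sum>w\<in>W. \<nu> w / 10 ^ 15 * avg \<Phi> (z - w))"
      by (simp only: U_def avg_sum avg_cmult avg_shift)
    have "U z - (1 - k z) * avg U z = (\<Sum>w\<in>W. \<nu> w / 10 ^ 15 * (\<Phi> (z - w) - (1 - k z) * avg \<Phi> (z - w)))"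
      unfolding avU unfolding U_def sum_distrib_left sum_subtractf[symmetric]
      by (intro sum.cong refl) (simp only: right_diff_distrib mult.left_commute)
    also have "\<dots> \<le> (\<Sum>w\<in>W. if w = z then \<nu> w else 0)"
    proof (rule sum_mono)
      fix w assume w: "w \<in> W"
      then have w0: "\<nu> w \<ge> 0" using \<nu>0 WD by auto
      have kz: "0 \<le> k z" "k z \<le> lam" using k z by (auto simp: D_def)
      show "\<nu> w / 10 ^ 15 * (\<Phi> (z - w) - (1 - k z) * avg \<Phi> (z - w)) \<le> (if w = z then \<nu> w else 0)"
      proof (cases "w = z")
        case True
        have "\<Phi> 0 - (1 - k z) * avg \<Phi> 0 \<le> 10 ^ 15" unfolding \<Phi>_def
          using lam0 kD[OF z] near(2)[OF w, of w] w r2 \<rho> by (intro barrier_at_0) (auto simp: \<beta>_def W_def B_def nsq_def)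
        then have "\<nu> w / 10 ^ 15 * (\<Phi> 0 - (1 - k z) * avg \<Phi> 0) \<le> \<nu> w / 10 ^ 15 * 10 ^ 15"
          using w0 by (intro mult_left_mono) auto
        then show ?thesis using True by simp
      next
        case False
        have "\<Phi> (z - w) \<le> (1 - k z) * avg \<Phi> (z - w)" unfolding \<Phi>_def
        proof (rule barrier_sub)
          show "ln (nsq (z - w + e) + 15) \<le> Lam" if "e \<in> unit_vectors" for e
            using near(2)[OF w nbD[OF z that]] by (simp add: algebra_simps)
          show "ln (nsq (z - w) + 15) \<le> Lam" using near(2)[OF w, of z] z by (simp add: D_def)
        qed (use False kz lam5 r2 in \<open>auto simp: \<beta>_def\<close>)
        then show ?thesis using w0 False by (simp add: mult_nonneg_nonpos)
      qed
    qed
    finally have "U z - (1 - k z) * avg U z \<le> v z - (1 - k z) * avg v z" using vW[OF z] by simp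
    moreover have "avg (\<lambda>z. U z - v z) z = avg U z - avg v z" by (rule avg_diff)
    ultimately show "(\<Sum>w\<in>W. \<nu> w / 10 ^ 15 * \<Phi> (z - w)) - v z \<le> (1 - k z) * avg (\<lambda>z. (\<Sum>w\<in>W. \<nu> w / 10 ^ 15 * \<Phi> (z - w)) - v z) z"
      unfolding U_def by (simp add: right_diff_distrib)
  next
    fix z e assume z: "z \<in> D" and e: "e \<in> unit_vectors" and o: "z + e \<notin> D"
    have "\<Phi> (z + e - w) \<le> 0" if w: "w \<in> W" for w
      unfolding \<Phi>_def \<beta>_def
    proof (rule barrier_outside)
      have "8 * \<rho> \<le> nrm (z + e - w)"
        using nrm_triangle3[of "z + e" c w] w o by (auto simp: W_def B_def D_def)
      then have "(8 * \<rho>)\<^sup>2 \<le> (nrm (z + e - w))\<^sup>2" using \<rho> by (intro power_mono) auto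
      then show "64 * \<rho>\<^sup>2 \<le> nsq (z + e - w)" by (simp add: nrm_squared power_mult_distrib)
    qed (use \<rho> lam0 near(2)[OF w nbD[OF z e]] in auto)
    then have "(\<Sum>w\<in>W. \<nu> w / 10 ^ 15 * \<Phi> (z + e - w)) \<le> 0"
      using \<nu>0 WD by (intro sum_nonpos mult_nonneg_nonpos) auto
    then show "(\<Sum>w\<in>W. \<nu> w / 10 ^ 15 * \<Phi> (z + e - w)) - v (z + e) \<le> 0" using v0[of "z + e"] by linarith
  qed
  have xyD: "x \<in> B" "y \<in> B" "x \<in> D" "y \<in> D" using x y \<rho> by (auto simp: B_def D_def)
  have dist: "\<rho>\<^sup>2 / 4 \<le> nsq (z - w)" "nsq (z - w) \<le> 16 * \<rho>\<^sup>2" if "nrm (z - c) \<le> \<rho>" "w \<in> W" for z w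
  proof -
    have "\<rho> / 2 \<le> nrm (z - w)" using nrm_triangle3[of w c z] nrm_diff_commute[of w z] that \<rho> by (auto simp: W_def B_def)
    then have "(\<rho> / 2)\<^sup>2 \<le> (nrm (z - w))\<^sup>2" using \<rho> by (intro power_mono) auto
    then show "\<rho>\<^sup>2 / 4 \<le> nsq (z - w)" by (simp add: nrm_squared power_divide)
    have "nrm (z - w) \<le> 4 * \<rho>" using nrm_triangle3[of z w c] nrm_diff_commute[of c w] that \<rho> by (auto simp: W_def B_def)
    then have "(nrm (z - w))\<^sup>2 \<le> (4 * \<rho>)\<^sup>2" by (intro power_mono) auto
    then show "nsq (z - w) \<le> 16 * \<rho>\<^sup>2" by (simp add: nrm_squared power_mult_distrib)
  qed
  define N where "N = (\<Sum>w\<in>W. \<nu> w)"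
  have "u x = v x" using vB xyD by simp
  also have "\<dots> \<le> (\<Sum>w\<in>W. 56 * \<nu> w * f (x - w))" using upper[OF xyD(3)] by simp
  also have "\<dots> \<le> (\<Sum>w\<in>W. 56 * \<nu> w * (4 / \<rho>\<^sup>2))"
  proof (intro sum_mono mult_left_mono)
    fix w assume w: "w \<in> W"
    have "f (x - w) \<le> 1 / (\<rho>\<^sup>2 / 4)" unfolding f_def
      using dist(1)[OF x w] r2 by (intro divide_left_mono mult_pos_pos) auto
    then show "f (x - w) \<le> 4 / \<rho>\<^sup>2" by simp
  qed (use \<nu>0 WD in auto)
  also have "\<dots> = 224 / \<rho>\<^sup>2 * N" by (simp add: N_def sum_distrib_right sum_divide_distrib mult_ac)
  finally have ux: "u x \<le> 224 / \<rho>\<^sup>2 * N" .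
  have "1 / (64 * \<rho>\<^sup>2) / 10 ^ 15 * N = (\<Sum>w\<in>W. \<nu> w / 10 ^ 15 * (1 / (64 * \<rho>\<^sup>2)))"
    by (simp add: N_def sum_distrib_right sum_divide_distrib mult_ac)
  also have "\<dots> \<le> (\<Sum>w\<in>W. \<nu> w / 10 ^ 15 * \<Phi> (y - w))"
  proof (intro sum_mono mult_left_mono)
    fix w assume w: "w \<in> W"
    show "1 / (64 * \<rho>\<^sup>2) \<le> \<Phi> (y - w)" unfolding \<Phi>_def \<beta>_def Lam_def
      using dist[OF y w] \<rho> lam0 lam by (intro barrier_lower) auto
  qed (use \<nu>0 WD in auto)
  also have "\<dots> \<le> v y" using lower[OF xyD(4)] by simp
  finally have uy: "1 / (64 * \<rho>\<^sup>2) / 10 ^ 15 * N \<le> u y" using vB xyD by simp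
  \<comment> \<open>14336 = 224 * 64: here 224 = 56 * 4 comes from the upper potential at distance
    at least \<rho> / 2, and 64 and 10^15 from the barrier.\<close>
  have eq: "224 / \<rho>\<^sup>2 * N = 14336 * 10 ^ 15 * (1 / (64 * \<rho>\<^sup>2) / 10 ^ 15 * N)" using r2 by simp
  note ux[unfolded eq]
  also have "14336 * 10 ^ 15 * (1 / (64 * \<rho>\<^sup>2) / 10 ^ 15 * N) \<le> 14336 * 10 ^ 15 * u y"
    by (rule mult_left_mono[OF uy]) simp
  finally show ?thesis .
qed

section \<open>Harnack inequality on the boundaries of large cubes, by chaining balls\<close>

definition kharmonic :: "(site \<Rightarrow> real) \<Rightarrow> (site \<Rightarrow> real) \<Rightarrow> int \<Rightarrow> bool" where
  "kharmonic k u r \<longleftrightarrow> (\<forall>z. (\<forall>j. \<bar>z $ j\<bar> < r) \<longrightarrow> u z = (1 - k z) * avg u z)"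

definition cube :: "int \<Rightarrow> site set" where
  "cube r = {z. \<forall>j. \<bar>z $ j\<bar> \<le> r}"

definition cube_boundary :: "int \<Rightarrow> site set" where
  "cube_boundary r = {z \<in> cube r. \<exists>j. \<bar>z $ j\<bar> = r}"

definition set_coord :: "4 \<Rightarrow> int \<Rightarrow> site \<Rightarrow> site" where
  "set_coord j v x = (\<chi> i. if i = j then v else x $ i)"

lemma set_coord_nth: "set_coord j v x $ i = (if i = j then v else x $ i)"
  by (simp add: set_coord_def)

lemma nrm_axis: "nrm (axis j m) = \<bar>real_of_int m\<bar>"
  unfolding nrm_def nsq_def
  by (simp add: axis_def if_distrib[of "\<lambda>x. (real_of_int x)\<^sup>2"] cong: if_cong)

lemma unit_vector_nth: "e \<in> unit_vectors \<Longrightarrow> \<bar>e $ i\<bar> \<le> 1"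
  unfolding unit_vectors_def by (auto simp: axis_def)

lemma cube_neighbour: "(\<forall>j. \<bar>z $ j\<bar> < r) \<Longrightarrow> e \<in> unit_vectors \<Longrightarrow> z + e \<in> cube r"
  unfolding cube_def
proof (clarsimp)
  fix j assume "\<forall>j. \<bar>z $ j\<bar> < r" "e \<in> unit_vectors"
  then have "\<bar>z $ j\<bar> < r" "\<bar>e $ j\<bar> \<le> 1" using unit_vector_nth by auto
  then show "\<bar>z $ j + e $ j\<bar> \<le> r" by linarith
qed

text \<open>The summand 20 in \<epsilon> keeps the ball of radius 10 \<epsilon> r around x at norm
  at least r / 2, where the killing is at most lam = 4 \<kappa> / r^2. The summand 30720 \<kappa> =
  4 * 7680 \<kappa> makes lam (\<epsilon> r)^2 = 4 \<kappa> \<epsilon>^2 small enough for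
  \<open>harnack_ball\<close>.\<close>

lemma harnack_step:
  fixes k u :: "site \<Rightarrow> real" and r :: int and \<kappa> :: real
  assumes k: "\<And>z. 0 \<le> k z" "\<And>z. z \<noteq> 0 \<Longrightarrow> k z \<le> \<kappa> / nsq z" and \<kappa>: "\<kappa> \<ge> 0"
    and \<epsilon>: "\<epsilon> = 1 / (20 + 30720 * \<kappa>)" and r: "2 \<le> \<epsilon> * r"
    and u: "\<And>z. 0 \<le> u z" and harm: "kharmonic k u (2 * r)"
    and x: "x \<in> cube_boundary r" and y: "nrm (y - x) \<le> \<epsilon> * r"
  shows "u x \<le> 14336 * 10 ^ 15 * u y \<and> u y \<le> 14336 * 10 ^ 15 * u x"
proof -
  have e0: "\<epsilon> > 0" unfolding \<epsilon> using \<kappa> by (intro divide_pos_pos) auto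
  have e1: "\<epsilon> \<le> 1 / 20" unfolding \<epsilon> using \<kappa> by (intro divide_left_mono mult_pos_pos) auto
  have r0: "r > 0" using r e0 by (smt (verit) mult_nonneg_nonpos of_int_le_0_iff)
  have rx: "real_of_int r \<le> nrm x"
  proof -
    obtain j where "\<bar>x $ j\<bar> = r" using x by (auto simp: cube_boundary_def)
    then show ?thesis using coord_le_nrm[of x j] by simp
  qed
  have half: "10 * (\<epsilon> * r) \<le> real_of_int r / 2" using mult_right_mono[OF e1, of "real_of_int r"] r0 by simp
  have zz: "real_of_int r / 2 \<le> nrm z" if "nrm (z - x) < 10 * (\<epsilon> * r)" for z
    using nrm_triangle[of z "x - z"] nrm_diff_commute[of z x] rx half that by simp
  have z0: "z \<noteq> 0" if "nrm (z - x) < 10 * (\<epsilon> * r)" for z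
    using zz[OF that] r0 by (auto simp: nrm_def nsq_def)
  define lam where "lam = 4 * \<kappa> / (real_of_int r)\<^sup>2"
  have kl: "0 \<le> k z \<and> k z \<le> lam" if z: "nrm (z - x) < 10 * (\<epsilon> * r)" for z
  proof -
    have "(real_of_int r / 2)\<^sup>2 \<le> (nrm z)\<^sup>2" using zz[OF z] r0 by (intro power_mono) auto
    then have "(real_of_int r)\<^sup>2 / 4 \<le> nsq z" by (simp add: nrm_squared power_divide)
    then have "\<kappa> / nsq z \<le> \<kappa> / ((real_of_int r)\<^sup>2 / 4)" 
      using \<kappa> r0 nsq_ge_1[OF z0[OF z]] by (intro divide_left_mono mult_pos_pos) auto
    then show ?thesis using k(2)[OF z0[OF z]] k(1) by (simp add: lam_def mult.commute)
  qed
  have ll: "lam * (\<epsilon> * r)\<^sup>2 \<le> 1 / 7680"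
  proof -
    have "lam * (\<epsilon> * r)\<^sup>2 = 4 * \<kappa> * \<epsilon>\<^sup>2" using r0 by (simp add: lam_def power_mult_distrib)
    also have "\<dots> = 4 * \<kappa> / (20 + 30720 * \<kappa>)\<^sup>2" by (simp add: \<epsilon> power_divide)
    also have "\<dots> \<le> 1 / 7680"
    proof -
      have "30720 * \<kappa> \<le> (20 + 30720 * \<kappa>)\<^sup>2" using \<kappa> by (simp add: power2_eq_square algebra_simps)
      moreover have "(20 + 30720 * \<kappa>)\<^sup>2 > 0" using \<kappa> by simp
      ultimately show ?thesis by (simp add: divide_simps)
    qed
    finally show ?thesis .
  qed
  have hz: "u z = (1 - k z) * avg u z" if z: "nrm (z - x) < 10 * (\<epsilon> * r)" for z
  proof -
    have "\<bar>z $ j\<bar> < 2 * r" for j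
    proof -
      have "\<bar>real_of_int ((z - x) $ j)\<bar> < real_of_int r / 2" using coord_le_nrm[of "z - x" j] z half by linarith
      moreover have "\<bar>x $ j\<bar> \<le> r" using x by (auto simp: cube_boundary_def cube_def)
      then have "\<bar>real_of_int (x $ j)\<bar> \<le> r" by linarith
      ultimately have "\<bar>real_of_int (z $ j)\<bar> < 2 * real_of_int r"
        using r0 unfolding vector_minus_component of_int_diff by linarith
      then show ?thesis by linarith
    qed
    then show ?thesis using harm by (simp add: kharmonic_def)
  qed
  have xx: "nrm (x - x) \<le> \<epsilon> * r" using r by (simp add: nrm_def nsq_def)
  show ?thesis
    using harnack_ball[OF r kl ll u hz xx y] harnack_ball[OF r kl ll u hz y xx] by blast
qed

text \<open>Each step of length at most d costs one factor C, so the constant depends on the number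
  of steps and not on d. The segment has to stay in P, where steps are allowed.\<close>

lemma harnack_segment:
  fixes x :: site and n :: nat and d :: int
  assumes step: "\<And>x y. x \<in> P \<Longrightarrow> nrm (y - x) \<le> d \<Longrightarrow> u x \<le> C * u y \<and> u y \<le> C * (u x :: real)"
    and u: "\<And>z. 0 \<le> u z" and C: "C \<ge> 1" and d: "d \<ge> 0"
    and m: "0 \<le> m" "m \<le> int n * d" and P: "\<And>i. 0 \<le> i \<Longrightarrow> i \<le> m \<Longrightarrow> x + axis j i \<in> P"
  shows "u x \<le> C ^ n * u (x + axis j m) \<and> u (x + axis j m) \<le> C ^ n * u x"
  using m P
proof (induction n arbitrary: m)
  case 0
  then have "axis j m = (0 :: site)" by (simp add: axis_def vec_eq_iff)
  then have "x + axis j m = x" by simp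
  then show ?case by (simp only: power_0 mult_1 order_refl simp_thms)
next
  case (Suc n)
  define m' where "m' = max 0 (m - d)"
  have m': "0 \<le> m'" "m' \<le> int n * d" "m' \<le> m" "m - m' \<le> d"
    using Suc.prems(1,2) d by (auto simp: m'_def algebra_simps max_def)
  have IH: "u x \<le> C ^ n * u (x + axis j m') \<and> u (x + axis j m') \<le> C ^ n * u x"
    using Suc.prems(3) m' by (intro Suc.IH) auto
  have "(x + axis j m) - (x + axis j m') = axis j (m - m')"
    by (simp add: vec_eq_iff axis_def)
  then have "nrm ((x + axis j m) - (x + axis j m')) \<le> d"
    using m' by (simp add: nrm_axis)
  then have s: "u (x + axis j m') \<le> C * u (x + axis j m) \<and> u (x + axis j m) \<le> C * u (x + axis j m')"
    using Suc.prems(3)[of m'] m' by (intro step) auto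
  have "C ^ n * u (x + axis j m') \<le> C ^ n * (C * u (x + axis j m))" 
    using s C by (intro mult_left_mono) auto
  moreover have "C * u (x + axis j m') \<le> C * (C ^ n * u x)" 
    using IH C by (intro mult_left_mono) auto
  ultimately show ?case using IH s by (simp add: mult_ac) 
qed

text \<open>
  A point of the boundary of a cube can be moved to any other by changing one coordinate at a time,
  as long as some other coordinate keeps the extremal absolute value.
\<close>

lemma harnack_cube_boundary_aux:
  fixes k :: "site \<Rightarrow> real" and \<kappa> :: real
  assumes k: "\<And>z. 0 \<le> k z" "\<And>z. z \<noteq> 0 \<Longrightarrow> k z \<le> \<kappa> / nsq z" and \<kappa>: "\<kappa> \<ge> 0"
  obtains C :: real and r0 :: int where "C \<ge> 1" "r0 > 0"
    "\<And>r u x y. r \<ge> r0 \<Longrightarrow> (\<And>z. 0 \<le> u z) \<Longrightarrow> kharmonic k u (2 * r) \<Longrightarrow>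
      x \<in> cube_boundary r \<Longrightarrow> y \<in> cube_boundary r \<Longrightarrow> u x \<le> C * u y"
proof -
  define \<epsilon> where "\<epsilon> = 1 / (20 + 30720 * \<kappa>)"
  have e0: "\<epsilon> > 0" using \<kappa> by (simp add: \<epsilon>_def add_pos_nonneg)
  define r0 where "r0 = max 1 \<lceil>2 / \<epsilon>\<rceil>"
  \<comment> \<open>A segment in the boundary has length at most 2 r, and d = floor (\<epsilon> r)
    is at least \<epsilon> r / 2 because \<epsilon> r \<ge> 2. Hence about 4 / \<epsilon> steps
    suffice, uniformly in r.\<close>
  define N where "N = nat \<lceil>4 / \<epsilon>\<rceil>"
  define C0 :: real where "C0 = 14336 * 10 ^ 15"
  define K where "K = C0 ^ N"
  have C0: "C0 \<ge> 1" by (simp add: C0_def)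
  have K1: "K \<ge> 1" using C0 by (simp add: K_def)
  have main: "u x \<le> K ^ 5 * u y"
    if r: "r \<ge> r0" and u: "\<And>z. 0 \<le> u z" and harm: "kharmonic k u (2 * r)"
      and x: "x \<in> cube_boundary r" and y: "y \<in> cube_boundary r" for r u x y
  proof -
    have "2 / \<epsilon> \<le> of_int r" using r by (simp add: r0_def ceiling_le_iff)
    then have er: "2 \<le> \<epsilon> * r" using e0 by (simp add: field_simps)
    have r1: "r \<ge> 1" using r by (simp add: r0_def)
    define d where "d = \<lfloor>\<epsilon> * r\<rfloor>"
    have d: "d \<ge> 0" "real_of_int d \<le> \<epsilon> * r" "real_of_int d \<ge> \<epsilon> * r / 2"
      using er by (auto simp: d_def) linarith
    have Nd: "2 * r \<le> int N * d"
    proof -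
      have "4 / \<epsilon> \<le> of_int \<lceil>4 / \<epsilon>\<rceil>" by (rule le_of_int_ceiling)
      also have "\<dots> \<le> real N" by (simp add: N_def)
      finally have "4 / \<epsilon> \<le> real N" .
      then have "4 / \<epsilon> * (\<epsilon> * r / 2) \<le> real N * real_of_int d"
        using d er e0 by (intro mult_mono) auto
      then have "real_of_int (2 * r) \<le> real_of_int (int N * d)" using e0 by simp
      then show ?thesis by (simp only: of_int_le_iff)
    qed
    have step: "u x \<le> C0 * u y \<and> u y \<le> C0 * u x" if "x \<in> cube_boundary r" "nrm (y - x) \<le> d" for x y
      unfolding C0_def
      using that d by (intro harnack_step[OF k \<kappa> \<epsilon>_def er u harm]) auto
    have up: "u x \<le> K * u (x + axis j m) \<and> u (x + axis j m) \<le> K * u x"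
      if x: "x \<in> cube r" and i: "i \<noteq> j" "\<bar>x $ i\<bar> = r" and m: "0 \<le> m" "x $ j + m \<le> r" for x i j m
      unfolding K_def
    proof (rule harnack_segment[where P = "cube_boundary r"])
      have "\<bar>x $ j\<bar> \<le> r" using x by (auto simp: cube_def)
      then show "m \<le> int N * d" using m Nd by linarith
      fix l assume l: "0 \<le> l" "l \<le> m"
      have "(x + axis j l) $ i = x $ i" using i by (simp add: axis_def)
      moreover have "\<bar>(x + axis j l) $ a\<bar> \<le> r" for a
      proof (cases "a = j")
        case True
        then show ?thesis using \<open>\<bar>x $ j\<bar> \<le> r\<close> l m by (simp add: axis_def)
      next
        case False
        then show ?thesis using x by (simp add: axis_def cube_def)
      qed
      ultimately have "x + axis j l \<in> cube r" "\<bar>(x + axis j l) $ i\<bar> = r"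
        using i by (auto simp only: cube_def mem_Collect_eq)
      then show "x + axis j l \<in> cube_boundary r" unfolding cube_boundary_def by blast
    qed (use step u C0 d m in auto)
    have setc: "u x \<le> K * u (set_coord j v x)" and setc_cube: "set_coord j v x \<in> cube r"
      if x: "x \<in> cube r" and i: "i \<noteq> j" "\<bar>x $ i\<bar> = r" and v: "\<bar>v\<bar> \<le> r" for x i j v
    proof -
      show c: "set_coord j v x \<in> cube r" using x v by (auto simp: cube_def set_coord_nth)
      show "u x \<le> K * u (set_coord j v x)"
      proof (cases "x $ j \<le> v")
        case True
        have "set_coord j v x = x + axis j (v - x $ j)" by (simp add: vec_eq_iff set_coord_def axis_def)
        then show ?thesis using up[OF x i, of "v - x $ j"] True v by simp
      next
        case False
        have "x = set_coord j v x + axis j (x $ j - v)" by (simp add: vec_eq_iff set_coord_def axis_def)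
        moreover have "\<bar>x $ j\<bar> \<le> r" using x by (auto simp: cube_def)
        ultimately show ?thesis
          using up[OF c, of i j "x $ j - v"] i False by (simp add: set_coord_nth)
      qed
    qed
    have multi: "u x \<le> K ^ card S * u (\<chi> i. if i \<in> S then y $ i else x $ i)"
      if x: "x \<in> cube r" and l: "\<bar>x $ l\<bar> = r" "l \<notin> S" and "finite S" for x l S
      using \<open>finite S\<close> l
    proof (induction S)
      case empty
      then show ?case by simp
    next
      case (insert a S)
      define z where "z = (\<chi> i. if i \<in> S then y $ i else x $ i)"
      have yc: "y \<in> cube r" using y by (simp add: cube_boundary_def)
      have z: "z \<in> cube r" using x yc by (auto simp: z_def cube_def)
      have "u z \<le> K * u (set_coord a (y $ a) z)"
        using insert.prems yc by (intro setc(1)[OF z, of l]) (auto simp: z_def cube_def)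
      moreover have "set_coord a (y $ a) z = (\<chi> i. if i \<in> insert a S then y $ i else x $ i)"
        by (auto simp: vec_eq_iff z_def set_coord_nth)
      ultimately have "K ^ card S * u z \<le> K ^ card S * (K * u (\<chi> i. if i \<in> insert a S then y $ i else x $ i))"
        using K1 by (intro mult_left_mono) auto
      then show ?case using insert by (simp add: z_def mult_ac)
    qed
    obtain j where j: "\<bar>x $ j\<bar> = r" using x by (auto simp: cube_boundary_def)
    obtain l where l: "\<bar>y $ l\<bar> = r" using y by (auto simp: cube_boundary_def)
    have xc: "x \<in> cube r" using x by (simp add: cube_boundary_def)
    \<comment> \<open>x is extremal in coordinate j and y in coordinate l. Making a third coordinate
      l' extremal frees coordinate l, which can then be set to y $ l; this value is extremal and
      frees the three others. These are 1 + 1 + 3 changes, whence the power 5.\<close>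
    have "\<exists>l'. l' \<notin> {j, l}"
    proof (rule ccontr)
      assume "\<not> ?thesis"
      then have "(UNIV :: 4 set) = {j, l}" by auto
      then have "card (UNIV :: 4 set) = card {j, l}" by simp
      moreover have "card {j, l} \<le> 2" by (simp add: card_insert_if)
      ultimately show False by simp
    qed
    then obtain l' where l': "l' \<noteq> j" "l' \<noteq> l" by auto
    define x1 where "x1 = set_coord l' r x"
    define x2 where "x2 = set_coord l (y $ l) x1"
    have a1: "u x \<le> K * u x1" "x1 \<in> cube r" unfolding x1_def
      using setc[OF xc, of j l' r] setc_cube[OF xc, of j l' r] j l' r1 by auto
    have "\<bar>x1 $ l'\<bar> = r" using r1 by (simp add: x1_def set_coord_nth)
    then have a2: "u x1 \<le> K * u x2" "x2 \<in> cube r" unfolding x2_def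
      using setc[OF a1(2), of l' l "y $ l"] setc_cube[OF a1(2), of l' l "y $ l"] l l' by auto
    have a3: "u x2 \<le> K ^ card (UNIV - {l}) * u (\<chi> i. if i \<in> UNIV - {l} then y $ i else x2 $ i)"
      using l by (intro multi[OF a2(2), of l]) (auto simp: x2_def set_coord_nth)
    have "(\<chi> i. if i \<in> UNIV - {l} then y $ i else x2 $ i) = y"
      by (auto simp: vec_eq_iff x2_def set_coord_nth)
    moreover have "card (UNIV - {l}) = 3" by (simp add: card_Diff_singleton)
    ultimately have a3: "u x2 \<le> K ^ 3 * u y" using a3 by simp
    have "u x \<le> K * (K * u x2)" using a1(1) a2(1) K1 by (meson mult_left_mono order_trans zero_le_one)
    also have "\<dots> \<le> K * (K * (K ^ 3 * u y))" using a3 K1 by (intro mult_left_mono) auto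
    also have "\<dots> = K ^ 5 * u y" by (simp add: eval_nat_numeral)
    finally show ?thesis .
  qed
  show thesis
  proof (rule that[of "K ^ 5" r0])
    show "1 \<le> K ^ 5" using K1 by simp
    show "0 < r0" by (simp add: r0_def)
  qed (use main in blast)
qed

text \<open>The equations inside the cube involve only values in the cube. So Harnack extends to
  functions that are nonnegative on the cube alone, such as the differences u - \<alpha> v met
  below.\<close>

lemma kharmonic_truncate:
  assumes "kharmonic k u r"
  shows "kharmonic k (\<lambda>z. if z \<in> cube r then u z else 0) r"
  unfolding kharmonic_def
proof (intro allI impI)
  fix z :: site assume z: "\<forall>j. \<bar>z $ j\<bar> < r"
  have "avg (\<lambda>z. if z \<in> cube r then u z else 0) z = avg u z"
    using cube_neighbour[OF z] by (intro avg_cong) auto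
  moreover have "z \<in> cube r" using z by (auto simp: cube_def less_imp_le)
  ultimately show "(if z \<in> cube r then u z else 0) = (1 - k z) * avg (\<lambda>z. if z \<in> cube r then u z else 0) z"
    using assms z by (simp add: kharmonic_def)
qed

lemma kharmonic_diff:
  assumes "kharmonic k u r" "kharmonic k v r"
  shows "kharmonic k (\<lambda>z. a * u z - b * v z) r"
  unfolding kharmonic_def
proof (intro allI impI)
  fix z :: site assume "\<forall>j. \<bar>z $ j\<bar> < r"
  then have "u z = (1 - k z) * avg u z" "v z = (1 - k z) * avg v z"
    using assms by (auto simp only: kharmonic_def)
  then have "a * u z - b * v z = a * ((1 - k z) * avg u z) - b * ((1 - k z) * avg v z)" by (simp only:)
  also have "\<dots> = (1 - k z) * avg (\<lambda>z. a * u z - b * v z) z"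
    unfolding avg_diff avg_cmult by (simp only: right_diff_distrib mult.left_commute)
  finally show "a * u z - b * v z = (1 - k z) * avg (\<lambda>z. a * u z - b * v z) z" .
qed

lemma kharmonic_mono: "kharmonic k u r \<Longrightarrow> r' \<le> r \<Longrightarrow> kharmonic k u r'"
  unfolding kharmonic_def by (meson less_le_trans)

lemma cube_mono: "r' \<le> r \<Longrightarrow> cube r' \<subseteq> cube r"
  unfolding cube_def by (auto intro: order_trans)

lemma harnack_cube_boundary:
  fixes k :: "site \<Rightarrow> real" and \<kappa> :: real
  assumes k: "\<And>z. 0 \<le> k z" "\<And>z. z \<noteq> 0 \<Longrightarrow> k z \<le> \<kappa> / nsq z" and \<kappa>: "\<kappa> \<ge> 0"
  obtains C :: real and r0 :: int where "C \<ge> 1" "r0 > 0"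
    "\<And>r u x y. r \<ge> r0 \<Longrightarrow> (\<And>z. z \<in> cube (2 * r) \<Longrightarrow> 0 \<le> u z) \<Longrightarrow> kharmonic k u (2 * r) \<Longrightarrow>
      x \<in> cube_boundary r \<Longrightarrow> y \<in> cube_boundary r \<Longrightarrow> u x \<le> C * u y"
proof -
  obtain C :: real and r0 :: int where C: "C \<ge> 1" "r0 > 0"
    and h: "\<And>r u x y. r \<ge> r0 \<Longrightarrow> (\<And>z. 0 \<le> u z) \<Longrightarrow> kharmonic k u (2 * r) \<Longrightarrow>
      x \<in> cube_boundary r \<Longrightarrow> y \<in> cube_boundary r \<Longrightarrow> u x \<le> C * u y"
    using harnack_cube_boundary_aux[OF k \<kappa>] by metis
  show thesis
  proof (rule that[OF C])
    fix r u x y assume r: "r0 \<le> r" and u: "\<And>z. z \<in> cube (2 * r) \<Longrightarrow> 0 \<le> u z"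
      and harm: "kharmonic k u (2 * r)" and xy: "x \<in> cube_boundary r" "y \<in> cube_boundary r"
    have "cube_boundary r \<subseteq> cube (2 * r)" using cube_mono[of r "2 * r"] r C by (auto simp: cube_boundary_def)
    then show "u x \<le> C * u y"
      using h[OF r _ kharmonic_truncate[OF harm] xy] u xy by (auto simp: subset_iff)
  qed
qed

lemma kharmonic_comparison:
  assumes k: "\<And>z. 0 \<le> k z \<and> k z \<le> 1" and f: "kharmonic k f r"
    and b: "\<And>z. z \<in> cube_boundary r \<Longrightarrow> f z \<le> 0" and z: "z \<in> cube r"
  shows "f z \<le> 0"
proof (cases "z \<in> cube_boundary r")
  case False
  define D where "D = {z :: site. \<forall>j. \<bar>z $ j\<bar> < r}"
  have finD: "finite D" unfolding D_def by (rule finite_subset[OF _ finite_coord_bounded[of r]]) (auto intro: less_imp_le)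
  have zD: "z \<in> D" using z False by (auto simp: D_def cube_def cube_boundary_def order_le_less)
  show ?thesis
  proof (rule maximum_principle[where k = k, OF finD _ _ _ zD])
    fix y e :: site assume "y \<in> D" "e \<in> unit_vectors" "y + e \<notin> D"
    then have "y + e \<in> cube_boundary r" 
      using cube_neighbour[of y r e] by (auto simp: D_def cube_boundary_def cube_def not_less intro: antisym)
    then show "f (y + e) \<le> 0" by (rule b)
  qed (use k f in \<open>auto simp: D_def kharmonic_def\<close>)
qed (use b in auto)

section \<open>Convergence of ratios of positive harmonic functions\<close>

lemma cube_boundary_nonempty: "r \<ge> 0 \<Longrightarrow> axis 1 r \<in> cube_boundary r"
  unfolding cube_boundary_def cube_def by (auto simp: axis_def)

lemma zero_notin_cube_boundary: "r > 0 \<Longrightarrow> z \<in> cube_boundary r \<Longrightarrow> z \<noteq> 0"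
  unfolding cube_boundary_def by auto

definition ratio_bounds :: "(site \<Rightarrow> real) \<Rightarrow> (site \<Rightarrow> real) \<Rightarrow> int \<Rightarrow> real \<Rightarrow> real \<Rightarrow> bool" where
  "ratio_bounds u v r \<alpha> \<beta> \<longleftrightarrow> (\<forall>z\<in>cube r. \<alpha> * v z \<le> u z \<and> u z \<le> \<beta> * v z)"

text \<open>The maximum principle for \<open>\<alpha> * v - u\<close> and
  \<open>u - \<beta> * v\<close> carries the bounds from the boundary to the whole cube, the origin
  included.\<close>

lemma ratio_bounds_extend:
  assumes k: "\<And>z. 0 \<le> k z \<and> k z \<le> 1" and u: "kharmonic k u r" and v: "kharmonic k v r"
    and b: "\<And>z. z \<in> cube_boundary r \<Longrightarrow> \<alpha> * v z \<le> u z \<and> u z \<le> \<beta> * v z"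
  shows "ratio_bounds u v r \<alpha> \<beta>"
  unfolding ratio_bounds_def
proof (intro ballI conjI)
  fix z assume z: "z \<in> cube r"
  have "\<alpha> * v z - 1 * u z \<le> 0"
    by (rule kharmonic_comparison[OF k kharmonic_diff[OF v u] _ z]) (use b in auto)
  then show "\<alpha> * v z \<le> u z" by simp
  have "1 * u z - \<beta> * v z \<le> 0"
    by (rule kharmonic_comparison[OF k kharmonic_diff[OF u v] _ z]) (use b in auto)
  then show "u z \<le> \<beta> * v z" by simp
qed

definition harnack_constant :: "(site \<Rightarrow> real) \<Rightarrow> int \<Rightarrow> real \<Rightarrow> bool" where
  "harnack_constant k r C \<longleftrightarrow> (\<forall>u. (\<forall>z\<in>cube (2 * r). 0 \<le> u z) \<longrightarrow> kharmonic k u (2 * r) \<longrightarrow>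
     (\<forall>x\<in>cube_boundary r. \<forall>y\<in>cube_boundary r. u x \<le> C * u y))"

lemma harnack_constantD:
  "harnack_constant k r C \<Longrightarrow> (\<And>z. z \<in> cube (2 * r) \<Longrightarrow> 0 \<le> u z) \<Longrightarrow> kharmonic k u (2 * r) \<Longrightarrow>
    x \<in> cube_boundary r \<Longrightarrow> y \<in> cube_boundary r \<Longrightarrow> u x \<le> C * u y"
  unfolding harnack_constant_def by blast

text \<open>
  If \<open>\<alpha> v \<le> u \<le> \<beta> v\<close>, then \<open>u - \<alpha> v\<close> and \<open>\<beta> v - u\<close> are nonnegative and harmonic and add up to
  \<open>(\<beta> - \<alpha>) v\<close>. One of them is therefore at least half of it at a given point, hence comparable to
  it on the whole boundary by Harnack, which improves \<open>\<alpha>\<close> or \<open>\<beta>\<close>.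
\<close>

lemma ratio_bounds_step:
  assumes k: "\<And>z. 0 \<le> k z \<and> k z \<le> 1" and C: "C \<ge> 1" and r: "r > 0"
    and hc: "harnack_constant k r C"
    and u: "kharmonic k u (2 * r)" and v: "kharmonic k v (2 * r)" and v0: "\<And>z. 0 \<le> v z"
    and b: "ratio_bounds u v (2 * r) \<alpha> \<beta>" and ab: "\<alpha> \<le> \<beta>"
  obtains \<alpha>' \<beta>' where "\<alpha> \<le> \<alpha>'" "\<alpha>' \<le> \<beta>'" "\<beta>' \<le> \<beta>" "\<beta>' - \<alpha>' \<le> (1 - 1 / (2 * C\<^sup>2)) * (\<beta> - \<alpha>)"
    "ratio_bounds u v r \<alpha>' \<beta>'"
proof -
  note h = harnack_constantD[OF hc]
  define p :: site where "p = axis 1 r"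
  have p: "p \<in> cube_boundary r" using r cube_boundary_nonempty by (simp add: p_def)
  have ur: "kharmonic k u r" "kharmonic k v r" using u v kharmonic_mono r by force+
  \<comment> \<open>One factor C moves v from z to p, another moves w from p back to z; the 2 is the
    half that the larger of the two differences is guaranteed to have at p.\<close>
  define \<delta> where "\<delta> = (\<beta> - \<alpha>) / (2 * C\<^sup>2)"
  have C2: "C\<^sup>2 \<ge> 1" using C by simp
  have \<delta>: "0 \<le> \<delta>" "\<delta> \<le> \<beta> - \<alpha>"
  proof -
    show "0 \<le> \<delta>" using ab by (simp add: \<delta>_def)
    have "(\<beta> - \<alpha>) / (2 * C\<^sup>2) \<le> (\<beta> - \<alpha>) / 1" using ab C2 by (intro divide_left_mono) auto
    then show "\<delta> \<le> \<beta> - \<alpha>" by (simp add: \<delta>_def)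
  qed
  have red: "(\<beta> - \<alpha>) - \<delta> = (1 - 1 / (2 * C\<^sup>2)) * (\<beta> - \<alpha>)" by (simp add: \<delta>_def algebra_simps)
  have b': "\<And>z. z \<in> cube_boundary r \<Longrightarrow> \<alpha> * v z \<le> u z \<and> u z \<le> \<beta> * v z"
    using b cube_mono[of r "2 * r"] r by (auto simp: ratio_bounds_def cube_boundary_def)
  have key: "\<delta> * v z \<le> w z" if w: "kharmonic k w (2 * r)" "\<And>z. z \<in> cube (2 * r) \<Longrightarrow> 0 \<le> w z"
    and wp: "(\<beta> - \<alpha>) * v p \<le> 2 * w p" and z: "z \<in> cube_boundary r" for w z
  proof -
    have "v z \<le> C * v p" using v0 by (intro h[OF _ v z p]) auto
    moreover have "w p \<le> C * w z" by (intro h[OF w(2) w(1) p z])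
    ultimately have "(\<beta> - \<alpha>) * v z \<le> (\<beta> - \<alpha>) * (C * v p)" using ab by (intro mult_left_mono) auto
    also have "\<dots> = C * ((\<beta> - \<alpha>) * v p)" by simp
    also have "\<dots> \<le> C * (2 * w p)" using wp C by (intro mult_left_mono) auto
    also have "\<dots> \<le> C * (2 * (C * w z))" using \<open>w p \<le> C * w z\<close> C by (intro mult_left_mono) auto
    finally have "(\<beta> - \<alpha>) * v z \<le> 2 * C\<^sup>2 * w z" by (simp add: power2_eq_square mult_ac)
    then show ?thesis using C by (simp add: \<delta>_def divide_simps mult_ac)
  qed
  show thesis
  proof (cases "(\<beta> - \<alpha>) * v p \<le> 2 * (u p - \<alpha> * v p)")
    case True
    have "kharmonic k (\<lambda>z. 1 * u z - \<alpha> * v z) (2 * r)" by (rule kharmonic_diff[OF u v])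
    then have "\<delta> * v z \<le> 1 * u z - \<alpha> * v z" if "z \<in> cube_boundary r" for z
      using b True that by (intro key[of "\<lambda>z. 1 * u z - \<alpha> * v z"]) (auto simp: ratio_bounds_def)
    then have "ratio_bounds u v r (\<alpha> + \<delta>) \<beta>"
      using b' by (intro ratio_bounds_extend[OF k ur]) (auto simp: algebra_simps)
    then show thesis using \<delta> red by (intro that[of "\<alpha> + \<delta>" \<beta>]) auto
  next
    case False
    have "kharmonic k (\<lambda>z. \<beta> * v z - 1 * u z) (2 * r)" by (rule kharmonic_diff[OF v u])
    then have "\<delta> * v z \<le> \<beta> * v z - 1 * u z" if "z \<in> cube_boundary r" for z
      using b False that by (intro key[of "\<lambda>z. \<beta> * v z - 1 * u z"]) (auto simp: ratio_bounds_def algebra_simps)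
    then have "ratio_bounds u v r \<alpha> (\<beta> - \<delta>)"
      using b' by (intro ratio_bounds_extend[OF k ur]) (auto simp: algebra_simps)
    then show thesis using \<delta> red by (intro that[of \<alpha> "\<beta> - \<delta>"]) auto
  qed
qed

text \<open>Harnack bounds the ratio on a cube 2^n times larger up to a factor C^4, and each halving
  of the radius contracts the oscillation by \<theta> = 1 - 1 / (2 C^2). As n depends only on
  \<epsilon> and C, the radius r' serves all pairs u, v at once; this uniformity allows comparing
  two different members of the sequence h.\<close>

lemma ratio_bounds_uniform:
  fixes k :: "site \<Rightarrow> real" and \<kappa> :: real
  assumes k: "\<And>z. 0 \<le> k z \<and> k z \<le> 1" "\<And>z. z \<noteq> 0 \<Longrightarrow> k z \<le> \<kappa> / nsq z" and \<kappa>: "\<kappa> \<ge> 0"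
    and \<epsilon>: "\<epsilon> > 0"
  obtains r0 :: int where "r0 > 0"
    "\<And>r. r \<ge> r0 \<Longrightarrow> \<exists>r'. \<forall>u v. kharmonic k u r' \<and> kharmonic k v r' \<and> (\<forall>z. 0 \<le> u z) \<and> (\<forall>z. 0 \<le> v z) \<and>
      (\<forall>z. z \<noteq> 0 \<longrightarrow> 0 < u z) \<and> (\<forall>z. z \<noteq> 0 \<longrightarrow> 0 < v z) \<longrightarrow>
      (\<exists>\<alpha>>0. ratio_bounds u v r \<alpha> ((1 + \<epsilon>) * \<alpha>))"
proof -
  obtain C :: real and r0 :: int where C: "C \<ge> 1" "r0 > 0"
    and h: "\<And>r u x y. r \<ge> r0 \<Longrightarrow> (\<And>z. z \<in> cube (2 * r) \<Longrightarrow> 0 \<le> u z) \<Longrightarrow> kharmonic k u (2 * r) \<Longrightarrow>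
      x \<in> cube_boundary r \<Longrightarrow> y \<in> cube_boundary r \<Longrightarrow> u x \<le> C * u y"
    using harnack_cube_boundary[of k \<kappa>] k \<kappa> by metis
  have hc: "harnack_constant k r C" if "r \<ge> r0" for r
    unfolding harnack_constant_def using h[OF that] by blast
  define \<theta> where "\<theta> = 1 - 1 / (2 * C\<^sup>2)"
  have C2: "C\<^sup>2 \<ge> 1" using C by simp
  have \<theta>: "0 \<le> \<theta>" "\<theta> < 1" using C2 by (auto simp: \<theta>_def divide_simps)
  have start: "\<exists>\<alpha>>0. ratio_bounds u v r \<alpha> (C ^ 4 * \<alpha>)"
    if r: "r \<ge> r0" and uv: "kharmonic k u (2 * r)" "kharmonic k v (2 * r)" "\<And>z. 0 \<le> u z" "\<And>z. 0 \<le> v z"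
      "\<And>z. z \<noteq> 0 \<Longrightarrow> 0 < u z" "\<And>z. z \<noteq> 0 \<Longrightarrow> 0 < v z" for r u v
  proof -
    have r1: "r > 0" using r C by simp
    define p :: site where "p = axis 1 r"
    have p: "p \<in> cube_boundary r" using r1 cube_boundary_nonempty by (simp add: p_def)
    have pp: "u p > 0" "v p > 0" using uv zero_notin_cube_boundary[OF r1 p] by auto
    \<comment> \<open>On the boundary u and v each differ from their values at p by at most a factor
      C in either direction, so u / v stays between C^-2 and C^2 times its value at p.\<close>
    define \<alpha> where "\<alpha> = u p / (C * (C * v p))"
    have "ratio_bounds u v r \<alpha> (C ^ 4 * \<alpha>)"
    proof (rule ratio_bounds_extend[OF k(1)])
      show "kharmonic k u r" "kharmonic k v r" using uv kharmonic_mono r1 by force+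
      fix z assume z: "z \<in> cube_boundary r"
      have 1: "u z \<le> C * u p" "u p \<le> C * u z" "v z \<le> C * v p" "v p \<le> C * v z"
        using h[OF r] uv z p by blast+
      have "u p * v z \<le> (C * u z) * (C * v p)" using 1 uv C by (intro mult_mono) auto
      then have "\<alpha> * v z \<le> u z" using pp C by (simp add: \<alpha>_def divide_simps mult_ac)
      moreover have "u z * v p \<le> (C * u p) * (C * v z)" using 1 uv C by (intro mult_mono) auto
      then have "u z \<le> C * C * (u p / v p) * v z" using pp by (simp add: divide_simps mult_ac)
      moreover have "u p / v p = C * C * \<alpha>" using pp C by (simp add: \<alpha>_def)
      ultimately show "\<alpha> * v z \<le> u z \<and> u z \<le> C ^ 4 * \<alpha> * v z"
        by (simp add: eval_nat_numeral mult_ac)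
    qed
    moreover have "\<alpha> > 0" using pp C by (simp add: \<alpha>_def)
    ultimately show ?thesis by blast
  qed
  have iter: "\<exists>\<alpha>' \<beta>'. \<alpha> \<le> \<alpha>' \<and> \<alpha>' \<le> \<beta>' \<and> \<beta>' \<le> \<beta> \<and> \<beta>' - \<alpha>' \<le> \<theta> ^ n * (\<beta> - \<alpha>) \<and> ratio_bounds u v r \<alpha>' \<beta>'"
    if "r \<ge> r0" "kharmonic k u (2 ^ n * r)" "kharmonic k v (2 ^ n * r)" "\<And>z. 0 \<le> v z"
      "ratio_bounds u v (2 ^ n * r) \<alpha> \<beta>" "\<alpha> \<le> \<beta>" for n r u v \<alpha> \<beta>
    using that
  proof (induction n arbitrary: r)
    case 0
    then show ?case by auto
  next
    case (Suc n)
    have e: "2 ^ Suc n * r = 2 ^ n * (2 * r)" by simp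
    have r: "2 * r \<ge> r0" "r > 0" using Suc.prems(1) C by auto
    obtain \<alpha>1 \<beta>1 where 1: "\<alpha> \<le> \<alpha>1" "\<alpha>1 \<le> \<beta>1" "\<beta>1 \<le> \<beta>" "\<beta>1 - \<alpha>1 \<le> \<theta> ^ n * (\<beta> - \<alpha>)"
      "ratio_bounds u v (2 * r) \<alpha>1 \<beta>1"
      using Suc.IH[of "2 * r"] Suc.prems r unfolding e by metis
    have "2 * r \<le> 2 ^ Suc n * r" unfolding e using r by simp
    then have uv: "kharmonic k u (2 * r)" "kharmonic k v (2 * r)"
      using Suc.prems kharmonic_mono by blast+
    obtain \<alpha>' \<beta>' where 2: "\<alpha>1 \<le> \<alpha>'" "\<alpha>' \<le> \<beta>'" "\<beta>' \<le> \<beta>1" "\<beta>' - \<alpha>' \<le> \<theta> * (\<beta>1 - \<alpha>1)"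
      "ratio_bounds u v r \<alpha>' \<beta>'"
      unfolding \<theta>_def
      using ratio_bounds_step[OF k(1) C(1) r(2) hc[OF Suc.prems(1)] uv Suc.prems(4) 1(5) 1(2)] by metis
    have "\<theta> * (\<beta>1 - \<alpha>1) \<le> \<theta> * (\<theta> ^ n * (\<beta> - \<alpha>))" using 1 \<theta> by (intro mult_left_mono) auto
    then have "\<beta>' - \<alpha>' \<le> \<theta> ^ Suc n * (\<beta> - \<alpha>)" using 2 by (simp add: mult_ac)
    then show ?case using 1 2 by (meson order_trans)
  qed
  have "(\<lambda>n. \<theta> ^ n * C ^ 4) \<longlonglongrightarrow> 0 * C ^ 4" using \<theta> by (intro tendsto_intros LIMSEQ_realpow_zero) auto
  then have "eventually (\<lambda>n. \<theta> ^ n * C ^ 4 < \<epsilon>) sequentially" using \<epsilon> by (intro order_tendstoD) auto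
  then obtain n where n: "\<theta> ^ n * C ^ 4 < \<epsilon>" by (auto simp: eventually_sequentially)
  show thesis
  proof (rule that[OF C(2)])
    fix r assume r: "r0 \<le> r"
    have r1: "r > 0" using r C by simp
    have rn: "r0 \<le> 2 ^ n * r" using r r1 by (smt (verit) mult_le_cancel_right1 one_le_power)
    show "\<exists>r'. \<forall>u v. kharmonic k u r' \<and> kharmonic k v r' \<and> (\<forall>z. 0 \<le> u z) \<and> (\<forall>z. 0 \<le> v z) \<and>
      (\<forall>z. z \<noteq> 0 \<longrightarrow> 0 < u z) \<and> (\<forall>z. z \<noteq> 0 \<longrightarrow> 0 < v z) \<longrightarrow>
      (\<exists>\<alpha>>0. ratio_bounds u v r \<alpha> ((1 + \<epsilon>) * \<alpha>))"
    proof (intro exI[of _ "2 * (2 ^ n * r)"] allI impI, elim conjE)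
      fix u v :: "site \<Rightarrow> real"
      assume uv: "kharmonic k u (2 * (2 ^ n * r))" "kharmonic k v (2 * (2 ^ n * r))"
        "\<forall>z. 0 \<le> u z" "\<forall>z. 0 \<le> v z" "\<forall>z. z \<noteq> 0 \<longrightarrow> 0 < u z" "\<forall>z. z \<noteq> 0 \<longrightarrow> 0 < v z"
      obtain \<alpha> where \<alpha>: "\<alpha> > 0" "ratio_bounds u v (2 ^ n * r) \<alpha> (C ^ 4 * \<alpha>)"
        using start[OF rn uv(1,2)] uv by blast
      have "C ^ 4 \<ge> 1" using C by simp
      then have "\<alpha> \<le> C ^ 4 * \<alpha>" using \<alpha> by simp
      moreover have "kharmonic k u (2 ^ n * r)" "kharmonic k v (2 ^ n * r)"
        using uv(1,2) r1 by (auto elim!: kharmonic_mono)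
      ultimately obtain \<alpha>' \<beta>' where 1: "\<alpha> \<le> \<alpha>'" "\<beta>' - \<alpha>' \<le> \<theta> ^ n * (C ^ 4 * \<alpha> - \<alpha>)" "ratio_bounds u v r \<alpha>' \<beta>'"
        using iter[OF r, where n = n and u = u and v = v and \<alpha> = \<alpha> and \<beta> = "C ^ 4 * \<alpha>"] \<alpha> uv by blast
      have "\<theta> ^ n * (C ^ 4 * \<alpha> - \<alpha>) \<le> \<theta> ^ n * (C ^ 4 * \<alpha>)" using \<alpha> \<theta> by (intro mult_left_mono) auto
      also have "\<dots> = (\<theta> ^ n * C ^ 4) * \<alpha>" by simp
      also have "\<dots> \<le> \<epsilon> * \<alpha>'" using n 1 \<alpha> \<theta> \<epsilon> \<open>C ^ 4 \<ge> 1\<close> by (intro mult_mono) auto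
      finally have "\<beta>' \<le> (1 + \<epsilon>) * \<alpha>'" using 1 by (simp add: algebra_simps)
      then have "\<beta>' * v z \<le> (1 + \<epsilon>) * \<alpha>' * v z" for z using uv by (intro mult_right_mono) auto
      then have "ratio_bounds u v r \<alpha>' ((1 + \<epsilon>) * \<alpha>')"
        using 1(3) unfolding ratio_bounds_def by (meson order_trans)
      then show "\<exists>\<alpha>>0. ratio_bounds u v r \<alpha> ((1 + \<epsilon>) * \<alpha>)" using 1 \<alpha> by (intro exI[of _ \<alpha>']) auto
    qed
  qed
qed

text \<open>Logarithms turn the multiplicative Cauchy condition into the usual one; exponentiating
  afterwards yields a positive limit.\<close>

lemma converges_of_ratio:
  fixes q :: "nat \<Rightarrow> real"
  assumes pos: "eventually (\<lambda>R. q R > 0) sequentially"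
    and r: "\<And>\<epsilon>. \<epsilon> > 0 \<Longrightarrow> \<exists>N. \<forall>R\<ge>N. \<forall>R'\<ge>N. q R \<le> (1 + \<epsilon>) * q R'"
  shows "\<exists>l>0. q \<longlonglongrightarrow> l"
proof -
  obtain N0 where N0: "\<And>R. R \<ge> N0 \<Longrightarrow> q R > 0" using pos by (auto simp: eventually_sequentially)
  have "Cauchy (\<lambda>R. ln (q (R + N0)))"
  proof (rule metric_CauchyI)
    fix e :: real assume e: "e > 0"
    obtain N where N: "\<And>R R'. R \<ge> N \<Longrightarrow> R' \<ge> N \<Longrightarrow> q R \<le> (1 + e / 2) * q R'" using r[of "e / 2"] e by auto
    have "ln (q (R + N0)) \<le> e / 2 + ln (q (R' + N0))" if "R \<ge> N" "R' \<ge> N" for R R'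
    proof -
      have "ln (q (R + N0)) \<le> ln ((1 + e / 2) * q (R' + N0))"
        using N[of "R + N0" "R' + N0"] that N0 e by (subst ln_le_cancel_iff) (auto intro!: mult_pos_pos)
      also have "\<dots> = ln (1 + e / 2) + ln (q (R' + N0))" using N0 e by (intro ln_mult_pos) auto
      also have "ln (1 + e / 2) \<le> e / 2" using e by (intro ln_add_one_self_le_self) auto
      finally show ?thesis by simp
    qed
    then have "dist (ln (q (R + N0))) (ln (q (R' + N0))) < e" if "R \<ge> N" "R' \<ge> N" for R R'
      using that e by (auto simp: dist_real_def abs_less_iff) (smt (verit) field_sum_of_halves)+
    then show "\<exists>M. \<forall>m\<ge>M. \<forall>n\<ge>M. dist (ln (q (m + N0))) (ln (q (n + N0))) < e" by blast
  qed
  then obtain l where "(\<lambda>R. ln (q (R + N0))) \<longlonglongrightarrow> l" by (auto simp: Cauchy_convergent_iff convergent_def)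
  then have "(\<lambda>R. exp (ln (q (R + N0)))) \<longlonglongrightarrow> exp l" by (rule tendsto_exp)
  then have "(\<lambda>R. q (R + N0)) \<longlonglongrightarrow> exp l" using N0 by simp
  then have "q \<longlonglongrightarrow> exp l" by (rule LIMSEQ_offset)
  then show ?thesis by (intro exI[of _ "exp l"]) simp
qed

text \<open>For large R and R' the functions h R and h R' are harmonic on the same large cube, so
  they are almost proportional on a cube containing x and p. The unknown factor of proportionality
  \<alpha> cancels after normalisation at p, which leaves a multiplicative Cauchy condition.\<close>

lemma ratio_limit:
  fixes k :: "site \<Rightarrow> real" and \<kappa> :: real and h :: "nat \<Rightarrow> site \<Rightarrow> real"
  assumes k: "\<And>z. 0 \<le> k z \<and> k z \<le> 1" "\<And>z. z \<noteq> 0 \<Longrightarrow> k z \<le> \<kappa> / nsq z" and \<kappa>: "\<kappa> \<ge> 0"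
    and h: "\<And>R z. 0 \<le> h R z" "\<And>R z. z \<noteq> 0 \<Longrightarrow> 0 < h R z"
    and harm: "\<And>r. eventually (\<lambda>R. kharmonic k (h R) r) sequentially"
  obtains a :: "site \<Rightarrow> real" where "\<And>z. z \<noteq> 0 \<Longrightarrow> a z > 0"
    "\<And>x y. x \<noteq> 0 \<Longrightarrow> y \<noteq> 0 \<Longrightarrow> (\<lambda>R. h R x / h R y) \<longlonglongrightarrow> a x / a y"
proof -
  define p :: site where "p = axis 1 1"
  have p: "p \<noteq> 0" by (simp add: p_def axis_def vec_eq_iff)
  have "\<exists>l>0. (\<lambda>R. h R x / h R p) \<longlonglongrightarrow> l" if x: "x \<noteq> 0" for x
  proof (rule converges_of_ratio)
    fix \<epsilon> :: real assume \<epsilon>: "\<epsilon> > 0"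
    obtain r0 where r0: "r0 > 0"
      and R: "\<And>r. r \<ge> r0 \<Longrightarrow> \<exists>r'. \<forall>u v. kharmonic k u r' \<and> kharmonic k v r' \<and> (\<forall>z. 0 \<le> u z) \<and> (\<forall>z. 0 \<le> v z) \<and>
      (\<forall>z. z \<noteq> 0 \<longrightarrow> 0 < u z) \<and> (\<forall>z. z \<noteq> 0 \<longrightarrow> 0 < v z) \<longrightarrow>
      (\<exists>\<alpha>>0. ratio_bounds u v r \<alpha> ((1 + \<epsilon>) * \<alpha>))"
      using ratio_bounds_uniform[OF k \<kappa> \<epsilon>] by metis
    define r where "r = max r0 (max 1 (\<Sum>j\<in>UNIV. \<bar>x $ j\<bar>))"
    have "\<bar>x $ j\<bar> \<le> (\<Sum>j\<in>UNIV. \<bar>x $ j\<bar>)" for j by (rule member_le_sum) auto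
    then have xr: "x \<in> cube r" unfolding cube_def r_def by (auto simp: le_max_iff_disj)
    have pr: "p \<in> cube r" by (auto simp: cube_def r_def p_def axis_def)
    have "r \<ge> r0" by (simp add: r_def)
    from R[OF this] obtain r' where r': "\<forall>u v. kharmonic k u r' \<and> kharmonic k v r' \<and> (\<forall>z. 0 \<le> u z) \<and> (\<forall>z. 0 \<le> v z) \<and>
      (\<forall>z. z \<noteq> 0 \<longrightarrow> 0 < u z) \<and> (\<forall>z. z \<noteq> 0 \<longrightarrow> 0 < v z) \<longrightarrow>
      (\<exists>\<alpha>>0. ratio_bounds u v r \<alpha> ((1 + \<epsilon>) * \<alpha>))"
      by (elim exE)
    obtain N where N: "\<And>R. R \<ge> N \<Longrightarrow> kharmonic k (h R) r'" using harm by (auto simp: eventually_sequentially)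
    show "\<exists>N. \<forall>R\<ge>N. \<forall>R'\<ge>N. h R x / h R p \<le> (1 + \<epsilon>) * (h R' x / h R' p)"
    proof (intro exI[of _ N] allI impI)
      fix R R' assume RR: "R \<ge> N" "R' \<ge> N"
      obtain \<alpha> where \<alpha>: "\<alpha> > 0" "ratio_bounds (h R) (h R') r \<alpha> ((1 + \<epsilon>) * \<alpha>)"
        using r' N[OF RR(1)] N[OF RR(2)] h by meson
      have 1: "h R x \<le> (1 + \<epsilon>) * \<alpha> * h R' x" "\<alpha> * h R' p \<le> h R p" 
        using \<alpha>(2) xr pr by (auto simp: ratio_bounds_def)
      have "h R x * (\<alpha> * h R' p) \<le> (1 + \<epsilon>) * \<alpha> * h R' x * h R p"
        using 1 h \<alpha> \<epsilon> by (intro mult_mono) auto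
      then have "h R x * h R' p \<le> (1 + \<epsilon>) * h R' x * h R p" using \<alpha>(1) by (simp add: mult_ac)
      then show "h R x / h R p \<le> (1 + \<epsilon>) * (h R' x / h R' p)"
        using h(2)[OF p, of R] h(2)[OF p, of R'] by (simp add: divide_simps mult_ac)
    qed
  qed (use h x p in auto)
  then obtain a where a: "\<And>x. x \<noteq> 0 \<Longrightarrow> a x > 0 \<and> (\<lambda>R. h R x / h R p) \<longlonglongrightarrow> a x" by metis
  show thesis
  proof (rule that[of a])
    fix x y :: site assume xy: "x \<noteq> 0" "y \<noteq> 0"
    have "(\<lambda>R. (h R x / h R p) / (h R y / h R p)) \<longlonglongrightarrow> a x / a y"
      using a[OF xy(1)] a[OF xy(2)] by (intro tendsto_divide) auto
    moreover have "(h R x / h R p) / (h R y / h R p) = h R x / h R y" for R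
      using h(2)[OF p, of R] by (simp add: divide_simps)
    ultimately show "(\<lambda>R. h R x / h R y) \<longlonglongrightarrow> a x / a y" by (simp only:)
  qed (use a in auto)
qed

section \<open>Products of probability mass functions\<close>

definition iprod :: "('i \<Rightarrow> 'a pmf) \<Rightarrow> ('i \<Rightarrow> 'a) measure" where
  "iprod p = PiM UNIV (\<lambda>i. measure_pmf (p i))"

lemma space_iprod [simp]: "space (iprod p) = UNIV"
  by (simp add: iprod_def space_PiM PiE_def)

lemma product_prob_space_pmf: "product_prob_space (\<lambda>i. measure_pmf (p i))"
  by (intro product_prob_space.intro product_prob_space_axioms.intro product_sigma_finite.intro
      measure_pmf.prob_space_axioms prob_space_imp_sigma_finite)

lemma prob_space_iprod: "prob_space (iprod p)"
  unfolding iprod_def by (intro prob_space_PiM measure_pmf.prob_space_axioms)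

lemma measurable_iprod_component: "(\<lambda>\<omega>. \<omega> i) \<in> measurable (iprod p) (count_space UNIV)"
proof -
  have "(\<lambda>\<omega>. \<omega> i) \<in> measurable (iprod p) (measure_pmf (p i))"
    unfolding iprod_def by (rule measurable_component_singleton) simp
  then show ?thesis by (simp cong: measurable_cong_sets)
qed

text \<open>Such a function factors through the list of its finitely many coordinates. Lists over a
  countable type are countable, so the list is a measurable discrete variable and any function of it
  is measurable, whatever its codomain.\<close>

lemma measurable_iprod_finite:
  fixes p :: "'i \<Rightarrow> 'a::countable pmf"
  assumes J: "finite J" and f: "\<And>\<omega> \<omega>'. (\<And>i. i \<in> J \<Longrightarrow> \<omega> i = \<omega>' i) \<Longrightarrow> f \<omega> = f \<omega>'"
  shows "f \<in> measurable (iprod p) (count_space UNIV)"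
proof -
  obtain us where us: "set us = J" using finite_list[OF J] by blast
  have m: "(\<lambda>\<omega>. map \<omega> vs) \<in> measurable (iprod p) (count_space UNIV)" for vs
  proof (induction vs)
    case (Cons v vs)
    have "(\<lambda>\<omega>. (\<lambda>l \<omega>. \<omega> v # l) (map \<omega> vs) \<omega>) \<in> measurable (iprod p) (count_space UNIV)"
    proof (rule measurable_compose_countable[OF _ Cons])
      fix l show "(\<lambda>\<omega>. \<omega> v # l) \<in> measurable (iprod p) (count_space UNIV)"
        using measurable_compose[OF measurable_iprod_component[of v p], of "\<lambda>a. a # l"] by simp
    qed
    then show ?case by simp
  qed simp
  have "f = (\<lambda>\<omega>. f (\<lambda>i. the (map_of (zip us (map \<omega> us)) i)))"
  proof
    fix \<omega> show "f \<omega> = f (\<lambda>i. the (map_of (zip us (map \<omega> us)) i))"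
      by (rule f) (simp add: map_of_zip_map us)
  qed
  moreover have "(\<lambda>\<omega>. f (\<lambda>i. the (map_of (zip us (map \<omega> us)) i))) \<in> measurable (iprod p) (count_space UNIV)"
    using measurable_compose[OF m[of us], of "\<lambda>l. f (\<lambda>i. the (map_of (zip us l) i))"] by simp
  ultimately show ?thesis by simp
qed

lemma sets_iprod_finite:
  fixes p :: "'i \<Rightarrow> 'a::countable pmf"
  assumes J: "finite J" and f: "\<And>\<omega> \<omega>'. (\<And>i. i \<in> J \<Longrightarrow> \<omega> i = \<omega>' i) \<Longrightarrow> P \<omega> \<Longrightarrow> P \<omega>'"
  shows "{\<omega>. P \<omega>} \<in> sets (iprod p)"
proof -
  have "P \<in> measurable (iprod p) (count_space UNIV)"
    by (rule measurable_iprod_finite[OF J]) (metis f)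
  then show ?thesis by (simp add: pred_def)
qed

lemma measurable_into_maps:
  fixes p :: "'i \<Rightarrow> 'a::countable pmf" and f :: "('i \<Rightarrow> 'a) \<Rightarrow> 'j \<Rightarrow> 'b"
  assumes J: "\<And>j. finite (J j)" and f: "\<And>j \<omega> \<omega>'. (\<And>i. i \<in> J j \<Longrightarrow> \<omega> i = \<omega>' i) \<Longrightarrow> f \<omega> j = f \<omega>' j"
  shows "f \<in> measurable (iprod p) (PiM UNIV (\<lambda>_. count_space UNIV))"
proof (rule measurable_PiM_single')
  fix j show "(\<lambda>\<omega>. f \<omega> j) \<in> measurable (iprod p) (count_space UNIV)"
    by (rule measurable_iprod_finite[OF J]) (rule f)
qed (auto simp: space_PiM)

lemma measurable_iprod_reindex: "(\<lambda>\<omega> j. \<omega> (f j)) \<in> measurable (iprod p) (iprod (\<lambda>j. p (f j)))"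
  unfolding iprod_def by (rule measurable_PiM_single') (auto simp: space_PiM intro!: measurable_component_singleton)

lemma distr_iprod_reindex:
  assumes "inj f"
  shows "distr (iprod p) (iprod (\<lambda>j. p (f j))) (\<lambda>\<omega> j. \<omega> (f j)) = iprod (\<lambda>j. p (f j))"
  using distr_PiM_reindex[of UNIV "\<lambda>i. measure_pmf (p i)" f UNIV] assms
  by (simp add: iprod_def measure_pmf.prob_space_axioms restrict_UNIV)

lemma measure_iprod_reindex:
  assumes "inj f" "A \<in> sets (iprod (\<lambda>j. p (f j)))"
  shows "measure (iprod p) {\<omega>. (\<lambda>j. \<omega> (f j)) \<in> A} = measure (iprod (\<lambda>j. p (f j))) A"
proof -
  have "measure (iprod (\<lambda>j. p (f j))) A = measure (distr (iprod p) (iprod (\<lambda>j. p (f j))) (\<lambda>\<omega> j. \<omega> (f j))) A"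
    by (simp only: distr_iprod_reindex[OF assms(1)])
  also have "\<dots> = measure (iprod p) {\<omega>. (\<lambda>j. \<omega> (f j)) \<in> A}"
    using assms by (subst measure_distr) (auto simp: measurable_iprod_reindex vimage_def)
  finally show ?thesis by simp
qed

lemma iprod_cylinder:
  assumes "finite J"
  shows "measure (iprod p) {\<omega>. \<forall>i\<in>J. \<omega> i \<in> A i} = (\<Prod>i\<in>J. measure_pmf.prob (p i) (A i))"
proof -
  interpret product_prob_space "\<lambda>i. measure_pmf (p i)" UNIV by (rule product_prob_space_pmf)
  have "emeasure (iprod p) {\<omega>. \<forall>i\<in>J. \<omega> i \<in> A i} = (\<Prod>i\<in>J. emeasure (measure_pmf (p i)) (A i))"
    using emeasure_PiM_Collect[of J A] assms space_iprod[of p] by (simp add: iprod_def)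
  also have "\<dots> = ennreal (\<Prod>i\<in>J. measure_pmf.prob (p i) (A i))"
    by (simp add: measure_pmf.emeasure_eq_measure prod_ennreal)
  finally show ?thesis by (simp add: measure_def prod_nonneg)
qed

lemma iprod_single: "measure (iprod p) {\<omega>. \<omega> i \<in> A} = measure_pmf.prob (p i) A"
  using iprod_cylinder[of "{i}" p "\<lambda>_. A"] by simp

lemma AE_iprod_component: "(\<And>x. x \<in> set_pmf (p i) \<Longrightarrow> P x) \<Longrightarrow> AE \<omega> in iprod p. P (\<omega> i)"
proof -
  assume h: "\<And>x. x \<in> set_pmf (p i) \<Longrightarrow> P x"
  interpret product_prob_space "\<lambda>i. measure_pmf (p i)" UNIV by (rule product_prob_space_pmf)
  have "AE \<omega> in PiM UNIV (\<lambda>i. measure_pmf (p i)). P (\<omega> i)"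
    by (rule AE_component) (use h in \<open>auto simp: AE_measure_pmf_iff\<close>)
  then show ?thesis by (simp only: iprod_def)
qed

definition depends_on :: "(('i \<Rightarrow> 'a) set) \<Rightarrow> 'i set \<Rightarrow> bool" where
  "depends_on E K \<longleftrightarrow> (\<forall>\<omega> \<omega>'. (\<forall>i\<in>K. \<omega> i = \<omega>' i) \<longrightarrow> (\<omega> \<in> E \<longleftrightarrow> \<omega>' \<in> E))"

lemma iprod_indep:
  fixes p :: "'i \<Rightarrow> 'a pmf" and K :: "'l \<Rightarrow> 'i set"
  assumes L: "finite L" and K: "disjoint_family_on K L"
    and E: "\<And>l. l \<in> L \<Longrightarrow> E l \<in> sets (iprod p)" and dep: "\<And>l. l \<in> L \<Longrightarrow> depends_on (E l) (K l)"
  shows "measure (iprod p) {\<omega>. \<forall>l\<in>L. \<omega> \<in> E l} = (\<Prod>l\<in>L. measure (iprod p) (E l))"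
proof (cases "L = {}")
  case True
  interpret prob_space "iprod p" by (rule prob_space_iprod)
  show ?thesis using True prob_space by simp
next
  case False
  let ?M = "\<lambda>i. measure_pmf (p i)"
  interpret Pr: prob_space "iprod p" by (rule prob_space_iprod)
  have "Pr.indep_vars ?M (\<lambda>i \<omega>. \<omega> i) UNIV"
  proof (subst Pr.indep_vars_iff_distr_eq_PiM)
    show "Pr.random_variable (?M i) (\<lambda>\<omega>. \<omega> i)" for i
      unfolding iprod_def by (rule measurable_component_singleton) simp
    interpret product_prob_space ?M UNIV by (rule product_prob_space_pmf)
    have 1: "distr (iprod p) (?M i) (\<lambda>\<omega>. \<omega> i) = ?M i" for i
      unfolding iprod_def by (rule PiM_component) simp
    have "distr (iprod p) (PiM UNIV ?M) (\<lambda>x. \<lambda>i\<in>UNIV. x i) = distr (iprod p) (iprod p) (\<lambda>x. x)"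
      by (intro distr_cong) (auto simp: iprod_def)
    also have "\<dots> = PiM UNIV ?M" by (simp add: distr_id2 iprod_def)
    finally show "distr (iprod p) (PiM UNIV ?M) (\<lambda>x. \<lambda>i\<in>UNIV. x i) = (\<Pi>\<^sub>M i\<in>UNIV. distr (iprod p) (?M i) (\<lambda>\<omega>. \<omega> i))"
      by (simp add: 1)
  qed simp
  then have ind: "Pr.indep_vars (\<lambda>l. PiM (K l) ?M) (\<lambda>l \<omega>. restrict (\<lambda>i. \<omega> i) (K l)) L"
    by (rule Pr.indep_vars_restrict) (use K in auto)
  \<comment> \<open>An event depending only on the coordinates in K l can be read off the
    restriction to K l once the other coordinates are filled in arbitrarily;
    \<open>undefined\<close> is the filler.\<close>
  define ext where "ext l X = (\<lambda>i. if i \<in> K l then X i else (undefined :: 'a))" for l and X :: "'i \<Rightarrow> 'a"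
  define A where "A l = {X \<in> space (PiM (K l) ?M). ext l X \<in> E l}" for l
  have ext: "ext l \<in> measurable (PiM (K l) ?M) (iprod p)" for l
    unfolding iprod_def
  proof (rule measurable_PiM_single')
    fix i show "(\<lambda>X. ext l X i) \<in> measurable (PiM (K l) ?M) (?M i)"
      unfolding ext_def by (cases "i \<in> K l") (auto intro: measurable_component_singleton)
  qed (auto simp: space_PiM)
  have A: "A l \<in> sets (PiM (K l) ?M)" if "l \<in> L" for l
    using measurable_sets[OF ext E[OF that], of l] by (simp add: A_def vimage_def Int_def conj_commute)
  have eq: "(\<lambda>\<omega>. restrict \<omega> (K l)) -` A l \<inter> space (iprod p) = E l" if "l \<in> L" for l
  proof -
    have "ext l (restrict \<omega> (K l)) \<in> E l \<longleftrightarrow> \<omega> \<in> E l" for \<omega>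
      using dep[OF that] by (auto simp: depends_on_def ext_def)
    then show ?thesis by (auto simp: A_def space_PiM)
  qed
  have "Pr.prob (\<Inter>l\<in>L. (\<lambda>\<omega>. restrict (\<lambda>i. \<omega> i) (K l)) -` A l \<inter> space (iprod p)) =
      (\<Prod>l\<in>L. Pr.prob ((\<lambda>\<omega>. restrict (\<lambda>i. \<omega> i) (K l)) -` A l \<inter> space (iprod p)))"
    by (rule Pr.indep_varsD_finite[OF ind False L A])
  also have "(\<Inter>l\<in>L. (\<lambda>\<omega>. restrict (\<lambda>i. \<omega> i) (K l)) -` A l \<inter> space (iprod p)) = (\<Inter>l\<in>L. E l)"
    by (intro INF_cong refl eq)
  also have "(\<Prod>l\<in>L. Pr.prob ((\<lambda>\<omega>. restrict (\<lambda>i. \<omega> i) (K l)) -` A l \<inter> space (iprod p))) = (\<Prod>l\<in>L. Pr.prob (E l))"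
    by (intro prod.cong refl arg_cong[where f = Pr.prob] eq)
  also have "(\<Inter>l\<in>L. E l) = {\<omega>. \<forall>l\<in>L. \<omega> \<in> E l}" by auto
  finally show ?thesis .
qed

lemma iprod_indep2:
  assumes "A \<in> sets (iprod p)" "B \<in> sets (iprod p)" "depends_on A K" "depends_on B K'" "K \<inter> K' = {}"
  shows "measure (iprod p) (A \<inter> B) = measure (iprod p) A * measure (iprod p) B"
proof -
  have "measure (iprod p) {\<omega>. \<forall>l\<in>UNIV. \<omega> \<in> (if l then A else B)} = (\<Prod>l\<in>UNIV. measure (iprod p) (if l then A else B))"
    by (rule iprod_indep[where K = "\<lambda>l. if l then K else K'"])
      (use assms in \<open>auto simp: disjoint_family_on_def split: if_splits\<close>)
  moreover have "{\<omega>. \<forall>l\<in>UNIV. \<omega> \<in> (if l then A else B)} = A \<inter> B" by (auto simp: all_bool_eq split: if_splits)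
  ultimately show ?thesis by (simp add: UNIV_bool mult.commute)
qed

text \<open>
  Needed because the increment stored at the root of a bush is not used by the walk on that bush:
  it belongs to the spine edge leading to the root.
\<close>

lemma iprod_second_indep:
  fixes p :: "'i \<Rightarrow> ('a \<times> 'b) pmf"
  assumes p: "p i = pair_pmf a b" and E: "E \<in> sets (iprod p)"
    and inv: "\<And>\<omega> c c' d. fun_upd \<omega> i (d, c) \<in> E \<Longrightarrow> fun_upd \<omega> i (d, c') \<in> E"
  shows "measure (iprod p) {\<omega> \<in> E. snd (\<omega> i) = e} = pmf b e * measure (iprod p) E"
proof -
  let ?M = "\<lambda>i. measure_pmf (p i)"
  let ?Q = "PiM (UNIV - {i}) ?M"
  interpret Pr: prob_space "iprod p" by (rule prob_space_iprod)
  interpret Q: prob_space ?Q by (intro prob_space_PiM measure_pmf.prob_space_axioms)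
  have upd: "(\<lambda>(x, X). X(i := x)) \<in> measurable (?M i \<Otimes>\<^sub>M ?Q) (iprod p)"
    unfolding iprod_def split_def
  proof (rule measurable_PiM_single')
    fix j show "(\<lambda>z. ((snd z)(i := fst z)) j) \<in> measurable (?M i \<Otimes>\<^sub>M ?Q) (?M j)"
    proof (cases "j = i")
      case True
      then show ?thesis by simp
    next
      case False
      have "(\<lambda>z. snd z j) \<in> measurable (?M i \<Otimes>\<^sub>M ?Q) (?M j)"
        by (rule measurable_compose[OF measurable_snd measurable_component_singleton]) (use False in auto)
      then show ?thesis using False by simp
    qed
  qed (auto simp: space_PiM)
  have D: "iprod p = distr (?M i \<Otimes>\<^sub>M ?Q) (iprod p) (\<lambda>(x, X). X(i := x))"
    using distr_pair_PiM_eq_PiM[of "UNIV - {i}" ?M i, OF measure_pmf.prob_space_axioms measure_pmf.prob_space_axioms]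
    by (simp add: iprod_def)
  have em: "emeasure (iprod p) A = (\<integral>\<^sup>+x. \<integral>\<^sup>+y. emeasure ?Q {X \<in> space ?Q. X(i := (x, y)) \<in> A} \<partial>measure_pmf b \<partial>measure_pmf a)"
    if A: "A \<in> sets (iprod p)" for A
  proof -
    have m: "(\<lambda>(x, X). X(i := x)) -` A \<inter> space (?M i \<Otimes>\<^sub>M ?Q) \<in> sets (?M i \<Otimes>\<^sub>M ?Q)"
      by (rule measurable_sets[OF upd A])
    have "emeasure (iprod p) A = emeasure (?M i \<Otimes>\<^sub>M ?Q) ((\<lambda>(x, X). X(i := x)) -` A \<inter> space (?M i \<Otimes>\<^sub>M ?Q))"
      by (subst D) (rule emeasure_distr[OF upd A])
    also have "\<dots> = (\<integral>\<^sup>+x. emeasure ?Q (Pair x -` ((\<lambda>(x, X). X(i := x)) -` A \<inter> space (?M i \<Otimes>\<^sub>M ?Q))) \<partial>?M i)"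
      by (rule Q.emeasure_pair_measure_alt[OF m])
    also have "\<dots> = (\<integral>\<^sup>+x. emeasure ?Q {X \<in> space ?Q. X(i := x) \<in> A} \<partial>?M i)"
      by (intro nn_integral_cong arg_cong2[where f = emeasure] refl) (auto simp: space_pair_measure)
    finally show ?thesis by (simp add: p nn_integral_pair_pmf')
  qed
  have E': "{\<omega> \<in> E. snd (\<omega> i) = e} \<in> sets (iprod p)"
  proof -
    have "(\<lambda>\<omega>. snd (\<omega> i)) \<in> measurable (iprod p) (count_space UNIV)"
      using measurable_compose[OF measurable_iprod_component[of i p], of snd] by simp
    then have "(\<lambda>\<omega>. snd (\<omega> i)) -` {e} \<inter> space (iprod p) \<in> sets (iprod p)" by (rule measurable_sets) simp
    then have "E \<inter> ((\<lambda>\<omega>. snd (\<omega> i)) -` {e} \<inter> space (iprod p)) \<in> sets (iprod p)" using E by (rule sets.Int[rotated])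
    also have "E \<inter> ((\<lambda>\<omega>. snd (\<omega> i)) -` {e} \<inter> space (iprod p)) = {\<omega> \<in> E. snd (\<omega> i) = e}" by auto
    finally show ?thesis .
  qed
  define G where "G x = emeasure ?Q {X \<in> space ?Q. X(i := (x, e)) \<in> E}" for x
  have G: "emeasure ?Q {X \<in> space ?Q. X(i := (x, y)) \<in> E} = G x" for x y
    unfolding G_def using inv by (intro arg_cong2[where f = emeasure] refl Collect_cong) blast
  have "emeasure (iprod p) {\<omega> \<in> E. snd (\<omega> i) = e} = (\<integral>\<^sup>+x. \<integral>\<^sup>+y. G x * indicator {e} y \<partial>measure_pmf b \<partial>measure_pmf a)"
    unfolding em[OF E'] by (intro nn_integral_cong) (auto simp: G split: split_indicator)
  also have "\<dots> = (\<integral>\<^sup>+x. G x * pmf b e \<partial>measure_pmf a)"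
    by (intro nn_integral_cong) (simp add: nn_integral_cmult emeasure_pmf_single)
  also have "\<dots> = (\<integral>\<^sup>+x. G x \<partial>measure_pmf a) * pmf b e" by (rule nn_integral_multc) simp
  also have "(\<integral>\<^sup>+x. G x \<partial>measure_pmf a) = emeasure (iprod p) E" unfolding em[OF E] G by simp
  finally show ?thesis
    by (simp add: Pr.emeasure_eq_measure ennreal_mult''[symmetric] mult.commute)
qed

section \<open>Galton--Watson trees\<close>

text \<open>The root law q is kept apart from \<mu> so that one development covers the bushes (q =
  \<open>root_offspring \<mu>\<close>) and the subtrees of their vertices (q = \<mu>), cf.
  \<open>gw_sub\<close>.\<close>

definition gw_label :: "nat pmf \<Rightarrow> nat pmf \<Rightarrow> nat list \<Rightarrow> (nat \<times> site) pmf" where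
  "gw_label q \<mu> u = pair_pmf (if u = [] then q else \<mu>) step_pmf"

definition gw_space :: "nat pmf \<Rightarrow> nat pmf \<Rightarrow> (nat list \<Rightarrow> nat \<times> site) measure" where
  "gw_space q \<mu> = iprod (gw_label q \<mu>)"

abbreviation tree_maps :: "(nat list \<rightharpoonup> site) measure" where
  "tree_maps \<equiv> PiM UNIV (\<lambda>_. count_space UNIV)"

lemma star_space_eq: "star_space \<mu> = gw_space (root_offspring \<mu>) \<mu>"
  by (simp add: star_space_def gw_space_def iprod_def gw_label_def[abs_def] label_pmf_def)

lemma space_gw_space [simp]: "space (gw_space q \<mu>) = UNIV"
  by (simp add: gw_space_def)

lemma prob_space_gw: "prob_space (gw_space q \<mu>)"
  unfolding gw_space_def by (rule prob_space_iprod)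

lemma gw_tree_cong:
  assumes "\<And>k. k < length u \<Longrightarrow> N (take k u) = N' (take k u)"
  shows "u \<in> gw_tree N \<longleftrightarrow> u \<in> gw_tree N'"
  using assms by (simp add: gw_tree_def)

lemma tree_walk_cong:
  assumes "\<And>k. k \<le> length u \<Longrightarrow> fst (\<omega> (take k u)) = fst (\<omega>' (take k u))"
    "\<And>k. 1 \<le> k \<Longrightarrow> k \<le> length u \<Longrightarrow> snd (\<omega> (take k u)) = snd (\<omega>' (take k u))"
  shows "tree_walk x \<omega> u = tree_walk x \<omega>' u"
proof -
  have "u \<in> gw_tree (\<lambda>v. fst (\<omega> v)) \<longleftrightarrow> u \<in> gw_tree (\<lambda>v. fst (\<omega>' v))"
    by (rule gw_tree_cong) (use assms(1) in auto)
  moreover have "(\<Sum>k=1..length u. snd (\<omega> (take k u))) = (\<Sum>k=1..length u. snd (\<omega>' (take k u)))"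
    by (intro sum.cong refl assms(2)) auto
  ultimately show ?thesis by (simp add: tree_walk_def)
qed

lemma tree_walk_root: "tree_walk x \<omega> [] = Some x"
  by (simp add: tree_walk_def gw_tree_def)

lemma dom_tree_walk: "dom (tree_walk x \<omega>) = gw_tree (\<lambda>v. fst (\<omega> v))"
  by (auto simp: tree_walk_def dom_def)

lemma tree_walk_upd_root: "tree_walk x (fun_upd \<omega> [] (d, c)) = tree_walk x (fun_upd \<omega> [] (d, c'))"
proof
  fix u show "tree_walk x (fun_upd \<omega> [] (d, c)) u = tree_walk x (fun_upd \<omega> [] (d, c')) u"
    by (rule tree_walk_cong) auto
qed

lemma measurable_tree_walk: "tree_walk x \<in> measurable (gw_space q \<mu>) tree_maps"
  unfolding gw_space_def
  by (rule measurable_into_maps[where J = "\<lambda>u. (\<lambda>k. take k u) ` {..length u}"])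
    (auto intro!: tree_walk_cong)

lemma sets_tree_walk: "B \<in> sets tree_maps \<Longrightarrow> {\<omega>. tree_walk x \<omega> \<in> B} \<in> sets (gw_space q \<mu>)"
  using measurable_sets[OF measurable_tree_walk[of x q \<mu>], of B] by (simp add: vimage_def)

lemma measure_star_law:
  assumes "B \<in> sets tree_maps"
  shows "measure (star_law \<mu> x) B = measure (star_space \<mu>) {\<omega>. tree_walk x \<omega> \<in> B}"
  unfolding star_law_def star_space_eq
  by (subst measure_distr[OF measurable_tree_walk assms]) (simp add: vimage_def)

lemma prob_space_star_law: "prob_space (star_law \<mu> x)"
  unfolding star_law_def star_space_eq
  by (intro prob_space.prob_space_distr prob_space_gw measurable_tree_walk)

lemma sets_star_law [measurable_cong]: "sets (star_law \<mu> x) = sets tree_maps"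
  by (simp add: star_law_def)

lemma space_star_law [simp]: "space (star_law \<mu> x) = UNIV"
  by (simp add: star_law_def space_PiM)

lemma sets_maps_component: "{w. w u \<in> B} \<in> sets (PiM UNIV (\<lambda>_. count_space UNIV))"
proof -
  have "(\<lambda>w. w u) \<in> measurable (PiM UNIV (\<lambda>_. count_space UNIV)) (count_space UNIV)"
    by (rule measurable_component_singleton) simp
  from measurable_sets[OF this, of B] show ?thesis by (simp add: vimage_def space_PiM)
qed

lemma sets_hits_0: "{w. hits_0 w} \<in> sets tree_maps"
proof -
  have "{w. hits_0 w} = (\<Union>u. {w. w u \<in> {Some 0}})" by (auto simp: hits_0_def)
  also have "\<dots> \<in> sets tree_maps" by (intro sets.countable_UN image_subsetI sets_maps_component)
  finally show ?thesis .
qed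

lemma killing_eq: "killing \<mu> z = measure (star_space \<mu>) {\<omega>. hits_0 (tree_walk z \<omega>)}"
  unfolding killing_def using measure_star_law[OF sets_hits_0, of \<mu> z] by simp

lemma killing_bounds: "0 \<le> killing \<mu> z \<and> killing \<mu> z \<le> 1"
  unfolding killing_def using prob_space.prob_le_1[OF prob_space_star_law] by simp

lemma gw_tree_Cons: "j # v \<in> gw_tree N \<longleftrightarrow> j < N [] \<and> v \<in> gw_tree (\<lambda>w. N (j # w))"
proof
  assume "j # v \<in> gw_tree N"
  then have h: "\<And>k. k < Suc (length v) \<Longrightarrow> (j # v) ! k < N (take k (j # v))" by (simp add: gw_tree_def)
  show "j < N [] \<and> v \<in> gw_tree (\<lambda>w. N (j # w))"
    using h[of 0] h[of "Suc k" for k] by (auto simp: gw_tree_def)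
next
  assume h: "j < N [] \<and> v \<in> gw_tree (\<lambda>w. N (j # w))"
  show "j # v \<in> gw_tree N"
    unfolding gw_tree_def
  proof (clarify)
    fix k assume "k < length (j # v)"
    then show "(j # v) ! k < N (take k (j # v))" using h by (cases k) (auto simp: gw_tree_def)
  qed
qed

lemma tree_walk_Cons:
  "tree_walk x \<omega> (j # v) = (if j < fst (\<omega> []) then tree_walk (x + snd (\<omega> [j])) (\<lambda>w. \<omega> (j # w)) v else None)"
proof -
  have "(\<Sum>k=1..length (j # v). snd (\<omega> (take k (j # v)))) = (\<Sum>k=0..length v. snd (\<omega> (j # take k v)))"
    using sum.shift_bounds_cl_Suc_ivl[of "\<lambda>k. snd (\<omega> (take k (j # v)))" 0 "length v"] by simp
  also have "\<dots> = snd (\<omega> [j]) + (\<Sum>k=1..length v. snd (\<omega> (j # take k v)))"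
    by (subst sum.atLeast_Suc_atMost) auto
  finally show ?thesis
    by (simp add: tree_walk_def gw_tree_Cons add.assoc)
qed

lemma set_step_pmf: "set_pmf step_pmf = unit_vectors"
  unfolding step_pmf_def using finite_unit_vectors card_unit_vectors by (intro set_pmf_of_set) auto

lemma pmf_step: "pmf step_pmf e = (if e \<in> unit_vectors then 1 / 8 else 0)"
  unfolding step_pmf_def using finite_unit_vectors card_unit_vectors by (subst pmf_of_set) auto

lemma AE_gw_step: "AE \<omega> in gw_space q \<mu>. snd (\<omega> u) \<in> unit_vectors"
  unfolding gw_space_def by (rule AE_iprod_component) (auto simp: gw_label_def set_step_pmf)

lemma gw_sub: "(\<lambda>w. gw_label q \<mu> (j # w)) = gw_label \<mu> \<mu>"
  by (auto simp: gw_label_def fun_eq_iff)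

text \<open>The increment stored at the root belongs to an edge coming from outside the tree, so
  changing it leaves the walk as it is (\<open>tree_walk_upd_root\<close>). This gives independence
  of the root increment and the walk.\<close>

lemma gw_root_step:
  assumes "E \<in> sets tree_maps"
  shows "measure (gw_space q \<mu>) {\<omega>. snd (\<omega> []) = e \<and> tree_walk x \<omega> \<in> E}
    = pmf step_pmf e * measure (gw_space q \<mu>) {\<omega>. tree_walk x \<omega> \<in> E}"
proof -
  have "measure (gw_space q \<mu>) {\<omega> \<in> {\<omega>. tree_walk x \<omega> \<in> E}. snd (\<omega> []) = e}
    = pmf step_pmf e * measure (gw_space q \<mu>) {\<omega>. tree_walk x \<omega> \<in> E}"
    unfolding gw_space_def
  proof (rule iprod_second_indep)
    show "gw_label q \<mu> [] = pair_pmf q step_pmf" by (simp add: gw_label_def)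
    show "{\<omega>. tree_walk x \<omega> \<in> E} \<in> sets (iprod (gw_label q \<mu>))" using sets_tree_walk[OF assms] by (simp add: gw_space_def)
    fix \<omega> :: "nat list \<Rightarrow> nat \<times> site" and c c' d
    assume "fun_upd \<omega> [] (d, c) \<in> {\<omega>. tree_walk x \<omega> \<in> E}"
    then show "fun_upd \<omega> [] (d, c') \<in> {\<omega>. tree_walk x \<omega> \<in> E}" using tree_walk_upd_root[of x \<omega> d c c'] by simp
  qed
  then show ?thesis by (simp add: conj_commute)
qed

text \<open>Decomposition at child j of the root: it exists with probability q {j<..}, independently
  of the labels above [j]. These form an ordinary \<mu>-tree whose root label carries the step e to
  the child, and \<open>gw_root_step\<close> separates that step from the rest of the
  subtree.\<close>

lemma visits_Cons:
  "measure (gw_space q \<mu>) {\<omega>. tree_walk x \<omega> (j # v) = Some y}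
   = measure_pmf.prob q {j<..} * ((\<Sum>e\<in>unit_vectors. measure (gw_space \<mu> \<mu>) {\<omega>. tree_walk (x + e) \<omega> v = Some y}) / 8)"
proof -
  interpret P: prob_space "gw_space q \<mu>" by (rule prob_space_gw)
  define E where "E = {w :: nat list \<rightharpoonup> site. w v \<in> {Some y}}"
  have E: "E \<in> sets tree_maps" unfolding E_def by (rule sets_maps_component)
  define A where "A = {\<omega> :: nat list \<Rightarrow> nat \<times> site. j < fst (\<omega> [])}"
  define B where "B e = {\<omega> :: nat list \<Rightarrow> nat \<times> site. snd (\<omega> [j]) = e \<and> tree_walk (x + e) (\<lambda>w. \<omega> (j # w)) \<in> E}" for e
  have A: "A \<in> sets (gw_space q \<mu>)" unfolding A_def gw_space_def by (rule sets_iprod_finite[of "{[]}"]) auto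
  have B0: "{\<omega>. snd (\<omega> []) = e \<and> tree_walk (x + e) \<omega> \<in> E} \<in> sets (gw_space \<mu> \<mu>)" for e
  proof -
    have "{\<omega>. snd (\<omega> []) = e} \<in> sets (gw_space \<mu> \<mu>)" unfolding gw_space_def by (rule sets_iprod_finite[of "{[]}"]) auto
    from sets.Int[OF this sets_tree_walk[OF E]] show ?thesis by (simp add: Int_def)
  qed
  have Be: "B e = (\<lambda>\<omega> w. \<omega> (j # w)) -` {\<omega>. snd (\<omega> []) = e \<and> tree_walk (x + e) \<omega> \<in> E}" for e
    by (auto simp: B_def)
  have B: "B e \<in> sets (gw_space q \<mu>)" for e
    using measurable_sets[OF measurable_iprod_reindex[of "(#) j" "gw_label q \<mu>"], of "{\<omega>. snd (\<omega> []) = e \<and> tree_walk (x + e) \<omega> \<in> E}"] B0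
    unfolding Be gw_space_def gw_sub by simp
  have mB: "measure (gw_space q \<mu>) (B e) = pmf step_pmf e * measure (gw_space \<mu> \<mu>) {\<omega>. tree_walk (x + e) \<omega> \<in> E}" for e
  proof -
    have "measure (gw_space q \<mu>) (B e) = measure (gw_space \<mu> \<mu>) {\<omega>. snd (\<omega> []) = e \<and> tree_walk (x + e) \<omega> \<in> E}"
      using measure_iprod_reindex[of "(#) j" "{\<omega>. snd (\<omega> []) = e \<and> tree_walk (x + e) \<omega> \<in> E}" "gw_label q \<mu>"] B0
      unfolding gw_space_def gw_sub by (simp add: B_def)
    then show ?thesis by (simp add: gw_root_step[OF E])
  qed
  have mA: "measure (gw_space q \<mu>) A = measure_pmf.prob q {j<..}"
  proof -
    have "measure (gw_space q \<mu>) A = measure_pmf.prob (gw_label q \<mu> []) (fst -` {j<..})"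
      unfolding gw_space_def A_def using iprod_single[of "gw_label q \<mu>" "[]" "fst -` {j<..}"] by simp
    also have "\<dots> = measure_pmf.prob (map_pmf fst (gw_label q \<mu> [])) {j<..}" by simp
    also have "map_pmf fst (gw_label q \<mu> []) = q" by (simp add: gw_label_def map_fst_pair_pmf)
    finally show ?thesis .
  qed
  have ind: "measure (gw_space q \<mu>) (A \<inter> B e) = measure (gw_space q \<mu>) A * measure (gw_space q \<mu>) (B e)" for e
    unfolding gw_space_def
  proof (rule iprod_indep2[where K = "{[]}" and K' = "range ((#) j)"])
    show "depends_on A {[]}" by (auto simp: depends_on_def A_def)
    show "depends_on (B e) (range ((#) j))"
      unfolding depends_on_def
    proof (intro allI impI)
      fix \<omega> \<omega>' :: "nat list \<Rightarrow> nat \<times> site" assume "\<forall>i\<in>range ((#) j). \<omega> i = \<omega>' i"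
      then have "(\<lambda>w. \<omega> (j # w)) = (\<lambda>w. \<omega>' (j # w))" "\<omega> [j] = \<omega>' [j]" by auto
      then show "\<omega> \<in> B e \<longleftrightarrow> \<omega>' \<in> B e" by (simp add: B_def)
    qed
  qed (use A B in \<open>auto simp: gw_space_def\<close>)
  have "measure (gw_space q \<mu>) {\<omega>. tree_walk x \<omega> (j # v) = Some y} = measure (gw_space q \<mu>) (\<Union>e\<in>unit_vectors. A \<inter> B e)"
  proof (rule P.finite_measure_eq_AE)
    show "AE \<omega> in gw_space q \<mu>. \<omega> \<in> {\<omega>. tree_walk x \<omega> (j # v) = Some y} \<longleftrightarrow> \<omega> \<in> (\<Union>e\<in>unit_vectors. A \<inter> B e)"
      using AE_gw_step[where q = q and \<mu> = \<mu> and u = "[j]"] by eventually_elim (auto simp: tree_walk_Cons A_def B_def E_def)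
    show "{\<omega>. tree_walk x \<omega> (j # v) = Some y} \<in> P.events"
      using sets_tree_walk[OF sets_maps_component[of "j # v" "{Some y}"]] by simp
    show "(\<Union>e\<in>unit_vectors. A \<inter> B e) \<in> P.events" using A B finite_unit_vectors by auto
  qed
  also have "\<dots> = (\<Sum>e\<in>unit_vectors. measure (gw_space q \<mu>) (A \<inter> B e))"
    using A B by (intro P.finite_measure_finite_Union finite_unit_vectors) (auto simp: disjoint_family_on_def B_def)
  also have "\<dots> = (\<Sum>e\<in>unit_vectors. measure_pmf.prob q {j<..} * (measure (gw_space \<mu> \<mu>) {\<omega>. tree_walk (x + e) \<omega> \<in> E} / 8))"
    by (intro sum.cong refl) (simp add: ind mA mB pmf_step)
  finally show ?thesis by (simp add: E_def sum_distrib_left sum_divide_distrib)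
qed

section \<open>The killing function\<close>

lemma pmf_nat_integrable_iff:
  fixes f :: "nat \<Rightarrow> real"
  shows "integrable (measure_pmf p) f \<longleftrightarrow> summable (\<lambda>n. \<bar>pmf p n * f n\<bar>)"
  unfolding measure_pmf_eq_density
  by (subst integrable_density) (auto simp: integrable_count_space_nat_iff abs_mult)

lemma pmf_nat_expectation_sums:
  fixes f :: "nat \<Rightarrow> real"
  assumes "integrable (measure_pmf p) f"
  shows "(\<lambda>n. pmf p n * f n) sums measure_pmf.expectation p f"
proof -
  have "measure_pmf.expectation p f = (\<integral>n. pmf p n * f n \<partial>count_space UNIV)"
    unfolding measure_pmf_eq_density by (subst integral_density) auto
  moreover have "integrable (count_space UNIV) (\<lambda>n. pmf p n * f n)"
    using assms unfolding pmf_nat_integrable_iff by (simp add: integrable_count_space_nat_iff)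
  ultimately show ?thesis using sums_integral_count_space_nat[of "\<lambda>n. pmf p n * f n"] by simp
qed

lemma critical_expectation:
  assumes "critical \<mu>"
  shows "integrable (measure_pmf \<mu>) real" "measure_pmf.expectation \<mu> real = 1"
proof -
  have s: "(\<lambda>n. pmf \<mu> n * real n) sums 1" using assms by (simp add: critical_def mult.commute)
  show i: "integrable (measure_pmf \<mu>) real" unfolding pmf_nat_integrable_iff using s by (simp add: sums_iff)
  show "measure_pmf.expectation \<mu> real = 1" using pmf_nat_expectation_sums[OF i] s sums_unique2 by blast
qed

text \<open>The mean of the root law is the second factorial moment of \<mu>. This is where the
  finite variance enters.\<close>

lemma root_offspring_integrable:
  assumes "critical \<mu>" "finite_variance \<mu>"
  shows "integrable (measure_pmf (root_offspring \<mu>)) real"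
proof -
  define c where "c = measure_pmf.expectation \<mu> real"
  have "integrable (measure_pmf \<mu>) (\<lambda>n. (real n - c)\<^sup>2)" using assms(2) by (simp add: finite_variance_def c_def)
  then have i: "integrable (measure_pmf \<mu>) (\<lambda>n. 2 * (real n - c)\<^sup>2 + 2 * c\<^sup>2)" by simp
  have "integrable (measure_pmf \<mu>) (\<lambda>n. (real n)\<^sup>2)"
  proof (rule Bochner_Integration.integrable_bound[OF i])
    have "(real n)\<^sup>2 \<le> 2 * (real n - c)\<^sup>2 + 2 * c\<^sup>2" for n
      using zero_le_power2[of "real n - 2 * c"] by (simp add: power2_eq_square algebra_simps)
    then show "AE n in measure_pmf \<mu>. norm ((real n)\<^sup>2) \<le> norm (2 * (real n - c)\<^sup>2 + 2 * c\<^sup>2)" by simp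
  qed simp
  then have "summable (\<lambda>n. pmf \<mu> n * (real n)\<^sup>2)" by (simp add: pmf_nat_integrable_iff)
  then have s: "summable (\<lambda>n. pmf \<mu> (Suc n) * (real (Suc n))\<^sup>2)" by (subst summable_Suc_iff)
  have "summable (\<lambda>n. pmf (root_offspring \<mu>) n * real n)"
  proof (rule summable_comparison_test'[OF s])
    fix n
    have "real (Suc n) * pmf \<mu> (Suc n) * real n \<le> real (Suc n) * pmf \<mu> (Suc n) * real (Suc n)"
      by (intro mult_left_mono) auto
    then show "norm (pmf (root_offspring \<mu>) n * real n) \<le> pmf \<mu> (Suc n) * (real (Suc n))\<^sup>2"
      unfolding pmf_root_offspring[OF assms(1)] size_biased_def by (simp add: power2_eq_square mult_ac)
  qed
  then show ?thesis by (simp add: pmf_nat_integrable_iff)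
qed

text \<open>The left-hand side is the expected number of children with label below B.\<close>

lemma sum_tail_le_expectation:
  assumes "integrable (measure_pmf q) real"
  shows "(\<Sum>j<B. measure_pmf.prob q {j<..}) \<le> measure_pmf.expectation q real"
proof -
  have "(\<Sum>j<B. measure_pmf.prob q {j<..}) = measure_pmf.expectation q (\<lambda>n. \<Sum>j<B. indicator {j<..} n)"
    by (subst Bochner_Integration.integral_sum) (auto intro: measure_pmf.integrable_const_bound[where B = 1])
  also have "\<dots> \<le> measure_pmf.expectation q real"
  proof (rule integral_mono[OF _ assms])
    show "integrable (measure_pmf q) (\<lambda>n. \<Sum>j<B. indicator {j<..} n :: real)"
      by (intro Bochner_Integration.integrable_sum measure_pmf.integrable_const_bound[where B = 1]) auto
    fix n
    have "(\<Sum>j<B. indicator {j<..} n :: real) = real (card {j \<in> {..<B}. j < n})"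
      by (simp add: indicator_def sum.If_cases Int_def)
    also have "card {j \<in> {..<B}. j < n} \<le> card {..<n}" by (intro card_mono) auto
    finally show "(\<Sum>j<B. indicator {j<..} n :: real) \<le> real n" by simp
  qed
  finally show ?thesis .
qed

section \<open>Many-to-one bound for the visits of a bush to the origin\<close>

definition words :: "nat \<Rightarrow> nat \<Rightarrow> nat list set" where
  "words B m = {u. set u \<subseteq> {..<B} \<and> length u = m}"

lemma finite_words: "finite (words B m)"
  unfolding words_def by (rule finite_lists_length_eq) simp

lemma sum_words_Suc: "(\<Sum>u\<in>words B (Suc m). f u) = (\<Sum>j<B. \<Sum>v\<in>words B m. (f (j # v) :: real))"
proof -
  have "words B (Suc m) = (\<lambda>(j, v). j # v) ` ({..<B} \<times> words B m)"
    by (auto simp: words_def length_Suc_conv image_iff)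
  moreover have "inj_on (\<lambda>(j, v). j # v) ({..<B} \<times> words B m)" by (auto simp: inj_on_def)
  ultimately show ?thesis by (simp add: sum.reindex sum.cartesian_product o_def case_prod_unfold)
qed

text \<open>Expected number of vertices of generation m sitting at the origin, counting only labels
  with all letters below B. The cut-off makes the sum finite and is removed in
  \<open>killing_le\<close>.\<close>

definition visits :: "nat pmf \<Rightarrow> nat pmf \<Rightarrow> nat \<Rightarrow> nat \<Rightarrow> site \<Rightarrow> real" where
  "visits q \<mu> B m z = (\<Sum>u\<in>words B m. measure (gw_space q \<mu>) {\<omega>. tree_walk z \<omega> u = Some 0})"

lemma visits_0: "visits q \<mu> B 0 z = (if z = 0 then 1 else 0)"
proof -
  interpret prob_space "gw_space q \<mu>" by (rule prob_space_gw)
  have "words B 0 = {[]}" by (auto simp: words_def)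
  then show ?thesis using prob_space by (auto simp: visits_def tree_walk_root)
qed

lemma visits_nonneg: "0 \<le> visits q \<mu> B m z"
  unfolding visits_def by (intro sum_nonneg) auto

lemma visits_Suc: "visits q \<mu> B (Suc m) z = (\<Sum>j<B. measure_pmf.prob q {j<..}) * avg (visits \<mu> \<mu> B m) z"
proof -
  have "visits q \<mu> B (Suc m) z = (\<Sum>j<B. \<Sum>v\<in>words B m. measure_pmf.prob q {j<..} *
      ((\<Sum>e\<in>unit_vectors. measure (gw_space \<mu> \<mu>) {\<omega>. tree_walk (z + e) \<omega> v = Some 0}) / 8))"
    unfolding visits_def sum_words_Suc visits_Cons ..
  also have "\<dots> = (\<Sum>j<B. measure_pmf.prob q {j<..}) *
      (\<Sum>v\<in>words B m. (\<Sum>e\<in>unit_vectors. measure (gw_space \<mu> \<mu>) {\<omega>. tree_walk (z + e) \<omega> v = Some 0}) / 8)"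
    by (simp only: sum_product)
  also have "(\<Sum>v\<in>words B m. (\<Sum>e\<in>unit_vectors. measure (gw_space \<mu> \<mu>) {\<omega>. tree_walk (z + e) \<omega> v = Some 0}) / 8) = avg (visits \<mu> \<mu> B m) z"
    unfolding avg_def visits_def by (subst sum.swap) (simp add: sum_divide_distrib)
  finally show ?thesis .
qed

text \<open>By criticality each generation contributes a factor W \<le> 1, so the expected visits
  satisfy the recursion of the Green function of the simple walk with at most its weights. Induction
  on n shows that they stay below the supersolution 56 / (nsq z + 7).\<close>

lemma sum_visits_le:
  assumes "critical \<mu>"
  shows "(\<Sum>m<n. visits \<mu> \<mu> B m z) \<le> 56 * (1 / (nsq z + 7))"
proof (induction n arbitrary: z)
  case 0
  then show ?case using nsq_nonneg[of z] by simp
next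
  case (Suc n)
  define W where "W = (\<Sum>j<B. measure_pmf.prob \<mu> {j<..})"
  have W: "0 \<le> W" "W \<le> 1" unfolding W_def
    using sum_tail_le_expectation[OF critical_expectation(1)[OF assms], of B] critical_expectation(2)[OF assms]
    by (auto intro: sum_nonneg)
  have "(\<Sum>m<Suc n. visits \<mu> \<mu> B m z) = (if z = 0 then 1 else 0) + W * (\<Sum>m<n. avg (visits \<mu> \<mu> B m) z)"
    by (subst sum.lessThan_Suc_shift) (simp add: visits_0 visits_Suc W_def sum_distrib_left)
  also have "(\<Sum>m<n. avg (visits \<mu> \<mu> B m) z) = avg (\<lambda>y. \<Sum>m<n. visits \<mu> \<mu> B m y) z" by (simp add: avg_sum)
  also have "W * avg (\<lambda>y. \<Sum>m<n. visits \<mu> \<mu> B m y) z \<le> 1 * avg (\<lambda>y. 56 * (1 / (nsq y + 7))) z"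
    using W Suc.IH by (intro mult_mono avg_mono avg_nonneg sum_nonneg visits_nonneg) auto
  also have "\<dots> = 56 * avg (\<lambda>y. 1 / (nsq y + 7)) z" by (simp only: avg_cmult mult_1)
  finally have "(\<Sum>m<Suc n. visits \<mu> \<mu> B m z) \<le> (if z = 0 then 1 else 0) + 56 * avg (\<lambda>y. 1 / (nsq y + 7)) z" by simp
  also have "\<dots> \<le> 56 * (1 / (nsq z + 7))"
  proof (cases "z = 0")
    case True
    have "56 * avg (\<lambda>y. 1 / (nsq y + 7)) 0 = 56 * (1 / (nsq 0 + 7)) - 1" using superharmonic_inverse_at_0 by argo
    then show ?thesis unfolding True by simp
  next
    case False
    then show ?thesis using superharmonic_inverse[of z] by simp
  qed
  finally show ?case .
qed

text \<open>Union bound: the probability of hitting 0 is at most the expected number of visits,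
  which is the mean number of children of the root times an average of the bound for \<mu>-trees.
  The sets \<open>F n\<close>, with generations and letters below n, increase to all labels.\<close>

lemma killing_le:
  assumes "critical \<mu>" "finite_variance \<mu>" and z: "z \<noteq> 0"
  shows "killing \<mu> z \<le> 56 * measure_pmf.expectation (root_offspring \<mu>) real / nsq z"
proof -
  define q where "q = root_offspring \<mu>"
  interpret P: prob_space "gw_space q \<mu>" by (rule prob_space_gw)
  define E where "E = measure_pmf.expectation q real"
  have E0: "0 \<le> E" unfolding E_def by (intro Bochner_Integration.integral_nonneg) auto
  define F where "F n = (\<Union>m<n. words n m)" for n
  have finF: "finite (F n)" for n unfolding F_def using finite_words by auto
  define V where "V u = {\<omega>. tree_walk z \<omega> u = Some 0}" for u
  have V: "V u \<in> P.events" for u unfolding V_def using sets_tree_walk[OF sets_maps_component[of u "{Some 0}"]] by simp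
  have incF: "F n \<subseteq> F (Suc n)" for n
  proof
    fix u assume "u \<in> F n"
    then have "set u \<subseteq> {..<n}" "length u < n" by (auto simp: F_def words_def)
    then have "set u \<subseteq> {..<Suc n}" "length u < Suc n" by auto
    then show "u \<in> F (Suc n)" unfolding F_def words_def by blast
  qed
  have covF: "\<exists>n. u \<in> F n" for u
  proof -
    define n where "n = Suc (length u + Max (insert 0 (set u)))"
    have "x < n" if "x \<in> set u" for x
    proof -
      have "x \<le> Max (insert 0 (set u))" using that by (intro Max_ge) auto
      then show ?thesis by (simp add: n_def)
    qed
    then have "set u \<subseteq> {..<n}" "length u < n" by (auto simp: n_def)
    then have "u \<in> F n" unfolding F_def words_def by blast
    then show ?thesis ..
  qed
  have b: "P.prob (\<Union>u\<in>F n. V u) \<le> 56 * E / nsq z" for n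
  proof -
    have "P.prob (\<Union>u\<in>F n. V u) \<le> (\<Sum>u\<in>F n. P.prob (V u))"
      using finF V by (intro P.finite_measure_subadditive_finite) auto
    also have "\<dots> = (\<Sum>m<n. visits q \<mu> n m z)"
      unfolding F_def visits_def V_def
      by (subst sum.UNION_disjoint) (auto simp: finite_words, auto simp: words_def)
    also have "\<dots> \<le> (\<Sum>m<Suc n. visits q \<mu> n m z)" by (simp add: visits_nonneg)
    also have "\<dots> = (\<Sum>j<n. measure_pmf.prob q {j<..}) * (\<Sum>m<n. avg (visits \<mu> \<mu> n m) z)"
      using z by (subst sum.lessThan_Suc_shift) (simp add: visits_0 visits_Suc sum_distrib_left)
    also have "(\<Sum>m<n. avg (visits \<mu> \<mu> n m) z) = avg (\<lambda>y. \<Sum>m<n. visits \<mu> \<mu> n m y) z" by (simp add: avg_sum)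
    also have "(\<Sum>j<n. measure_pmf.prob q {j<..}) * avg (\<lambda>y. \<Sum>m<n. visits \<mu> \<mu> n m y) z
       \<le> E * avg (\<lambda>y. 56 * (1 / (nsq y + 7))) z"
      using sum_tail_le_expectation[of q n] root_offspring_integrable[OF assms(1,2)] sum_visits_le[OF assms(1)] E0
      by (intro mult_mono avg_mono avg_nonneg sum_nonneg visits_nonneg) (auto simp: E_def q_def)
    also have "\<dots> \<le> E * (56 * (1 / (nsq z + 7)))"
      unfolding avg_cmult using superharmonic_inverse[of z] E0 by (intro mult_left_mono) auto
    also have "\<dots> \<le> E * (56 * (1 / nsq z))"
    proof -
      have "1 / (nsq z + 7) \<le> 1 / nsq z" using nsq_ge_1[OF z] by (intro divide_left_mono) auto
      then show ?thesis using E0 by (intro mult_left_mono) auto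
    qed
    finally show ?thesis by (simp add: mult_ac)
  qed
  have "(\<lambda>n. P.prob (\<Union>u\<in>F n. V u)) \<longlonglongrightarrow> P.prob (\<Union>n. \<Union>u\<in>F n. V u)"
  proof (rule P.finite_Lim_measure_incseq)
    show "range (\<lambda>n. \<Union>u\<in>F n. V u) \<subseteq> P.events" using finF V by auto
    show "incseq (\<lambda>n. \<Union>u\<in>F n. V u)" using incF by (intro incseq_SucI UN_mono) auto
  qed
  then have "P.prob (\<Union>n. \<Union>u\<in>F n. V u) \<le> 56 * E / nsq z" by (rule LIMSEQ_le_const2) (use b in auto)
  moreover have "(\<Union>n. \<Union>u\<in>F n. V u) = {\<omega>. hits_0 (tree_walk z \<omega>)}"
    unfolding V_def hits_0_def using covF by (auto; meson)
  ultimately show ?thesis by (simp add: killing_eq star_space_eq q_def E_def)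
qed

text \<open>If \<mu> does not charge 0, mean one forces \<mu> to be the point mass at 1; then the
  root of a bush has no children and bushes are single vertices. This degenerate case has to be
  separated in positivity and extinction arguments.\<close>

lemma critical_cases:
  assumes "critical \<mu>"
  shows "pmf \<mu> 0 > 0 \<or> pmf (root_offspring \<mu>) 0 = 1"
proof (cases "pmf \<mu> 0 = 0")
  case True
  have i: "integrable (measure_pmf \<mu>) (\<lambda>n. real n - 1)" using critical_expectation[OF assms] by simp
  have e: "measure_pmf.expectation \<mu> (\<lambda>n. real n - 1) = 0" using critical_expectation[OF assms] by simp
  have "AE n in measure_pmf \<mu>. 0 \<le> real n - 1"
  proof (subst AE_measure_pmf_iff, intro ballI)
    fix n assume "n \<in> set_pmf \<mu>"
    then have "n \<noteq> 0" using True by (metis set_pmf_iff)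
    then show "0 \<le> real n - 1" by simp
  qed
  then have "AE n in measure_pmf \<mu>. real n - 1 = 0" using integral_nonneg_eq_0_iff_AE[OF i] e by simp
  then have "set_pmf \<mu> \<subseteq> {1}" by (auto simp: AE_measure_pmf_iff)
  then have "\<mu> = return_pmf 1" by (simp add: set_pmf_subset_singleton)
  then show ?thesis using pmf_root_offspring[OF assms, of 0] by (simp add: size_biased_def)
next
  case False
  then show ?thesis using pmf_nonneg[of \<mu> 0] by linarith
qed

text \<open>An event of positive probability on which 0 is avoided: the root has a possible number i
  of children, all of them step to the same site z + e \<noteq> 0, and all are childless. For i > 0
  this uses \<mu> 0 > 0; otherwise i = 0 is available.\<close>

lemma killing_less_1:
  assumes c: "critical \<mu>" and z: "z \<noteq> 0"
  shows "killing \<mu> z < 1"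
proof -
  define q where "q = root_offspring \<mu>"
  interpret P: prob_space "gw_space q \<mu>" by (rule prob_space_gw)
  obtain i where i: "pmf q i > 0" "i = 0 \<or> pmf \<mu> 0 > 0"
  proof (cases "pmf \<mu> 0 > 0")
    case True
    obtain i where "i \<in> set_pmf q" using set_pmf_not_empty[of q] by blast
    then show thesis using True that[of i] by (simp add: pmf_positive)
  next
    case False
    then show thesis using critical_cases[OF c] that[of 0] by (simp add: q_def)
  qed
  obtain e where e: "e \<in> unit_vectors" "z + e \<noteq> 0"
  proof (cases "z + axis 1 1 = 0")
    case True
    have "axis 2 1 \<noteq> (axis 1 1 :: site)" by (simp add: axis_eq_axis)
    then have "z + axis 2 1 \<noteq> 0" using True by (metis add_left_cancel)
    then show thesis using that[of "axis 2 1"] by (auto simp: unit_vectors_def)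
  next
    case False
    then show thesis using that[of "axis 1 1"] by (auto simp: unit_vectors_def)
  qed
  define A where "A u = (if u = [] then {i} \<times> UNIV else {(0::nat, e)})" for u :: "nat list"
  define J where "J = insert [] ((\<lambda>j. [j]) ` {..<i})"
  define G where "G = {\<omega>. \<forall>u\<in>J. \<omega> u \<in> A u}"
  have J: "finite J" by (simp add: J_def)
  have "P.prob G = (\<Prod>u\<in>J. measure_pmf.prob (gw_label q \<mu> u) (A u))"
    unfolding G_def gw_space_def by (rule iprod_cylinder[OF J])
  also have "\<dots> > 0"
  proof (rule prod_pos)
    fix u assume u: "u \<in> J"
    have "\<exists>x\<in>A u. x \<in> set_pmf (gw_label q \<mu> u)"
    proof (cases "u = []")
      case True
      then show ?thesis using i e by (intro bexI[of _ "(i, e)"]) (auto simp: A_def gw_label_def set_step_pmf set_pmf_iff)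
    next
      case False
      then have "pmf \<mu> 0 > 0" using u i by (auto simp: J_def)
      then show ?thesis using False e by (intro bexI[of _ "(0, e)"]) (auto simp: A_def gw_label_def set_step_pmf set_pmf_iff)
    qed
    then obtain x where "x \<in> A u" "x \<in> set_pmf (gw_label q \<mu> u)" by blast
    then show "0 < measure_pmf.prob (gw_label q \<mu> u) (A u)" by (intro measure_pmf_posI[of x])
  qed
  finally have G0: "P.prob G > 0" .
  have "\<not> hits_0 (tree_walk z \<omega>)" if "\<omega> \<in> G" for \<omega>
  proof
    assume "hits_0 (tree_walk z \<omega>)"
    then obtain u where u: "tree_walk z \<omega> u = Some 0" by (auto simp: hits_0_def)
    have r: "fst (\<omega> []) = i" using that by (auto simp: G_def J_def A_def)
    have ch: "\<omega> [j] = (0, e)" if "j < i" for j using \<open>\<omega> \<in> G\<close> that by (auto simp: G_def J_def A_def)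
    show False
    proof (cases u)
      case Nil
      then show False using u z by (simp add: tree_walk_root)
    next
      case (Cons j v)
      then have j: "j < i" "tree_walk (z + e) (\<lambda>w. \<omega> (j # w)) v = Some 0"
        using u r ch[of j] by (auto simp: tree_walk_Cons split: if_splits)
      show False
      proof (cases v)
        case Nil
        then show False using j e by (simp add: tree_walk_root)
      next
        case (Cons l w)
        then show False using j ch[of j] by (simp add: tree_walk_Cons)
      qed
    qed
  qed
  then have "{\<omega>. hits_0 (tree_walk z \<omega>)} \<subseteq> UNIV - G" by auto
  moreover have Gs: "G \<in> P.events"
    unfolding G_def gw_space_def by (rule sets_iprod_finite[OF J]) auto
  moreover have "UNIV - G \<in> P.events" using sets.compl_sets[OF Gs] by simp
  ultimately have "P.prob {\<omega>. hits_0 (tree_walk z \<omega>)} \<le> P.prob (UNIV - G)" by (intro P.finite_measure_mono) auto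
  also have "\<dots> = 1 - P.prob G" using P.prob_compl[OF Gs] by simp
  finally show ?thesis using G0 by (simp add: killing_eq star_space_eq q_def)
qed

section \<open>Extinction\<close>

definition extinct_by :: "nat \<Rightarrow> (nat list \<Rightarrow> nat \<times> site) set" where
  "extinct_by m = {\<omega>. \<forall>u. length u = m \<longrightarrow> u \<notin> gw_tree (\<lambda>v. fst (\<omega> v))}"

lemma extinct_by_Suc: "\<omega> \<in> extinct_by (Suc m) \<longleftrightarrow> (\<forall>j<fst (\<omega> []). (\<lambda>w. \<omega> (j # w)) \<in> extinct_by m)"
proof
  assume h: "\<omega> \<in> extinct_by (Suc m)"
  show "\<forall>j<fst (\<omega> []). (\<lambda>w. \<omega> (j # w)) \<in> extinct_by m"
    unfolding extinct_by_def
  proof (intro allI impI CollectI)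
    fix j u assume "j < fst (\<omega> [])" "length (u :: nat list) = m"
    moreover from this have "j # u \<notin> gw_tree (\<lambda>v. fst (\<omega> v))" using h by (simp add: extinct_by_def)
    ultimately show "u \<notin> gw_tree (\<lambda>v. fst (\<omega> (j # v)))" by (simp add: gw_tree_Cons)
  qed
qed (auto simp: extinct_by_def length_Suc_conv gw_tree_Cons)

lemma gw_tree_snoc: "u @ [k] \<in> gw_tree N \<longleftrightarrow> u \<in> gw_tree N \<and> k < N u"
  by (auto simp: gw_tree_def less_Suc_eq nth_append)

lemma extinct_by_mono: "extinct_by m \<subseteq> extinct_by (Suc m)"
proof
  fix \<omega> assume "\<omega> \<in> extinct_by m"
  then show "\<omega> \<in> extinct_by (Suc m)"
    unfolding extinct_by_def by (auto simp: length_Suc_conv_rev gw_tree_snoc)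
qed

lemma sets_extinct_by: "extinct_by m \<in> sets (gw_space q \<mu>)"
proof -
  have "{\<omega>. u \<notin> gw_tree (\<lambda>v. fst (\<omega> v))} \<in> sets (gw_space q \<mu>)" for u
    unfolding gw_space_def
    by (rule sets_iprod_finite[of "(\<lambda>k. take k u) ` {..length u}"]) (auto simp: gw_tree_def)
  then have "(\<Inter>u\<in>{u. length u = m}. {\<omega>. u \<notin> gw_tree (\<lambda>v. fst (\<omega> v))}) \<in> sets (gw_space q \<mu>)"
    by (intro sets.countable_INT') (auto intro!: exI[of _ "replicate m 0"])
  moreover have "(\<Inter>u\<in>{u. length u = m}. {\<omega>. u \<notin> gw_tree (\<lambda>v. fst (\<omega> v))}) = extinct_by m"
    by (auto simp: extinct_by_def)
  ultimately show ?thesis by simp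
qed

lemma sub_extinct:
  "{\<omega>. (\<lambda>w. \<omega> (j # w)) \<in> extinct_by m} \<in> sets (gw_space q \<mu>)"
  "measure (gw_space q \<mu>) {\<omega>. (\<lambda>w. \<omega> (j # w)) \<in> extinct_by m} = measure (gw_space \<mu> \<mu>) (extinct_by m)"
proof -
  show "{\<omega>. (\<lambda>w. \<omega> (j # w)) \<in> extinct_by m} \<in> sets (gw_space q \<mu>)"
    using measurable_sets[OF measurable_iprod_reindex[of "(#) j" "gw_label q \<mu>"], of "extinct_by m"]
      sets_extinct_by[of m \<mu> \<mu>] unfolding gw_space_def gw_sub by (simp add: vimage_def)
  show "measure (gw_space q \<mu>) {\<omega>. (\<lambda>w. \<omega> (j # w)) \<in> extinct_by m} = measure (gw_space \<mu> \<mu>) (extinct_by m)"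
    using measure_iprod_reindex[of "(#) j" "extinct_by m" "gw_label q \<mu>"] sets_extinct_by[of m \<mu> \<mu>]
    unfolding gw_space_def gw_sub by simp
qed

lemma gw_root: "measure (gw_space q \<mu>) {\<omega>. fst (\<omega> []) = i} = pmf q i"
proof -
  have "measure (gw_space q \<mu>) {\<omega>. fst (\<omega> []) = i} = measure_pmf.prob (gw_label q \<mu> []) (fst -` {i})"
    unfolding gw_space_def using iprod_single[of "gw_label q \<mu>" "[]" "fst -` {i}"] by simp
  also have "\<dots> = measure_pmf.prob (map_pmf fst (gw_label q \<mu> [])) {i}" by simp
  also have "map_pmf fst (gw_label q \<mu> []) = q" by (simp add: gw_label_def map_fst_pair_pmf)
  finally show ?thesis by (simp add: measure_pmf_single)
qed

text \<open>The generating function of q appears because, given i children, the i subtrees are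
  independent \<mu>-trees that must all die out one generation earlier.\<close>

lemma prob_extinct_by_Suc:
  "measure (gw_space q \<mu>) (extinct_by (Suc m)) = measure_pmf.expectation q (\<lambda>i. measure (gw_space \<mu> \<mu>) (extinct_by m) ^ i)"
proof -
  interpret P: prob_space "gw_space q \<mu>" by (rule prob_space_gw)
  interpret M: prob_space "gw_space \<mu> \<mu>" by (rule prob_space_gw)
  define l where "l = M.prob (extinct_by m)"
  have l: "0 \<le> l" "l \<le> 1" by (auto simp: l_def)
  define A where "A i = {\<omega>. fst (\<omega> []) = i \<and> (\<forall>j<i. (\<lambda>w. \<omega> (j # w)) \<in> extinct_by m)}" for i
  have A: "A i \<in> P.events \<and> P.prob (A i) = pmf q i * l ^ i" for i
  proof -
    \<comment> \<open>\<open>None\<close> stands for the root and \<open>Some j\<close> for the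
      subtree of child j, so that all of them form one independent family.\<close>
    define E where "E o' = (case o' of None \<Rightarrow> {\<omega>. fst (\<omega> []) = i} | Some j \<Rightarrow> {\<omega>. (\<lambda>w. \<omega> (j # w)) \<in> extinct_by m})" for o'
    define K where "K o' = (case o' of None \<Rightarrow> {[]} | Some j \<Rightarrow> range ((#) j))" for o' :: "nat option"
    define L where "L = insert None (Some ` {..<i})"
    have root: "{\<omega>. fst (\<omega> []) = i} \<in> P.events" unfolding gw_space_def by (rule sets_iprod_finite[of "{[]}"]) auto
    have E: "E o' \<in> P.events" for o' unfolding E_def using sub_extinct root by (auto split: option.splits)
    have dep: "depends_on (E o') (K o')" for o'
    proof (cases o')
      case None
      then show ?thesis by (auto simp: depends_on_def E_def K_def)
    next
      case (Some j)
      show ?thesis unfolding depends_on_def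
      proof (intro allI impI)
        fix \<omega> \<omega>' :: "nat list \<Rightarrow> nat \<times> site" assume "\<forall>i\<in>K o'. \<omega> i = \<omega>' i"
        then have "(\<lambda>w. \<omega> (j # w)) = (\<lambda>w. \<omega>' (j # w))" using Some by (auto simp: K_def)
        then show "\<omega> \<in> E o' \<longleftrightarrow> \<omega>' \<in> E o'" using Some by (simp add: E_def)
      qed
    qed
    have Aeq: "A i = {\<omega>. \<forall>o'\<in>L. \<omega> \<in> E o'}" by (auto simp: A_def L_def E_def)
    have "P.prob (A i) = (\<Prod>o'\<in>L. P.prob (E o'))" unfolding Aeq gw_space_def
    proof (rule iprod_indep)
      show "disjoint_family_on K L" by (auto simp: disjoint_family_on_def K_def split: option.splits)
    qed (use E dep in \<open>auto simp: L_def gw_space_def\<close>)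
    also have "\<dots> = P.prob (E None) * (\<Prod>j<i. P.prob (E (Some j)))"
      unfolding L_def by (subst prod.insert) (auto simp: prod.reindex)
    also have "\<dots> = pmf q i * l ^ i" by (simp add: E_def gw_root sub_extinct l_def)
    finally have 1: "P.prob (A i) = pmf q i * l ^ i" .
    have "A i = (\<Inter>o'\<in>L. E o')" by (auto simp: Aeq)
    also have "\<dots> \<in> P.events" using E by (intro sets.finite_INT) (auto simp: L_def)
    finally show ?thesis using 1 by simp
  qed
  have "(\<lambda>i. P.prob (A i)) sums P.prob (\<Union>i. A i)"
    using A by (intro P.finite_measure_UNION) (auto simp: disjoint_family_on_def A_def)
  also have "(\<Union>i. A i) = extinct_by (Suc m)" by (auto simp: A_def extinct_by_Suc)
  also have "(\<lambda>i. P.prob (A i)) = (\<lambda>i. pmf q i * l ^ i)" using A by auto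
  finally have 1: "(\<lambda>i. pmf q i * l ^ i) sums P.prob (extinct_by (Suc m))" .
  have "integrable (measure_pmf q) (\<lambda>i. l ^ i)"
    using l by (intro measure_pmf.integrable_const_bound[where B = 1]) (auto simp: power_le_one)
  from pmf_nat_expectation_sums[OF this] 1 show ?thesis unfolding l_def using sums_unique2 by blast
qed

text \<open>The limit l of the extinction probabilities is a fixed point of the generating function
  of \<mu>. If l < 1, mean one would confine \<mu> to 0 and 1 and then, again by mean one, to 1
  alone, against \<mu> 0 > 0.\<close>

lemma prob_extinct_limit:
  assumes c: "critical \<mu>" and p0: "pmf \<mu> 0 > 0"
  shows "measure (gw_space \<mu> \<mu>) (\<Union>m. extinct_by m) = 1"
proof -
  interpret M: prob_space "gw_space \<mu> \<mu>" by (rule prob_space_gw)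
  define e where "e m = M.prob (extinct_by m)" for m
  define l where "l = M.prob (\<Union>m. extinct_by m)"
  have lim: "e \<longlonglongrightarrow> l" unfolding e_def l_def
    by (rule M.finite_Lim_measure_incseq) (auto simp: sets_extinct_by intro!: incseq_SucI extinct_by_mono)
  have l: "0 \<le> l" "l \<le> 1" by (auto simp: l_def)
  have "(\<lambda>m. measure_pmf.expectation \<mu> (\<lambda>i. e m ^ i)) \<longlonglongrightarrow> measure_pmf.expectation \<mu> (\<lambda>i. l ^ i)"
  proof (rule integral_dominated_convergence[where w = "\<lambda>_. 1"])
    show "AE x in measure_pmf \<mu>. (\<lambda>i. e i ^ x) \<longlonglongrightarrow> l ^ x" using lim by (auto intro!: tendsto_power)
    show "AE x in measure_pmf \<mu>. norm (e i ^ x) \<le> 1" for i by (auto simp: e_def power_le_one)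
  qed auto
  moreover have "(\<lambda>m. measure_pmf.expectation \<mu> (\<lambda>i. e m ^ i)) \<longlonglongrightarrow> l"
    using LIMSEQ_Suc[OF lim] prob_extinct_by_Suc[of \<mu> \<mu>] by (simp add: e_def)
  ultimately have fixpoint: "measure_pmf.expectation \<mu> (\<lambda>i. l ^ i) = l" by (rule LIMSEQ_unique)
  have il: "integrable (measure_pmf \<mu>) (\<lambda>i. l ^ i)"
    using l by (intro measure_pmf.integrable_const_bound[where B = 1]) (auto simp: power_le_one)
  show ?thesis
  proof (rule ccontr)
    assume "\<not> ?thesis"
    then have "l \<noteq> 1" by (simp add: l_def)
    then have l1: "l < 1" using l by linarith
    \<comment> \<open>The slack in 1 - l^i \<le> i (1 - l). It is nonnegative with mean 0 by
      criticality and the fixed point equation, hence vanishes on the support, but it is positive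
      for i \<ge> 2.\<close>
    define g where "g i = real i * (1 - l) - (1 - l ^ i)" for i
    have gi: "integrable (measure_pmf \<mu>) g" unfolding g_def using il critical_expectation(1)[OF c] by simp
    have "measure_pmf.expectation \<mu> g = 1 * (1 - l) - (1 - l)"
      unfolding g_def using il critical_expectation[OF c] fixpoint by simp
    then have g0: "measure_pmf.expectation \<mu> g = 0" by simp
    have geo: "1 - l ^ i = (1 - l) * (\<Sum>k<i. l ^ k)" for i by (rule one_diff_power_eq)
    have gnn: "0 \<le> g i" for i
    proof -
      have "(\<Sum>k<i. l ^ k) \<le> (\<Sum>k<i. 1)" using l by (intro sum_mono) (auto simp: power_le_one)
      then have "(1 - l) * (\<Sum>k<i. l ^ k) \<le> (1 - l) * real i" using l1 by (intro mult_left_mono) auto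
      then show ?thesis unfolding g_def geo by (simp add: mult.commute)
    qed
    have "AE i in measure_pmf \<mu>. g i = 0" using integral_nonneg_eq_0_iff_AE[OF gi] g0 gnn by simp
    then have z: "g i = 0" if "i \<in> set_pmf \<mu>" for i using that by (auto simp: AE_measure_pmf_iff)
    have small: "i \<le> 1" if i: "i \<in> set_pmf \<mu>" for i
    proof (rule ccontr)
      assume "\<not> i \<le> 1"
      then have i2: "1 < i" by simp
      have "(\<Sum>k<i. l ^ k) < (\<Sum>k<i. 1)"
        using i2 l l1 by (intro sum_strict_mono_ex1) (auto simp: power_le_one intro!: bexI[of _ 1])
      then have "(1 - l) * (\<Sum>k<i. l ^ k) < (1 - l) * real i" using l1 by (intro mult_strict_left_mono) auto
      then show False using z[OF i] unfolding g_def geo by (simp add: mult.commute)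
    qed
    have nn: "AE i in measure_pmf \<mu>. 0 \<le> 1 - real i" using small by (auto simp: AE_measure_pmf_iff)
    have "integrable (measure_pmf \<mu>) (\<lambda>i. 1 - real i)" "measure_pmf.expectation \<mu> (\<lambda>i. 1 - real i) = 0"
      using critical_expectation[OF c] by simp_all
    then have "AE i in measure_pmf \<mu>. 1 - real i = 0" using integral_nonneg_eq_0_iff_AE nn by blast
    moreover have "0 \<in> set_pmf \<mu>" using p0 by (simp add: set_pmf_iff)
    ultimately show False by (auto simp: AE_measure_pmf_iff)
  qed
qed

lemma finite_gw_tree:
  assumes "\<And>u. length u = m \<Longrightarrow> u \<notin> gw_tree N"
  shows "finite (gw_tree N)"
proof -
  have lev: "finite {u \<in> gw_tree N. length u = k}" for k
  proof (induction k)
    case (Suc k)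
    have "{u \<in> gw_tree N. length u = Suc k} \<subseteq> (\<Union>u\<in>{u \<in> gw_tree N. length u = k}. (\<lambda>i. u @ [i]) ` {..<N u})"
      by (auto simp: length_Suc_conv_rev gw_tree_snoc)
    then show ?case by (rule finite_subset) (use Suc in auto)
  qed auto
  have "length u < m" if u: "u \<in> gw_tree N" for u
  proof (rule ccontr)
    assume "\<not> length u < m"
    then have "length (take m u) = m" by simp
    moreover have "take m u \<in> gw_tree N" using u by (auto simp: gw_tree_def min_def)
    ultimately show False using assms by blast
  qed
  then have "gw_tree N \<subseteq> (\<Union>k<m. {u \<in> gw_tree N. length u = k})" by auto
  then show ?thesis by (rule finite_subset) (use lev in auto)
qed

lemma gw_tree_finite_trees:
  assumes "finite (gw_tree N)"
  shows "gw_tree N \<in> finite_trees"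
  using assms unfolding finite_trees_def by (auto simp: gw_tree_snoc) (simp add: gw_tree_def)

text \<open>Almost surely all subtrees of children of the root die out; the root has finitely many
  children, so the largest of their extinction times bounds the height.\<close>

lemma AE_star_finite:
  assumes c: "critical \<mu>"
  shows "AE \<omega> in star_space \<mu>. finite (gw_tree (\<lambda>v. fst (\<omega> v)))"
proof -
  define q where "q = root_offspring \<mu>"
  interpret P: prob_space "gw_space q \<mu>" by (rule prob_space_gw)
  have "AE \<omega> in gw_space q \<mu>. \<exists>m. \<omega> \<in> extinct_by m"
  proof (cases "pmf \<mu> 0 > 0")
    case True
    have "AE \<omega> in gw_space q \<mu>. \<exists>m. (\<lambda>w. \<omega> (j # w)) \<in> extinct_by m" for j
    proof -
      interpret M: prob_space "gw_space \<mu> \<mu>" by (rule prob_space_gw)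
      have "M.prob (\<Union>m. extinct_by m) = 1" by (rule prob_extinct_limit[OF c True])
      then have "AE \<omega> in gw_space \<mu> \<mu>. \<omega> \<in> (\<Union>m. extinct_by m)" by (rule M.AE_prob_1)
      moreover have "distr (gw_space q \<mu>) (gw_space \<mu> \<mu>) (\<lambda>\<omega> w. \<omega> (j # w)) = gw_space \<mu> \<mu>"
        using distr_iprod_reindex[of "(#) j" "gw_label q \<mu>"] unfolding gw_space_def gw_sub by simp
      ultimately have "AE \<omega> in distr (gw_space q \<mu>) (gw_space \<mu> \<mu>) (\<lambda>\<omega> w. \<omega> (j # w)). \<omega> \<in> (\<Union>m. extinct_by m)"
        by (simp only:)
      from AE_distrD[OF _ this] show ?thesis
        using measurable_iprod_reindex[of "(#) j" "gw_label q \<mu>"] unfolding gw_space_def gw_sub by simp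
    qed
    then have "AE \<omega> in gw_space q \<mu>. \<forall>j. \<exists>m. (\<lambda>w. \<omega> (j # w)) \<in> extinct_by m" by (simp add: AE_all_countable)
    then show ?thesis
    proof eventually_elim
      case (elim \<omega>)
      then obtain f where f: "\<And>j. (\<lambda>w. \<omega> (j # w)) \<in> extinct_by (f j)" by metis
      have up: "extinct_by m \<subseteq> extinct_by m'" if "m \<le> m'" for m m'
        using that extinct_by_mono by (rule lift_Suc_mono_le[rotated])
      define m where "m = Max (insert 0 (f ` {..<fst (\<omega> [])}))"
      have "(\<lambda>w. \<omega> (j # w)) \<in> extinct_by m" if "j < fst (\<omega> [])" for j
        using up[of "f j" m] f that by (auto simp: m_def)
      then have "\<omega> \<in> extinct_by (Suc m)" by (simp add: extinct_by_Suc)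
      then show ?case ..
    qed
  next
    case False
    then have "pmf q 0 = 1" using critical_cases[OF c] by (simp add: q_def)
    then have "P.prob {\<omega>. fst (\<omega> []) = 0} = 1" by (simp add: gw_root)
    then have "AE \<omega> in gw_space q \<mu>. \<omega> \<in> {\<omega>. fst (\<omega> []) = 0}" by (rule P.AE_prob_1)
    then show ?thesis by eventually_elim (auto simp: extinct_by_Suc intro: exI[of _ "Suc 0"])
  qed
  then show ?thesis unfolding star_space_eq q_def
    by eventually_elim (auto simp: extinct_by_def intro: finite_gw_tree)
qed

lemma sets_dom_finite_trees: "{w :: nat list \<rightharpoonup> site. dom w \<in> finite_trees} \<in> sets tree_maps"
proof -
  have ct: "countable (finite_trees :: nat list set set)"
    by (rule countable_subset[OF _ countable_Collect_finite]) (auto simp: finite_trees_def)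
  have "{w :: nat list \<rightharpoonup> site. dom w = t} \<in> sets tree_maps" for t
  proof -
    have "{w :: nat list \<rightharpoonup> site. dom w = t} = (\<Inter>u. {w. w u \<in> (if u \<in> t then - {None} else {None})})"
      by (auto simp: dom_def set_eq_iff split: if_splits) (metis option.distinct(1))+
    also have "\<dots> \<in> sets tree_maps" using sets.top[of tree_maps] by (intro sets.countable_INT'' sets_maps_component) (auto simp: space_PiM)
    finally show ?thesis .
  qed
  then have "(\<Union>t\<in>finite_trees. {w :: nat list \<rightharpoonup> site. dom w = t}) \<in> sets tree_maps" using ct by (intro sets.countable_UN') auto
  moreover have "(\<Union>t\<in>finite_trees. {w :: nat list \<rightharpoonup> site. dom w = t}) = {w. dom w \<in> finite_trees}" by auto
  ultimately show ?thesis by simp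
qed

lemma AE_star_law_finite_tree:
  assumes "critical \<mu>"
  shows "AE w in star_law \<mu> x. dom w \<in> finite_trees"
  unfolding star_law_def
proof (subst AE_distr_iff)
  show "tree_walk x \<in> measurable (star_space \<mu>) tree_maps" unfolding star_space_eq by (rule measurable_tree_walk)
  show "{w \<in> space tree_maps. dom w \<in> finite_trees} \<in> sets tree_maps" using sets_dom_finite_trees by (simp add: space_PiM)
  show "AE \<omega> in star_space \<mu>. dom (tree_walk x \<omega>) \<in> finite_trees"
    using AE_star_finite[OF assms] by eventually_elim (auto simp: dom_tree_walk intro: gw_tree_finite_trees)
qed

section \<open>The Markov property of the infinite snake\<close>

text \<open>Polymorphic in the values, because both the driving labels and the snakes themselves are
  shifted; \<open>shift_snake\<close> relates the two.\<close>

definition shift_bushes :: "(vertex \<Rightarrow> 'a) \<Rightarrow> vertex \<Rightarrow> 'a" where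
  "shift_bushes f = (\<lambda>(i, u). f (Suc i, u))"

lemma kesten_space_eq: "kesten_space \<mu> = iprod (\<lambda>p. gw_label (root_offspring \<mu>) \<mu> (snd p))"
proof -
  have "(\<lambda>(i :: nat, u). measure_pmf (label_pmf \<mu> u)) = (\<lambda>p. measure_pmf (gw_label (root_offspring \<mu>) \<mu> (snd p)))"
    by (simp add: gw_label_def label_pmf_def case_prod_unfold)
  then show ?thesis unfolding kesten_space_def iprod_def by (simp only:)
qed

lemma star_space_iprod: "star_space \<mu> = iprod (gw_label (root_offspring \<mu>) \<mu>)"
  by (simp add: star_space_eq gw_space_def)

lemma prob_space_kesten: "prob_space (kesten_space \<mu>)"
  unfolding kesten_space_eq by (rule prob_space_iprod)

lemma space_kesten [simp]: "space (kesten_space \<mu>) = UNIV"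
  by (simp add: kesten_space_eq)

lemma space_snake_space [simp]: "space snake_space = UNIV"
  by (simp add: snake_space_def space_PiM)

lemma snake_cong:
  assumes "\<And>u. fst (\<omega> (i, u)) = fst (\<omega>' (i, u))" "\<And>u. u \<noteq> [] \<Longrightarrow> snd (\<omega> (i, u)) = snd (\<omega>' (i, u))"
    "\<And>j. 1 \<le> j \<Longrightarrow> j \<le> i \<Longrightarrow> snd (\<omega> (j, [])) = snd (\<omega>' (j, []))"
  shows "snake x \<omega> (i, u) = snake x \<omega>' (i, u)"
proof -
  have "(\<Sum>j=1..i. snd (\<omega> (spine j))) = (\<Sum>j=1..i. snd (\<omega>' (spine j)))"
    using assms(3) by (intro sum.cong refl) (auto simp: spine_def)
  moreover have "tree_walk y (\<lambda>v. \<omega> (i, v)) u = tree_walk y (\<lambda>v. \<omega>' (i, v)) u" for y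
    using assms(1) by (intro tree_walk_cong) (auto intro!: assms(2))
  ultimately show ?thesis by (simp add: snake_def)
qed

lemma measurable_snake: "snake x \<in> measurable (kesten_space \<mu>) snake_space"
  unfolding kesten_space_eq snake_space_def
proof (rule measurable_into_maps[where J = "\<lambda>(i, u). (\<lambda>k. (i, take k u)) ` {..length u} \<union> spine ` {..i}"])
  fix p :: vertex and \<omega> \<omega>' :: "vertex \<Rightarrow> nat \<times> site"
  obtain i u where p: "p = (i, u)" by fastforce
  assume h: "\<And>v. v \<in> (case p of (i, u) \<Rightarrow> (\<lambda>k. (i, take k u)) ` {..length u} \<union> spine ` {..i}) \<Longrightarrow> \<omega> v = \<omega>' v"
  have "(\<Sum>j=1..i. snd (\<omega> (spine j))) = (\<Sum>j=1..i. snd (\<omega>' (spine j)))"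
    using h by (intro sum.cong refl) (auto simp: p)
  moreover have "tree_walk y (\<lambda>v. \<omega> (i, v)) u = tree_walk y (\<lambda>v. \<omega>' (i, v)) u" for y
    using h by (intro tree_walk_cong) (auto simp: p)
  ultimately show "snake x \<omega> p = snake x \<omega>' p" by (simp add: snake_def p)
qed auto

lemma bush_snake_0: "bush (snake x \<omega>) 0 = tree_walk x (\<lambda>u. \<omega> (0, u))"
  by (auto simp: bush_def snake_def)

lemma shift_snake: "shift_bushes (snake x \<omega>) = snake (x + snd (\<omega> (1, []))) (shift_bushes \<omega>)"
proof
  fix p :: vertex
  obtain i u where p: "p = (i, u)" by fastforce
  have "(\<Sum>j=1..Suc i. snd (\<omega> (spine j))) = snd (\<omega> (1, [])) + (\<Sum>j=1..i. snd (\<omega> (Suc j, [])))"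
    using sum.shift_bounds_cl_Suc_ivl[of "\<lambda>j. snd (\<omega> (spine j))" 1 i]
    by (subst sum.atLeast_Suc_atMost) (simp_all add: spine_def del: sum.cl_ivl_Suc)
  then show "shift_bushes (snake x \<omega>) p = snake (x + snd (\<omega> (1, []))) (shift_bushes \<omega>) p"
    by (simp add: p shift_bushes_def snake_def spine_def add.assoc)
qed

lemma snake_spine_0: "snake x \<omega> (spine 0) = Some x"
  by (simp add: snake_def spine_def tree_walk_root)

lemma prob_space_snake_law: "prob_space (snake_law \<mu> x)"
  unfolding snake_law_def by (intro prob_space.prob_space_distr prob_space_kesten measurable_snake)

lemma measure_snake_law:
  assumes "E \<in> sets snake_space"
  shows "measure (snake_law \<mu> x) E = measure (kesten_space \<mu>) {\<omega>. snake x \<omega> \<in> E}"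
  unfolding snake_law_def by (subst measure_distr[OF measurable_snake assms]) (simp add: vimage_def)

lemma sets_snake_law [simp]: "sets (snake_law \<mu> x) = sets snake_space"
  by (simp add: snake_law_def)

lemma space_snake_law [simp]: "space (snake_law \<mu> x) = UNIV"
  by (simp add: snake_law_def)

lemma sets_snake: "E \<in> sets snake_space \<Longrightarrow> {\<omega>. snake x \<omega> \<in> E} \<in> sets (kesten_space \<mu>)"
  using measurable_sets[OF measurable_snake[of x \<mu>], of E] by (simp add: vimage_def)

text \<open>Bush 0 and the later bushes use disjoint labels. The first spine step is stored at (1,
  []), the root label of the shifted family, and the shifted snake is unaffected by the increment
  there, so \<open>iprod_second_indep\<close> splits it off. Prescribing the step as e makes the
  starting point x + e of the shifted snake deterministic.\<close>

lemma markov_snake: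
  assumes B: "B \<in> sets tree_maps" and E: "E \<in> sets snake_space"
  shows "measure (kesten_space \<mu>) {\<omega>. bush (snake x \<omega>) 0 \<in> B \<and> snd (\<omega> (1, [])) = e \<and> shift_bushes (snake x \<omega>) \<in> E}
    = measure (star_law \<mu> x) B * (pmf step_pmf e * measure (snake_law \<mu> (x + e)) E)"
    (is "measure ?K ?S = _")
    and "{\<omega>. bush (snake x \<omega>) 0 \<in> B \<and> snd (\<omega> (1, [])) = e \<and> shift_bushes (snake x \<omega>) \<in> E} \<in> sets (kesten_space \<mu>)"
proof -
  define L where "L = gw_label (root_offspring \<mu>) \<mu>"
  define K where "K = (\<lambda>p :: vertex. L (snd p))"
  have Kes: "kesten_space \<mu> = iprod K" by (simp add: kesten_space_eq K_def L_def)
  have St: "star_space \<mu> = iprod L" by (simp add: star_space_iprod L_def)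
  define f :: "vertex \<Rightarrow> vertex" where "f = (\<lambda>(i, u). (Suc i, u))"
  have inj: "inj f" "inj (Pair (0::nat) :: nat list \<Rightarrow> vertex)" by (auto simp: inj_def f_def)
  have Kf: "(\<lambda>p. K (f p)) = K" "(\<lambda>u. K (0, u)) = L" by (auto simp: K_def f_def fun_eq_iff)
  have sh: "shift_bushes \<omega> = (\<lambda>p. \<omega> (f p))" for \<omega> :: "vertex \<Rightarrow> nat \<times> site" by (auto simp: shift_bushes_def f_def fun_eq_iff)
  have s0: "shift_bushes \<omega> (0, []) = \<omega> (Suc 0, [])" for \<omega> :: "vertex \<Rightarrow> nat \<times> site" by (simp add: shift_bushes_def)
  define A0 where "A0 = {\<omega>. tree_walk x \<omega> \<in> B}"
  define C0 where "C0 = {\<omega> \<in> {\<omega>. snake (x + e) \<omega> \<in> E}. snd (\<omega> (0, [])) = e}"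
  have A0: "A0 \<in> sets (iprod L)" using sets_tree_walk[OF B, of x "root_offspring \<mu>" \<mu>] by (simp add: A0_def L_def gw_space_def)
  have E0: "{\<omega>. snake (x + e) \<omega> \<in> E} \<in> sets (iprod K)" using sets_snake[OF E, of "x + e" \<mu>] by (simp add: Kes)
  have "{\<omega>. snd (\<omega> (0, [])) = e} \<in> sets (iprod K)" by (rule sets_iprod_finite[of "{(0, [])}"]) auto
  from sets.Int[OF E0 this] have C0: "C0 \<in> sets (iprod K)" by (simp add: C0_def Int_def)
  have mC0: "measure (iprod K) C0 = pmf step_pmf e * measure (snake_law \<mu> (x + e)) E"
    unfolding C0_def measure_snake_law[OF E] Kes
  proof (rule iprod_second_indep[OF _ E0])
    show "K (0, []) = pair_pmf (root_offspring \<mu>) step_pmf" by (simp add: K_def L_def gw_label_def)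
    fix \<omega> :: "vertex \<Rightarrow> nat \<times> site" and c c' d
    have "snake (x + e) (fun_upd \<omega> (0, []) (d, c)) p = snake (x + e) (fun_upd \<omega> (0, []) (d, c')) p" for p
      by (cases p) (auto intro!: snake_cong)
    then have "snake (x + e) (fun_upd \<omega> (0, []) (d, c)) = snake (x + e) (fun_upd \<omega> (0, []) (d, c'))" by (rule ext)
    then show "fun_upd \<omega> (0, []) (d, c) \<in> {\<omega>. snake (x + e) \<omega> \<in> E} \<Longrightarrow> fun_upd \<omega> (0, []) (d, c') \<in> {\<omega>. snake (x + e) \<omega> \<in> E}"
      by simp
  qed
  define A where "A = {\<omega> :: vertex \<Rightarrow> nat \<times> site. (\<lambda>u. \<omega> (0, u)) \<in> A0}"
  define C where "C = {\<omega> :: vertex \<Rightarrow> nat \<times> site. (\<lambda>p. \<omega> (f p)) \<in> C0}"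
  have A: "A \<in> sets (iprod K)"
    using measurable_sets[OF measurable_iprod_reindex[of "Pair 0" K], of A0] A0 by (simp add: A_def Kf vimage_def)
  have C: "C \<in> sets (iprod K)"
    using measurable_sets[OF measurable_iprod_reindex[of f K], of C0] C0 by (simp add: C_def Kf vimage_def)
  have mA: "measure (iprod K) A = measure (star_law \<mu> x) B"
    using measure_iprod_reindex[of "Pair 0" A0 K] A0 inj by (simp add: A_def Kf measure_star_law[OF B] A0_def St)
  have mC: "measure (iprod K) C = measure (iprod K) C0"
    using measure_iprod_reindex[of f C0 K] C0 inj by (simp add: C_def Kf)
  have eq: "?S = A \<inter> C"
    by (auto simp: A_def A0_def C_def C0_def bush_snake_0 shift_snake sh[symmetric] s0)
  have "measure (iprod K) (A \<inter> C) = measure (iprod K) A * measure (iprod K) C"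
  proof (rule iprod_indep2[OF A C])
    show "depends_on A (range (Pair 0))"
      unfolding depends_on_def
    proof (intro allI impI)
      fix \<omega> \<omega>' :: "vertex \<Rightarrow> nat \<times> site" assume "\<forall>i\<in>range (Pair 0). \<omega> i = \<omega>' i"
      then have "(\<lambda>u. \<omega> (0, u)) = (\<lambda>u. \<omega>' (0, u))" by auto
      then show "\<omega> \<in> A \<longleftrightarrow> \<omega>' \<in> A" by (simp add: A_def)
    qed
    show "depends_on C (range f)"
      unfolding depends_on_def
    proof (intro allI impI)
      fix \<omega> \<omega>' :: "vertex \<Rightarrow> nat \<times> site" assume "\<forall>i\<in>range f. \<omega> i = \<omega>' i"
      then have "(\<lambda>p. \<omega> (f p)) = (\<lambda>p. \<omega>' (f p))" by auto
      then show "\<omega> \<in> C \<longleftrightarrow> \<omega>' \<in> C" by (simp add: C_def)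
    qed
    show "range (Pair 0) \<inter> range f = {}" by (auto simp: f_def)
  qed
  then show "measure ?K ?S = measure (star_law \<mu> x) B * (pmf step_pmf e * measure (snake_law \<mu> (x + e)) E)"
    unfolding eq Kes by (simp add: mA mC mC0)
  show "?S \<in> sets (kesten_space \<mu>)" unfolding eq Kes using A C by (rule sets.Int)
qed

lemma sets_snake_component: "{w. w p \<in> B} \<in> sets snake_space"
  unfolding snake_space_def by (rule sets_maps_component)

lemma sets_snake_UNIV: "UNIV \<in> sets snake_space"
  using sets.top[of snake_space] by simp

lemma sets_hits_before_0: "{w. hits_before_0 A w} \<in> sets snake_space"
proof -
  have "{w. hits_before_0 A w} = (\<Union>j. {w. w (spine j) \<in> Some ` A} \<inter>
      (\<Inter>u. {w. w u \<in> (if before u (spine j) \<or> u = spine j then - {Some 0} else UNIV)}))"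
  proof (rule set_eqI)
    fix w :: "vertex \<rightharpoonup> site"
    have "hits_before_0 A w \<longleftrightarrow>
        (\<exists>j. w (spine j) \<in> Some ` A \<and> (\<forall>u. before u (spine j) \<or> u = spine j \<longrightarrow> w u \<noteq> Some 0))"
    proof -
      have "(\<forall>u\<in>dom w. P u \<longrightarrow> w u \<noteq> Some 0) \<longleftrightarrow> (\<forall>u. P u \<longrightarrow> w u \<noteq> Some 0)" for P by (metis domI)
      moreover have "(\<exists>z\<in>A. w p = Some z) \<longleftrightarrow> w p \<in> Some ` A" for p by blast
      ultimately show ?thesis unfolding hits_before_0_def by (simp only:)
    qed
    also have "\<dots> \<longleftrightarrow> w \<in> (\<Union>j. {w. w (spine j) \<in> Some ` A} \<inter>
      (\<Inter>u. {w. w u \<in> (if before u (spine j) \<or> u = spine j then - {Some 0} else UNIV)}))"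
      by (simp only: UN_iff Int_iff INT_iff mem_Collect_eq UNIV_I bex_simps ball_simps if_split_mem2 ComplD) (simp split: if_splits; metis)
    finally show "w \<in> {w. hits_before_0 A w} \<longleftrightarrow> w \<in> (\<Union>j. {w. w (spine j) \<in> Some ` A} \<inter>
      (\<Inter>u. {w. w u \<in> (if before u (spine j) \<or> u = spine j then - {Some 0} else UNIV)}))" by simp
  qed
  also have "\<dots> \<in> sets snake_space"
  proof (intro sets.countable_UN image_subsetI)
    fix j
    have "(\<Inter>u. {w :: vertex \<rightharpoonup> site. w u \<in> (if before u (spine j) \<or> u = spine j then - {Some 0} else UNIV)}) \<in> sets snake_space"
      by (rule sets.countable_INT''[OF sets_snake_UNIV countableI_type sets_snake_component])
    then show "{w. w (spine j) \<in> Some ` A} \<inter>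
      (\<Inter>u. {w. w u \<in> (if before u (spine j) \<or> u = spine j then - {Some 0} else UNIV)}) \<in> sets snake_space"
      by (rule sets.Int[OF sets_snake_component])
  qed
  finally show ?thesis .
qed

lemma measurable_bush: "(\<lambda>w. bush w i) \<in> measurable snake_space tree_maps"
  unfolding snake_space_def bush_def
  by (rule measurable_PiM_single') (auto simp: space_PiM intro!: measurable_component_singleton)

lemma sets_bush: "B \<in> sets tree_maps \<Longrightarrow> {w. bush w i \<in> B} \<in> sets snake_space"
  using measurable_sets[OF measurable_bush, of B i] by (simp add: vimage_def)

text \<open>Under the assumption on x the hit cannot occur at index 0: for x = 0 the vertex itself
  must avoid 0. So the hitting index is positive, and all of bush 0 comes before it.\<close>

lemma hits_before_0_shift:
  assumes w0: "w (spine 0) = Some x" and x: "x \<notin> A \<or> x = 0"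
  shows "hits_before_0 A w \<longleftrightarrow> \<not> hits_0 (bush w 0) \<and> hits_before_0 A (shift_bushes w)"
proof
  assume "hits_before_0 A w"
  then obtain j z where j: "z \<in> A" "w (spine j) = Some z"
    and n: "\<And>u. u \<in> dom w \<Longrightarrow> before u (spine j) \<or> u = spine j \<Longrightarrow> w u \<noteq> Some 0"
    unfolding hits_before_0_def by blast
  have "j \<noteq> 0"
  proof
    assume "j = 0"
    then have "x \<in> A" "x \<noteq> 0" using j w0 n[of "spine 0"] by auto
    then show False using x by simp
  qed
  then obtain i where i: "j = Suc i" by (cases j) auto
  have "\<not> hits_0 (bush w 0)"
    using n i by (force simp: hits_0_def bush_def before_def spine_def dom_def)
  moreover have "hits_before_0 A (shift_bushes w)"
    unfolding hits_before_0_def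
  proof (intro exI[of _ i] conjI ballI impI)
    show "\<exists>z\<in>A. shift_bushes w (spine i) = Some z" using j i by (auto simp: shift_bushes_def spine_def)
    fix u assume "u \<in> dom (shift_bushes w)" and "before u (spine i) \<or> u = spine i"
    then show "shift_bushes w u \<noteq> Some 0"
      using n[of "(Suc (fst u), snd u)"] i by (cases u) (auto simp: shift_bushes_def before_def spine_def)
  qed
  ultimately show "\<not> hits_0 (bush w 0) \<and> hits_before_0 A (shift_bushes w)" ..
next
  assume h: "\<not> hits_0 (bush w 0) \<and> hits_before_0 A (shift_bushes w)"
  then obtain i z where i: "z \<in> A" "shift_bushes w (spine i) = Some z"
    and n: "\<And>u. u \<in> dom (shift_bushes w) \<Longrightarrow> before u (spine i) \<or> u = spine i \<Longrightarrow> shift_bushes w u \<noteq> Some 0"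
    unfolding hits_before_0_def by blast
  show "hits_before_0 A w"
    unfolding hits_before_0_def
  proof (intro exI[of _ "Suc i"] conjI ballI impI)
    show "\<exists>z\<in>A. w (spine (Suc i)) = Some z" using i by (auto simp: shift_bushes_def spine_def)
    fix p assume p: "p \<in> dom w" and b: "before p (spine (Suc i)) \<or> p = spine (Suc i)"
    show "w p \<noteq> Some 0"
    proof (cases "fst p")
      case 0
      then show ?thesis using h by (cases p) (auto simp: hits_0_def bush_def)
    next
      case (Suc k)
      have "(k, snd p) \<in> dom (shift_bushes w)" using p Suc by (cases p) (auto simp: shift_bushes_def)
      then show ?thesis using Suc n[of "(k, snd p)"] b by (cases p) (auto simp: shift_bushes_def before_def spine_def)
    qed
  qed
qed

lemma hits_before_0_snake:
  assumes "x \<notin> A \<or> x = 0"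
  shows "hits_before_0 A (snake x \<omega>) \<longleftrightarrow>
    \<not> hits_0 (bush (snake x \<omega>) 0) \<and> hits_before_0 A (shift_bushes (snake x \<omega>))"
  by (rule hits_before_0_shift[where w = "snake x \<omega>" and x = x]) (use assms snake_spine_0 in auto)

section \<open>The hitting probability as a positive harmonic function of the killed walk\<close>

definition hit_prob :: "nat pmf \<Rightarrow> site set \<Rightarrow> site \<Rightarrow> real" where
  "hit_prob \<mu> A x = measure (snake_law \<mu> x) {w. hits_before_0 A w}"

lemma hit_prob_eq: "hit_prob \<mu> A x = measure (kesten_space \<mu>) {\<omega>. hits_before_0 A (snake x \<omega>)}"
  unfolding hit_prob_def using measure_snake_law[OF sets_hits_before_0, of \<mu> x A] by simp

lemma hit_prob_nonneg: "0 \<le> hit_prob \<mu> A x"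
  by (simp add: hit_prob_def)

lemma hit_prob_0: "hit_prob \<mu> A 0 = 0"
proof -
  have "\<not> hits_before_0 A (snake 0 \<omega>)" for \<omega>
  proof
    assume "hits_before_0 A (snake 0 \<omega>)"
    then obtain j where j: "\<And>u. u \<in> dom (snake 0 \<omega>) \<Longrightarrow> before u (spine j) \<or> u = spine j \<Longrightarrow> snake 0 \<omega> u \<noteq> Some 0"
      unfolding hits_before_0_def by blast
    show False using j[of "spine 0"] snake_spine_0[of 0 \<omega>] by (cases "j = 0") (auto simp: before_def spine_def)
  qed
  then show ?thesis by (simp add: hit_prob_eq)
qed

lemma hit_prob_inside:
  assumes "x \<in> A" "x \<noteq> 0"
  shows "hit_prob \<mu> A x = 1"
proof -
  interpret prob_space "kesten_space \<mu>" by (rule prob_space_kesten)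
  have "hits_before_0 A (snake x \<omega>)" for \<omega>
    unfolding hits_before_0_def
    using assms by (intro exI[of _ 0]) (auto simp: snake_spine_0 before_def spine_def snake_spine_0[unfolded spine_def])
  then show ?thesis using prob_space by (simp add: hit_prob_eq)
qed

lemma prob_not_hits_0: "measure (star_law \<mu> x) {w. \<not> hits_0 w} = 1 - killing \<mu> x"
proof -
  interpret prob_space "star_law \<mu> x" by (rule prob_space_star_law)
  have "{w. \<not> hits_0 w} = space (star_law \<mu> x) - {w. hits_0 w}" by auto
  then show ?thesis using prob_compl[of "{w. hits_0 w}"] sets_hits_0 by (simp add: killing_def sets_star_law)
qed

lemma sets_not_hits_0: "{w. \<not> hits_0 w} \<in> sets tree_maps"
proof -
  have "{w. \<not> hits_0 w} = space tree_maps - {w. hits_0 w}" by (auto simp: space_PiM)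
  then show ?thesis using sets_hits_0 by auto
qed

lemma hit_prob_step:
  assumes x: "x \<notin> A"
  shows "hit_prob \<mu> A x = (1 - killing \<mu> x) * avg (hit_prob \<mu> A) x"
proof -
  interpret K: prob_space "kesten_space \<mu>" by (rule prob_space_kesten)
  define S where "S e = {\<omega>. bush (snake x \<omega>) 0 \<in> {w. \<not> hits_0 w} \<and> snd (\<omega> (1, [])) = e \<and>
      shift_bushes (snake x \<omega>) \<in> {w. hits_before_0 A w}}" for e
  note M = markov_snake[OF sets_not_hits_0 sets_hits_before_0[of A], where \<mu> = \<mu> and x = x]
  have S: "S e \<in> K.events" for e unfolding S_def by (rule M(2))
  have mS: "K.prob (S e) = (1 - killing \<mu> x) * (pmf step_pmf e * hit_prob \<mu> A (x + e))" for e
    unfolding S_def M(1) by (simp add: prob_not_hits_0 hit_prob_def)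
  have ae: "AE \<omega> in kesten_space \<mu>. snd (\<omega> (1, [])) \<in> unit_vectors"
    unfolding kesten_space_eq by (rule AE_iprod_component) (auto simp: gw_label_def set_step_pmf)
  have "hit_prob \<mu> A x = K.prob (\<Union>e\<in>unit_vectors. S e)"
    unfolding hit_prob_eq
  proof (rule K.finite_measure_eq_AE)
    show "AE \<omega> in kesten_space \<mu>. \<omega> \<in> {\<omega>. hits_before_0 A (snake x \<omega>)} \<longleftrightarrow> \<omega> \<in> (\<Union>e\<in>unit_vectors. S e)"
      using ae by eventually_elim (use x hits_before_0_snake in \<open>auto simp: S_def\<close>)
    show "{\<omega>. hits_before_0 A (snake x \<omega>)} \<in> K.events" using sets_snake[OF sets_hits_before_0, of x A \<mu>] by simp
    show "(\<Union>e\<in>unit_vectors. S e) \<in> K.events" using S finite_unit_vectors by auto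
  qed
  also have "\<dots> = (\<Sum>e\<in>unit_vectors. K.prob (S e))"
    using S by (intro K.finite_measure_finite_Union finite_unit_vectors) (auto simp: disjoint_family_on_def S_def)
  also have "\<dots> = (\<Sum>e\<in>unit_vectors. (1 - killing \<mu> x) * (hit_prob \<mu> A (x + e) / 8))"
    by (intro sum.cong refl) (simp add: mS pmf_step)
  finally show ?thesis by (simp add: avg_def sum_distrib_left sum_divide_distrib)
qed

text \<open>Walk from x straight outwards along an axis on which x has a nonzero coordinate. The
  sites y m never meet 0 and eventually leave the finite set \<Lambda>; there the probability is 1,
  and \<open>hit_prob_step\<close> carries positivity back to x, since survival has positive
  probability off 0.\<close>

lemma hit_prob_pos:
  assumes c: "critical \<mu>" and x: "x \<noteq> 0" and fin: "finite \<Lambda>"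
  shows "0 < hit_prob \<mu> (- \<Lambda>) x"
proof -
  obtain j where j: "x $ j \<noteq> 0" using x by (auto simp: vec_eq_iff)
  define s where "s = sgn (x $ j)"
  define e :: site where "e = axis j s"
  define y where "y m = x + axis j (int m * s)" for m
  have e: "e \<in> unit_vectors" using j by (auto simp: e_def s_def unit_vectors_def sgn_if)
  have yS: "y (Suc m) = y m + e" for m by (simp add: y_def e_def vec_eq_iff axis_def algebra_simps)
  have y0: "y m \<noteq> 0" for m
  proof
    assume "y m = 0"
    then have "y m $ j = 0" by simp
    then show False using j by (auto simp: y_def axis_def s_def sgn_if split: if_splits)
  qed
  have backward: "0 < hit_prob \<mu> (- \<Lambda>) (y m)" if "0 < hit_prob \<mu> (- \<Lambda>) (y (Suc m))" for m
  proof (cases "y m \<in> - \<Lambda>")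
    case True
    then show ?thesis using hit_prob_inside[OF True y0] by simp
  next
    case False
    have "0 < (\<Sum>e\<in>unit_vectors. hit_prob \<mu> (- \<Lambda>) (y m + e))"
      using that e yS by (intro sum_pos2[OF finite_unit_vectors e]) (auto simp: hit_prob_nonneg)
    then have "0 < avg (hit_prob \<mu> (- \<Lambda>)) (y m)" by (simp add: avg_def)
    then show ?thesis using hit_prob_step[OF False] killing_less_1[OF c y0, of m] by simp
  qed
  have "inj y" using j by (auto simp: inj_def y_def axis_eq_axis s_def sgn_if vec_eq_iff axis_def split: if_splits) 
  then have "infinite (range y)" by (simp add: finite_image_iff)
  then have "\<not> range y \<subseteq> \<Lambda>" using finite_subset[of "range y" \<Lambda>] fin by argo
  then obtain m where m: "y m \<notin> \<Lambda>" by (auto simp: subset_iff)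
  have "0 < hit_prob \<mu> (- \<Lambda>) (y m)" using hit_prob_inside[of "y m" "- \<Lambda>" \<mu>] m y0 by simp
  then have "0 < hit_prob \<mu> (- \<Lambda>) (y 0)"
    by (induction m) (use backward in auto)
  moreover have "axis j 0 = (0 :: site)" by (simp add: vec_eq_iff axis_def)
  ultimately show ?thesis by (simp add: y_def)
qed

section \<open>Cylinder probabilities of the snake and of the killed walk\<close>

definition cylinder :: "nat \<Rightarrow> (nat \<Rightarrow> site) \<Rightarrow> (nat \<Rightarrow> (nat list \<rightharpoonup> site) set) \<Rightarrow> (vertex \<rightharpoonup> site) set" where
  "cylinder n s T = {w. (\<forall>i\<le>n. w (spine i) = Some (s i)) \<and> (\<forall>i<n. bush w i \<in> T i)}"

lemma sets_cylinder:
  assumes "\<And>i. i < n \<Longrightarrow> T i \<in> sets tree_maps"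
  shows "cylinder n s T \<in> sets snake_space"
proof -
  have "cylinder n s T = (\<Inter>i\<in>{..n}. {w. w (spine i) \<in> {Some (s i)}} \<inter> (if i < n then {w. bush w i \<in> T i} else UNIV))"
    by (auto simp: cylinder_def split: if_splits)
  also have "\<dots> \<in> sets snake_space"
    using assms by (intro sets.finite_INT sets.Int sets_snake_component) (auto intro: sets_bush sets_snake_UNIV)
  finally show ?thesis .
qed

lemma cylinder_Suc:
  "w \<in> cylinder (Suc n) s T \<longleftrightarrow> w (spine 0) = Some (s 0) \<and> bush w 0 \<in> T 0 \<and> shift_bushes w \<in> cylinder n (\<lambda>i. s (Suc i)) (\<lambda>i. T (Suc i))"
proof -
  have "shift_bushes w (spine i) = w (spine (Suc i))" "bush (shift_bushes w) i = bush w (Suc i)" for i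
    by (auto simp: shift_bushes_def spine_def bush_def)
  then show ?thesis unfolding cylinder_def less_Suc_eq_le[symmetric] All_less_Suc2[of "Suc n"] All_less_Suc2[of n] mem_Collect_eq
    by (simp only:) blast
qed

text \<open>Iterated Markov property. As s i is outside A for i < n and the bushes in T i avoid 0,
  the hitting event passes at each of the n steps to the shifted snake, and only the factor
  \<open>hit_prob \<mu> A (s n)\<close> remembers it.\<close>

lemma prob_cylinder_hits:
  assumes "\<And>i. i < n \<Longrightarrow> s i \<notin> A" "\<And>i. i < n \<Longrightarrow> T i \<in> sets tree_maps" "\<And>i. i < n \<Longrightarrow> T i \<subseteq> {w. \<not> hits_0 w}"
  shows "measure (snake_law \<mu> x) (cylinder n s T \<inter> {w. hits_before_0 A w}) =
    (if x = s 0 then (\<Prod>i<n. pmf step_pmf (s (Suc i) - s i) * measure (star_law \<mu> (s i)) (T i)) * hit_prob \<mu> A (s n) else 0)"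
  using assms
proof (induction n arbitrary: x s T)
  case 0
  have c: "cylinder 0 s T \<in> sets snake_space" by (rule sets_cylinder) auto
  have "measure (snake_law \<mu> x) (cylinder 0 s T \<inter> {w. hits_before_0 A w}) =
      measure (kesten_space \<mu>) {\<omega>. snake x \<omega> \<in> cylinder 0 s T \<inter> {w. hits_before_0 A w}}"
    by (intro measure_snake_law sets.Int c sets_hits_before_0)
  also have "{\<omega>. snake x \<omega> \<in> cylinder 0 s T \<inter> {w. hits_before_0 A w}} = (if x = s 0 then {\<omega>. hits_before_0 A (snake x \<omega>)} else {})"
    by (auto simp: cylinder_def snake_spine_0)
  finally show ?case by (auto simp: hit_prob_eq)
next
  case (Suc n)
  define s' where "s' i = s (Suc i)" for i
  define T' where "T' i = T (Suc i)" for i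
  define H where "H = {w. hits_before_0 A w}"
  define E where "E = cylinder n s' T' \<inter> H"
  have cn: "cylinder n s' T' \<in> sets snake_space" "cylinder (Suc n) s T \<in> sets snake_space"
    by (rule sets_cylinder, simp add: T'_def Suc.prems)+
  have E: "E \<in> sets snake_space" unfolding E_def H_def using cn(1) sets_hits_before_0 by (rule sets.Int)
  have IH: "measure (snake_law \<mu> y) E = (if y = s' 0 then (\<Prod>i<n. pmf step_pmf (s' (Suc i) - s' i) * measure (star_law \<mu> (s' i)) (T' i)) * hit_prob \<mu> A (s' n) else 0)" for y
    unfolding E_def H_def by (rule Suc.IH) (use Suc.prems in \<open>auto simp: s'_def T'_def\<close>)
  have m: "measure (snake_law \<mu> x) (cylinder (Suc n) s T \<inter> H) = measure (kesten_space \<mu>) {\<omega>. snake x \<omega> \<in> cylinder (Suc n) s T \<inter> H}"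
    unfolding H_def by (intro measure_snake_law sets.Int cn sets_hits_before_0)
  show ?case
  proof (cases "x = s 0")
    case False
    then have "{\<omega>. snake x \<omega> \<in> cylinder (Suc n) s T \<inter> H} = {}" by (auto simp: cylinder_Suc snake_spine_0)
    then have "measure (snake_law \<mu> x) (cylinder (Suc n) s T \<inter> H) = 0" unfolding m by (simp only: measure_empty)
    then show ?thesis using False unfolding H_def by simp
  next
    case True
    have xA: "x \<notin> A" using Suc.prems(1)[of 0] True by simp
    have T0: "T 0 \<in> sets tree_maps" "T 0 \<subseteq> {w. \<not> hits_0 w}" using Suc.prems by auto
    have sp: "shift_bushes (snake x \<omega>) (spine 0) = Some (x + snd (\<omega> (1, [])))" for \<omega>
      by (simp add: shift_snake snake_spine_0)
    have "{\<omega>. snake x \<omega> \<in> cylinder (Suc n) s T \<inter> H} =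
        {\<omega>. bush (snake x \<omega>) 0 \<in> T 0 \<and> snd (\<omega> (1, [])) = s 1 - x \<and> shift_bushes (snake x \<omega>) \<in> E}"
    proof (intro Collect_cong)
      fix \<omega>
      have "snd (\<omega> (1, [])) = s 1 - x" if "shift_bushes (snake x \<omega>) \<in> E"
        using that sp[of \<omega>] by (auto simp: E_def cylinder_def s'_def algebra_simps)
      moreover have "hits_before_0 A (snake x \<omega>) \<longleftrightarrow> \<not> hits_0 (bush (snake x \<omega>) 0) \<and> hits_before_0 A (shift_bushes (snake x \<omega>))"
        by (rule hits_before_0_snake) (use xA in simp)
      ultimately show "snake x \<omega> \<in> cylinder (Suc n) s T \<inter> H \<longleftrightarrow>
          bush (snake x \<omega>) 0 \<in> T 0 \<and> snd (\<omega> (1, [])) = s 1 - x \<and> shift_bushes (snake x \<omega>) \<in> E"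
        using T0(2) True by (auto simp: cylinder_Suc snake_spine_0 H_def E_def s'_def[abs_def] T'_def[abs_def])
    qed
    then have "measure (snake_law \<mu> x) (cylinder (Suc n) s T \<inter> H)
       = measure (star_law \<mu> x) (T 0) * (pmf step_pmf (s 1 - x) * measure (snake_law \<mu> (x + (s 1 - x))) E)"
      unfolding m by (simp only: markov_snake(1)[OF T0(1) E])
    also have "x + (s 1 - x) = s' 0" by (simp add: s'_def)
    finally show ?thesis using True
      unfolding H_def[symmetric] IH by (simp add: prod.lessThan_Suc_shift s'_def T'_def mult_ac del: prod.lessThan_Suc)
  qed
qed

lemma pmf_trajectory:
  "pmf (trajectory K n a) (map f [0..<Suc n]) = (if a = f 0 then (\<Prod>i<n. pmf (K (f i)) (f (Suc i))) else 0)"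
proof (induction n arbitrary: a f)
  case 0
  then show ?case by (simp add: indicator_def)
next
  case (Suc n)
  have m: "map f [0..<Suc (Suc n)] = f 0 # map (\<lambda>i. f (Suc i)) [0..<Suc n]"
    by (simp only: upt_conv_Cons[OF zero_less_Suc] list.map map_Suc_upt[symmetric] map_map o_def)
  have c: "pmf (map_pmf (Cons a) p) (f 0 # l) = (if a = f 0 then pmf p l else 0)" for p l
  proof (cases "a = f 0")
    case True
    then show ?thesis using pmf_map_inj'[of "Cons a" p l] by (simp add: inj_def)
  next
    case False
    then show ?thesis by (auto simp: pmf_eq_0_set_pmf)
  qed
  have "pmf (trajectory K (Suc n) a) (map f [0..<Suc (Suc n)]) =
     (\<integral>b. (if a = f 0 then if b = f (Suc 0) then (\<Prod>i<n. pmf (K (f (Suc i))) (f (Suc (Suc i)))) else 0 else 0) \<partial>measure_pmf (K a))"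
    unfolding m trajectory.simps pmf_bind c Suc.IH[of _ "\<lambda>i. f (Suc i)"] by simp
  also have "\<dots> = (if a = f 0 then pmf (K (f 0)) (f (Suc 0)) * (\<Prod>i<n. pmf (K (f (Suc i))) (f (Suc (Suc i)))) else 0)"
  proof (cases "a = f 0")
    case True
    have "(\<lambda>b. if b = f (Suc 0) then (\<Prod>i<n. pmf (K (f (Suc i))) (f (Suc (Suc i)))) else 0) =
      (\<lambda>b. (\<Prod>i<n. pmf (K (f (Suc i))) (f (Suc (Suc i)))) * indicator {f (Suc 0)} b)" by (auto simp: fun_eq_iff)
    then show ?thesis using True by (simp add: measure_pmf_single)
  qed simp
  finally show ?case by (simp add: prod.lessThan_Suc_shift del: prod.lessThan_Suc)
qed

section \<open>Local convergence\<close>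

text \<open>The n-th spine vertex is kept without its bush, so that a truncation class fixes n
  bushes and n + 1 spine positions, exactly as a \<open>cylinder\<close> does.\<close>

definition truncate :: "nat \<Rightarrow> (vertex \<rightharpoonup> site) \<Rightarrow> vertex \<rightharpoonup> site" where
  "truncate n w = (\<lambda>(i, u). if i < n \<or> i = n \<and> u = [] then w (i, u) else None)"

text \<open>Only the sigma-algebra matters, so arbitrary point masses turn the space into an
  \<open>iprod\<close> and make the measurability lemmas for products applicable.\<close>

lemma sets_snake_space: "sets snake_space = sets (iprod (\<lambda>_. return_pmf None))"
  unfolding snake_space_def iprod_def by (intro sets_PiM_cong) auto

lemma measurable_snake_finite:
  fixes f :: "(vertex \<rightharpoonup> site) \<Rightarrow> 'c"
  assumes "finite J" "\<And>w w'. (\<And>p. p \<in> J \<Longrightarrow> w p = w' p) \<Longrightarrow> f w = f w'"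
  shows "f \<in> measurable snake_space (count_space UNIV)"
  using measurable_iprod_finite[of J f "\<lambda>_. return_pmf None"] assms
  by (subst measurable_cong_sets[OF sets_snake_space refl]) blast

lemma snake_topology_nbhd:
  assumes f: "continuous_map snake_topology euclideanreal f" and e: "e > 0"
  obtains V where "finite V" "\<And>w'. (\<And>p. p \<in> V \<Longrightarrow> w' p = w p) \<Longrightarrow> \<bar>f w' - f w\<bar> < e"
proof -
  define S where "S = {w'. f w' \<in> ball (f w) e}"
  have ts: "topspace snake_topology = UNIV" by (simp add: snake_topology_def)
  have "openin snake_topology {w' \<in> topspace snake_topology. f w' \<in> ball (f w) e}"
    using f by (rule openin_continuous_map_preimage) simp
  then have "openin snake_topology S" by (simp add: S_def ts)
  moreover have "w \<in> S" using e by (simp add: S_def)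
  ultimately obtain U where U: "finite {i. U i \<noteq> UNIV}" "w \<in> Pi\<^sub>E UNIV U" "Pi\<^sub>E UNIV U \<subseteq> S"
    unfolding snake_topology_def openin_product_topology_alt by auto
  show thesis
  proof (rule that[OF U(1)])
    fix w' assume h: "\<And>p. p \<in> {i. U i \<noteq> UNIV} \<Longrightarrow> w' p = w p"
    have "w p \<in> U p" for p using U(2) by (rule PiE_mem) simp
    then have "w' p \<in> U p" for p using h[of p] by (cases "U p = UNIV") simp_all
    then have "w' \<in> S" using U(3) by (auto simp: PiE_def)
    then show "\<bar>f w' - f w\<bar> < e" by (simp add: S_def dist_real_def abs_minus_commute)
  qed
qed

text \<open>f is the pointwise limit of f composed with the map keeping only the first n vertices in
  an enumeration; these compositions depend on finitely many coordinates with countably many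
  values.\<close>

lemma borel_measurable_snake_continuous:
  assumes f: "continuous_map snake_topology euclideanreal f"
  shows "f \<in> borel_measurable snake_space"
proof -
  define r where "r n w = (\<lambda>p. if to_nat p < n then w p else None)" for n and w :: "vertex \<rightharpoonup> site"
  have fin: "finite {p :: vertex. to_nat p < n}" for n
    by (rule finite_imageD[OF finite_subset[of _ "{..<n}"]]) (auto intro: inj_on_subset[OF inj_to_nat])
  show ?thesis
  proof (rule borel_measurable_LIMSEQ_real)
    fix w :: "vertex \<rightharpoonup> site"
    show "(\<lambda>n. f (r n w)) \<longlonglongrightarrow> f w"
    proof (rule LIMSEQ_I)
      fix e :: real assume "e > 0"
      from snake_topology_nbhd[OF f this] obtain V where V: "finite V" "\<And>w'. (\<And>p. p \<in> V \<Longrightarrow> w' p = w p) \<Longrightarrow> \<bar>f w' - f w\<bar> < e" by metis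
      have "norm (f (r n w) - f w) < e" if "n \<ge> Suc (Max (insert 0 (to_nat ` V)))" for n
      proof -
        have "to_nat p < n" if "p \<in> V" for p
        proof -
          have "to_nat p \<le> Max (insert 0 (to_nat ` V))" using V(1) that by (intro Max_ge) auto
          then show ?thesis using \<open>n \<ge> _\<close> by linarith
        qed
        then show ?thesis using V(2)[of "r n w"] by (simp add: r_def)
      qed
      then show "\<exists>N. \<forall>n\<ge>N. norm (f (r n w) - f w) < e" by blast
    qed
  next
    fix n
    have "(\<lambda>w. f (r n w)) \<in> measurable snake_space (count_space UNIV)"
    proof (rule measurable_snake_finite[OF fin[of n]])
      fix w w' :: "vertex \<rightharpoonup> site" assume "\<And>p. p \<in> {p. to_nat p < n} \<Longrightarrow> w p = w' p"
      then have "r n w = r n w'" by (auto simp: r_def fun_eq_iff)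
      then show "f (r n w) = f (r n w')" by simp
    qed
    from measurable_compose[OF this, of "\<lambda>x. x" borel] show "(\<lambda>w. f (r n w)) \<in> borel_measurable snake_space" by simp
  qed
qed

lemma countable_finite_maps: "countable {c :: 'a::countable \<rightharpoonup> 'b::countable. finite (dom c)}"
proof -
  have "countable {G :: ('a \<times> 'b) set. finite G}" by (rule countable_Collect_finite)
  moreover have "Map.graph ` {c :: 'a \<rightharpoonup> 'b. finite (dom c)} \<subseteq> {G. finite G}" by auto
  ultimately have "countable (Map.graph ` {c :: 'a \<rightharpoonup> 'b. finite (dom c)})" by (rule countable_subset[rotated])
  moreover have "inj_on Map.graph {c :: 'a \<rightharpoonup> 'b. finite (dom c)}"
    by (rule inj_on_inverseI[of _ "\<lambda>G x. if \<exists>y. (x, y) \<in> G then Some (SOME y. (x, y) \<in> G) else None"])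
      (auto simp: Map.graph_def fun_eq_iff split: option.splits)
  ultimately show ?thesis by (rule countable_image_inj_on)
qed

lemma finite_dom_truncate:
  assumes "\<And>i. finite (dom (bush w i))"
  shows "finite (dom (truncate n w))"
proof (rule finite_subset)
  show "dom (truncate n w) \<subseteq> (\<Union>i<n. Pair i ` dom (bush w i)) \<union> {(n, [])}"
    by (auto simp: truncate_def bush_def dom_def split: if_splits)
qed (use assms in auto)

lemma sets_truncate_class:
  assumes "finite (dom c)"
  shows "{w. truncate n w = c} \<in> sets snake_space"
proof -
  have tr: "truncate n w p = truncate n (\<lambda>_. w p) p" for w p
    by (simp add: truncate_def split: prod.split)
  have "{w. truncate n w = c} = (\<Inter>p. {w. w p \<in> {v. truncate n (\<lambda>_. v) p = c p}})"
    unfolding set_eq_iff mem_Collect_eq INT_iff fun_eq_iff by (metis tr UNIV_I)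
  also have "\<dots> \<in> sets snake_space"
    by (rule sets.countable_INT''[OF sets_snake_UNIV countableI_type sets_snake_component])
  finally show ?thesis .
qed

lemma truncate_agree: "truncate n w' = truncate n w \<Longrightarrow> fst p < n \<Longrightarrow> w' p = w p"
  by (drule fun_cong[of _ _ p]) (auto simp: truncate_def case_prod_unfold)

text \<open>
  A continuous function is, almost surely, the increasing limit of its infima over the classes of
  snakes with the same first bushes. Truncating to finitely many of the countably many classes
  reduces the claim to the convergence of finitely many probabilities.
\<close>

lemma local_convergence_lower:
  fixes P :: "nat \<Rightarrow> (vertex \<rightharpoonup> site) measure"
  assumes L: "prob_space L" "sets L = sets snake_space"
    and P: "\<And>R. prob_space (P R)" "\<And>R. sets (P R) = sets snake_space"
    and good: "AE w in L. w \<in> good" "\<And>w i. w \<in> good \<Longrightarrow> finite (dom (bush w i))"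
    and lim: "\<And>n w. w \<in> good \<Longrightarrow> (\<lambda>R. measure (P R) {w'. truncate n w' = truncate n w}) \<longlonglongrightarrow> measure L {w'. truncate n w' = truncate n w}"
    and f: "continuous_map snake_topology euclideanreal f" and fb: "\<And>w. 0 \<le> f w" "\<And>w. f w \<le> B"
    and x: "x < (\<integral>w. f w \<partial>L)"
  shows "eventually (\<lambda>R. x < (\<integral>w. f w \<partial>P R)) sequentially"
proof -
  interpret L: prob_space L by fact
  interpret P: prob_space "P R" for R by (rule P(1))
  have spL: "space L = UNIV" using sets_eq_imp_space_eq[OF L(2)] by simp
  have fm: "f \<in> borel_measurable L" "\<And>R. f \<in> borel_measurable (P R)"
    using borel_measurable_snake_continuous[OF f] L(2) P(2) by (auto cong: measurable_cong_sets)
  have B: "0 \<le> B" using fb[of undefined] by linarith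
  define C where "C n = truncate n ` good" for n
  have Cfin: "finite (dom c)" if "c \<in> C n" for c n
    using that good(2) finite_dom_truncate by (auto simp: C_def)
  have Cc: "countable (C n)" for n
    by (rule countable_subset[OF _ countable_finite_maps]) (use Cfin in auto)
  have ne: "good \<noteq> {}"
  proof
    assume "good = {}"
    then have "AE w in L. False" using good(1) by simp
    then show False by (simp add: L.AE_False)
  qed
  define cls where "cls n c = {w. truncate n w = c}" for n and c :: "vertex \<rightharpoonup> site"
  define \<phi> where "\<phi> n c = Inf (f ` cls n c)" for n c
  have bdd: "bdd_below (f ` S)" for S using fb by (intro bdd_belowI2[of _ 0])
  have \<phi>le: "\<phi> n c \<le> f w" if "w \<in> cls n c" for n c w
    unfolding \<phi>_def using that bdd by (intro cInf_lower) auto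
  have \<phi>0: "0 \<le> \<phi> n c" if "w \<in> cls n c" for n c w
    unfolding \<phi>_def using that fb by (intro cInf_greatest) auto
  have clsw: "w \<in> cls n (truncate n w)" for n w by (simp add: cls_def)
  define g where "g n K w = (\<Sum>c\<in>from_nat_into (C n) ` {..<K}. \<phi> n c * indicator (cls n c) w)" for n K and w :: "vertex \<rightharpoonup> site"
  define G where "G n w = (if truncate n w \<in> C n then \<phi> n (truncate n w) else 0)" for n w
  have Cne: "C n \<noteq> {}" for n using ne by (simp add: C_def)
  have fromC: "from_nat_into (C n) k \<in> C n" for n k by (rule from_nat_into[OF Cne])
  have geq: "g n K w = (if truncate n w \<in> from_nat_into (C n) ` {..<K} then \<phi> n (truncate n w) else 0)" for n K w
  proof -
    have "g n K w = (\<Sum>c\<in>from_nat_into (C n) ` {..<K}. if c = truncate n w then \<phi> n (truncate n w) else 0)"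
      unfolding g_def by (intro sum.cong refl) (auto simp: cls_def indicator_def)
    then show ?thesis by simp
  qed
  have gle: "0 \<le> g n K w" "g n K w \<le> f w" for n K w
    using \<phi>0[OF clsw] \<phi>le[OF clsw] fb by (auto simp: geq)
  have clsS: "cls n c \<in> sets snake_space" if "c \<in> C n" for n c
    unfolding cls_def by (rule sets_truncate_class[OF Cfin[OF that]])
  have gm: "g n K \<in> borel_measurable L" "g n K \<in> borel_measurable (P R)" for n K R
    unfolding g_def using clsS fromC L(2) P(2)
    by (intro borel_measurable_sum borel_measurable_times borel_measurable_const borel_measurable_indicator; auto)+
  have gi: "integrable L (g n K)" "integrable (P R) (g n K)" for n K R
  proof -
    have "norm (g n K w) \<le> B" for w using gle[of n K w] fb[of w] by simp
    then show "integrable L (g n K)" "integrable (P R) (g n K)"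
      using gm by (auto intro!: L.integrable_const_bound[where B = B] P.integrable_const_bound[where B = B])
  qed
  have fi: "integrable (P R) f" for R
    using fm fb by (intro P.integrable_const_bound[where B = B]) auto
  have gG: "(\<lambda>K. g n K w) \<longlonglongrightarrow> G n w" for n w
  proof (cases "truncate n w \<in> C n")
    case True
    then obtain k where k: "from_nat_into (C n) k = truncate n w" using from_nat_into_surj[OF Cc] by blast
    have "g n K w = G n w" if "K > k" for K
    proof -
      have "truncate n w \<in> from_nat_into (C n) ` {..<K}" using that k by (metis imageI lessThan_iff)
      then show ?thesis using True by (simp add: geq G_def)
    qed
    then have "eventually (\<lambda>K. g n K w = G n w) sequentially" by (auto simp: eventually_sequentially intro!: exI[of _ "Suc k"])
    then show ?thesis by (rule tendsto_eventually)
  next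
    case False
    then have "g n K w = G n w" for K using fromC by (auto simp: geq G_def)
    then show ?thesis by simp
  qed
  have Gm: "G n \<in> borel_measurable L" for n
    by (rule borel_measurable_LIMSEQ_real[OF gG gm(1)])
  have Gle: "0 \<le> G n w" "G n w \<le> f w" for n w
    using \<phi>0[OF clsw] \<phi>le[OF clsw] fb by (auto simp: G_def)
  have Gf: "(\<lambda>n. G n w) \<longlonglongrightarrow> f w" if w: "w \<in> good" for w
  proof (rule LIMSEQ_I)
    fix e :: real assume e: "e > 0"
    then have "e / 2 > 0" by simp
    from snake_topology_nbhd[OF f this] obtain V where V: "finite V" "\<And>w'. (\<And>p. p \<in> V \<Longrightarrow> w' p = w p) \<Longrightarrow> \<bar>f w' - f w\<bar> < e / 2" by metis
    have "norm (G n w - f w) < e" if n: "n \<ge> Suc (Max (insert 0 (fst ` V)))" for n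
    proof -
      have Vn: "fst p < n" if "p \<in> V" for p
      proof -
        have "fst p \<le> Max (insert 0 (fst ` V))" using V(1) that by (intro Max_ge) auto
        then show ?thesis using n by linarith
      qed
      have Gn: "G n w = \<phi> n (truncate n w)" using w by (simp add: G_def C_def)
      \<comment> \<open>n exceeds the bush index of every vertex in V, so all snakes in the class of
        w agree with w on V.\<close>
      have "f w - e / 2 \<le> \<phi> n (truncate n w)"
        unfolding \<phi>_def
      proof (rule cInf_greatest)
        show "f ` cls n (truncate n w) \<noteq> {}" using clsw by blast
        fix y assume "y \<in> f ` cls n (truncate n w)"
        then obtain w' where w': "y = f w'" "truncate n w' = truncate n w" by (auto simp: cls_def)
        have "\<bar>f w' - f w\<bar> < e / 2" using truncate_agree[OF w'(2)] Vn by (intro V(2)) auto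
        then show "f w - e / 2 \<le> y" unfolding w'(1) by linarith
      qed
      then show ?thesis using Gle(2)[of n w] e by (simp add: Gn abs_less_iff)
    qed
    then show "\<exists>N. \<forall>n\<ge>N. norm (G n w - f w) < e" by blast
  qed
  have "(\<lambda>n. \<integral>w. G n w \<partial>L) \<longlonglongrightarrow> (\<integral>w. f w \<partial>L)"
  proof (rule integral_dominated_convergence[where w = "\<lambda>_. B"])
    show "AE w in L. (\<lambda>n. G n w) \<longlonglongrightarrow> f w" using good(1) by eventually_elim (rule Gf)
    show "AE w in L. norm (G n w) \<le> B" for n using order_trans[OF Gle(2) fb(2)] Gle(1) by (intro AE_I2) auto
  qed (use fm Gm in auto)
  from order_tendstoD(1)[OF this x] obtain n where n: "x < (\<integral>w. G n w \<partial>L)"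
    by (auto simp: eventually_sequentially)
  have "(\<lambda>K. \<integral>w. g n K w \<partial>L) \<longlonglongrightarrow> (\<integral>w. G n w \<partial>L)"
  proof (rule integral_dominated_convergence[where w = "\<lambda>_. B"])
    show "AE w in L. (\<lambda>K. g n K w) \<longlonglongrightarrow> G n w" using gG by simp
    show "AE w in L. norm (g n K w) \<le> B" for K using order_trans[OF gle(2) fb(2)] gle(1) by (intro AE_I2) auto
  qed (use gm Gm in auto)
  from order_tendstoD(1)[OF this n] obtain K where K: "x < (\<integral>w. g n K w \<partial>L)"
    by (auto simp: eventually_sequentially)
  have gint: "(\<integral>w. g n K w \<partial>M) = (\<Sum>c\<in>from_nat_into (C n) ` {..<K}. \<phi> n c * measure M (cls n c))"
    if "prob_space M" "sets M = sets snake_space" for M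
  proof -
    interpret M: prob_space M by fact
    have s: "space M = UNIV" using sets_eq_imp_space_eq[OF that(2)] by simp
    have "(\<integral>w. g n K w \<partial>M) = (\<Sum>c\<in>from_nat_into (C n) ` {..<K}. \<integral>w. \<phi> n c * indicator (cls n c) w \<partial>M)"
      unfolding g_def
    proof (rule Bochner_Integration.integral_sum)
      fix c assume "c \<in> from_nat_into (C n) ` {..<K}"
      then have "cls n c \<in> sets M" using clsS fromC that by auto
      then show "integrable M (\<lambda>w. \<phi> n c * indicator (cls n c) w)"
        by (intro integrable_mult_right integrable_real_indicator) (auto simp: M.emeasure_eq_measure)
    qed
    then show ?thesis by (simp add: s)
  qed
  have "(\<lambda>R. \<integral>w. g n K w \<partial>P R) \<longlonglongrightarrow> (\<integral>w. g n K w \<partial>L)"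
    unfolding gint[OF P] gint[OF L]
  proof (intro tendsto_sum tendsto_mult tendsto_const)
    fix c assume "c \<in> from_nat_into (C n) ` {..<K}"
    then have "c \<in> C n" using fromC by auto
    then obtain w where "w \<in> good" "c = truncate n w" by (auto simp: C_def)
    then show "(\<lambda>R. measure (P R) (cls n c)) \<longlonglongrightarrow> measure L (cls n c)" using lim by (simp add: cls_def)
  qed
  from order_tendstoD(1)[OF this K] show ?thesis
  proof eventually_elim
    case (elim R)
    also have "(\<integral>w. g n K w \<partial>P R) \<le> (\<integral>w. f w \<partial>P R)" using gle by (intro integral_mono gi fi)
    finally show ?case .
  qed
qed

text \<open>The lower bound applied to f + B and to B - f gives both halves of the limit. The second
  half needs that L and all P R have total mass one, that is, that no mass is lost.\<close>

lemma local_convergence: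
  fixes P :: "nat \<Rightarrow> (vertex \<rightharpoonup> site) measure"
  assumes L: "prob_space L" "sets L = sets snake_space"
    and P: "\<And>R. prob_space (P R)" "\<And>R. sets (P R) = sets snake_space"
    and good: "AE w in L. w \<in> good" "\<And>w i. w \<in> good \<Longrightarrow> finite (dom (bush w i))"
    and lim: "\<And>n w. w \<in> good \<Longrightarrow> (\<lambda>R. measure (P R) {w'. truncate n w' = truncate n w}) \<longlonglongrightarrow> measure L {w'. truncate n w' = truncate n w}"
  shows "converges_in_distribution P L"
  unfolding converges_in_distribution_def
proof (intro allI impI, elim conjE)
  fix f assume f: "continuous_map snake_topology euclideanreal f" and "bounded (range f)"
  then obtain B where B: "\<And>w. \<bar>f w\<bar> \<le> B" by (auto simp: bounded_iff)
  interpret L: prob_space L by fact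
  interpret P: prob_space "P R" for R by (rule P(1))
  have fm: "f \<in> borel_measurable L" "\<And>R. f \<in> borel_measurable (P R)"
    using borel_measurable_snake_continuous[OF f] L(2) P(2) by (auto cong: measurable_cong_sets)
  have fi: "integrable L f" "\<And>R. integrable (P R) f"
    using fm B by (auto intro!: L.integrable_const_bound[where B = B] P.integrable_const_bound[where B = B])
  have c: "continuous_map snake_topology euclideanreal (\<lambda>w. f w + B)" "continuous_map snake_topology euclideanreal (\<lambda>w. B - f w)"
    using f by (auto intro!: continuous_map_add continuous_map_diff)
  have b: "0 \<le> f w + B" "f w + B \<le> 2 * B" "0 \<le> B - f w" "B - f w \<le> 2 * B" for w using B[of w] by (auto simp: abs_le_iff)
  show "(\<lambda>R. \<integral>w. f w \<partial>P R) \<longlonglongrightarrow> (\<integral>w. f w \<partial>L)"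
  proof (rule order_tendstoI)
    fix x assume "x < (\<integral>w. f w \<partial>L)"
    then have lt: "x + B < (\<integral>w. f w + B \<partial>L)" using fi L.prob_space by simp
    have "eventually (\<lambda>R. x + B < (\<integral>w. f w + B \<partial>P R)) sequentially"
      by (rule local_convergence_lower[OF L P good(1) _ _ c(1) b(1,2) lt]) (use good(2) lim in auto)
    then
    show "eventually (\<lambda>R. x < (\<integral>w. f w \<partial>P R)) sequentially"
      by eventually_elim (use fi P.prob_space in simp)
  next
    fix x assume "(\<integral>w. f w \<partial>L) < x"
    then have lt: "B - x < (\<integral>w. B - f w \<partial>L)" using fi L.prob_space by simp
    have "eventually (\<lambda>R. B - x < (\<integral>w. B - f w \<partial>P R)) sequentially"
      by (rule local_convergence_lower[OF L P good(1) _ _ c(2) b(3,4) lt]) (use good(2) lim in auto)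
    then
    show "eventually (\<lambda>R. (\<integral>w. f w \<partial>P R) < x) sequentially"
      by eventually_elim (use fi P.prob_space in simp)
  qed
qed

section \<open>The limiting snake\<close>

text \<open>Doob transform of the killed walk by a; the weights add up to one at z exactly when a is
  harmonic there. The value at 0 is a placeholder: with a 0 = 0, as chosen later, 0 is never entered
  from elsewhere.\<close>

definition doob :: "nat pmf \<Rightarrow> (site \<Rightarrow> real) \<Rightarrow> site \<Rightarrow> site pmf" where
  "doob \<mu> a z = (if z = 0 then return_pmf 0 else embed_pmf (\<lambda>w. (1 - killing \<mu> z) * pmf step_pmf (w - z) * a w / a z))"

lemma pmf_doob:
  assumes z: "z \<noteq> 0" and a: "\<And>w. 0 \<le> a w" "0 < a z" and harm: "a z = (1 - killing \<mu> z) * avg a z"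
  shows "pmf (doob \<mu> a z) w = (1 - killing \<mu> z) * pmf step_pmf (w - z) * a w / a z"
proof -
  define g where "g w = (1 - killing \<mu> z) * pmf step_pmf (w - z) * a w / a z" for w
  have g0: "0 \<le> g w" for w using killing_bounds[of \<mu> z] a by (simp add: g_def)
  have "(\<integral>\<^sup>+ w. ennreal (g w) \<partial>count_space UNIV) = (\<Sum>w\<in>(+) z ` unit_vectors. ennreal (g w))"
  proof (rule nn_integral_count_space')
    fix w assume "w \<notin> (+) z ` unit_vectors"
    then have "w - z \<notin> unit_vectors" by (metis add_diff_cancel_left' add.commute diff_add_cancel image_eqI)
    then show "ennreal (g w) = 0" by (simp add: g_def pmf_step)
  qed (use finite_unit_vectors in auto)
  also have "\<dots> = ennreal (\<Sum>w\<in>(+) z ` unit_vectors. g w)" using g0 by (intro sum_ennreal) auto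
  also have "(\<Sum>w\<in>(+) z ` unit_vectors. g w) = (\<Sum>e\<in>unit_vectors. g (z + e))"
    by (subst sum.reindex) (auto simp: o_def)
  also have "\<dots> = (\<Sum>e\<in>unit_vectors. (1 - killing \<mu> z) / a z * (a (z + e) / 8))"
    by (intro sum.cong refl) (simp add: g_def pmf_step)
  also have "\<dots> = (1 - killing \<mu> z) * avg a z / a z"
    by (simp add: avg_def sum_distrib_left[symmetric] sum_divide_distrib[symmetric])
  also have "\<dots> = 1" using harm a(2) by (metis divide_self less_irrefl)
  finally have "pmf (embed_pmf g) w = g w" using g0 by (intro pmf_embed_pmf) auto
  then show ?thesis using z by (simp add: doob_def g_def[abs_def])
qed

text \<open>Starting from 0 the bush always hits 0 at its root, so conditioning would be on a null
  event; the unconditioned law is a placeholder that keeps all factors probability measures.\<close>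

definition cond_star :: "nat pmf \<Rightarrow> site \<Rightarrow> (nat list \<rightharpoonup> site) measure" where
  "cond_star \<mu> z = (if z = 0 then star_law \<mu> 0 else uniform_measure (star_law \<mu> z) {w. \<not> hits_0 w})"

lemma star_not_hits_0_pos:
  assumes "critical \<mu>" "z \<noteq> 0"
  shows "emeasure (star_law \<mu> z) {w. \<not> hits_0 w} \<noteq> 0" "emeasure (star_law \<mu> z) {w. \<not> hits_0 w} \<noteq> \<infinity>"
proof -
  interpret prob_space "star_law \<mu> z" by (rule prob_space_star_law)
  show "emeasure (star_law \<mu> z) {w. \<not> hits_0 w} \<noteq> 0"
    using killing_less_1[OF assms] by (simp add: emeasure_eq_measure prob_not_hits_0)
  show "emeasure (star_law \<mu> z) {w. \<not> hits_0 w} \<noteq> \<infinity>" by simp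
qed

lemma prob_space_cond_star: "critical \<mu> \<Longrightarrow> prob_space (cond_star \<mu> z)"
  unfolding cond_star_def using prob_space_star_law star_not_hits_0_pos
  by (auto intro: prob_space_uniform_measure)

lemma sets_cond_star: "sets (cond_star \<mu> z) = sets tree_maps"
  by (simp add: cond_star_def sets_star_law)

lemma space_cond_star [simp]: "space (cond_star \<mu> z) = UNIV"
  by (simp add: cond_star_def)

lemma measure_cond_star:
  assumes "critical \<mu>" "z \<noteq> 0" "T \<in> sets tree_maps" "T \<subseteq> {w. \<not> hits_0 w}"
  shows "measure (cond_star \<mu> z) T = measure (star_law \<mu> z) T / (1 - killing \<mu> z)"
proof -
  have "{w. \<not> hits_0 w} \<inter> T = T" using assms(4) by auto
  then show ?thesis
    using assms star_not_hits_0_pos[OF assms(1,2)] by (simp add: cond_star_def sets_star_law prob_not_hits_0)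
qed

definition ok_trees :: "site \<Rightarrow> (nat list \<rightharpoonup> site) set" where
  "ok_trees z = {w. w [] = Some z \<and> dom w \<in> finite_trees \<and> (z \<noteq> 0 \<longrightarrow> \<not> hits_0 w)}"

lemma sets_ok_trees: "ok_trees z \<in> sets tree_maps"
proof -
  have "ok_trees z = {w. w [] \<in> {Some z}} \<inter> {w. dom w \<in> finite_trees} \<inter> (if z = 0 then UNIV else {w. \<not> hits_0 w})"
    by (auto simp: ok_trees_def)
  also have "\<dots> \<in> sets tree_maps"
    using sets.top[of tree_maps] sets_not_hits_0
    by (intro sets.Int sets_maps_component sets_dom_finite_trees) (auto simp: space_PiM)
  finally show ?thesis .
qed

lemma measure_ok_trees:
  assumes c: "critical \<mu>"
  shows "measure (cond_star \<mu> z) (ok_trees z) = 1"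
proof -
  interpret prob_space "cond_star \<mu> z" by (rule prob_space_cond_star[OF c])
  have "AE w in star_law \<mu> z. w [] = Some z"
    unfolding star_law_def
  proof (subst AE_distr_iff)
    show "tree_walk z \<in> measurable (star_space \<mu>) tree_maps" unfolding star_space_eq by (rule measurable_tree_walk)
    show "{w \<in> space tree_maps. w [] = Some z} \<in> sets tree_maps"
      using sets_maps_component[of "[]" "{Some z}"] by (simp add: space_PiM)
  qed (simp add: tree_walk_root)
  with AE_star_law_finite_tree[OF c, of z]
  have *: "AE w in star_law \<mu> z. w [] = Some z \<and> dom w \<in> finite_trees" by eventually_elim simp
  have "AE w in cond_star \<mu> z. w \<in> ok_trees z"
  proof (cases "z = 0")
    case True
    have "cond_star \<mu> 0 = star_law \<mu> 0" by (simp add: cond_star_def)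
    with *[unfolded True] show ?thesis unfolding True ok_trees_def by (simp only:) simp
  next
    case False
    have "AE w in uniform_measure (star_law \<mu> z) {w. \<not> hits_0 w}. w \<in> ok_trees z"
    proof (rule AE_uniform_measureI)
      show "{w. \<not> hits_0 w} \<in> sets (star_law \<mu> z)" using sets_not_hits_0 by (simp add: sets_star_law)
      show "AE w in star_law \<mu> z. w \<in> {w. \<not> hits_0 w} \<longrightarrow> w \<in> ok_trees z"
        using * by eventually_elim (simp add: ok_trees_def)
    qed
    moreover have "cond_star \<mu> z = uniform_measure (star_law \<mu> z) {w. \<not> hits_0 w}" using False by (simp add: cond_star_def)
    ultimately show ?thesis by (simp only:)
  qed
  then show ?thesis using sets_ok_trees by (subst prob_eq_1) (auto simp: sets_cond_star)
qed

text \<open>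
  The snake is driven by independent resources indexed by time and site: the next spine site and the
  bush to be used if the spine is at that site at that time. This avoids constructing the law of a
  Markov chain with infinite horizon, and cylinder events become products over distinct indices.
\<close>

definition resource :: "nat pmf \<Rightarrow> (site \<Rightarrow> real) \<Rightarrow> nat \<times> site \<Rightarrow> (site \<times> (nat list \<rightharpoonup> site)) measure" where
  "resource \<mu> a p = measure_pmf (doob \<mu> a (snd p)) \<Otimes>\<^sub>M cond_star \<mu> (snd p)"

definition spine_path :: "site \<Rightarrow> (nat \<times> site \<Rightarrow> site \<times> (nat list \<rightharpoonup> site)) \<Rightarrow> nat \<Rightarrow> site" where
  "spine_path x \<omega> = rec_nat x (\<lambda>i z. fst (\<omega> (i, z)))"

lemma spine_path_simps [simp]:
  "spine_path x \<omega> 0 = x" "spine_path x \<omega> (Suc i) = fst (\<omega> (i, spine_path x \<omega> i))"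
  by (simp_all add: spine_path_def)

definition limit_snake :: "site \<Rightarrow> (nat \<times> site \<Rightarrow> site \<times> (nat list \<rightharpoonup> site)) \<Rightarrow> vertex \<rightharpoonup> site" where
  "limit_snake x \<omega> = (\<lambda>(i, u). snd (\<omega> (i, spine_path x \<omega> i)) u)"

definition limit_law :: "nat pmf \<Rightarrow> (site \<Rightarrow> real) \<Rightarrow> site \<Rightarrow> (vertex \<rightharpoonup> site) measure" where
  "limit_law \<mu> a x = distr (PiM UNIV (resource \<mu> a)) snake_space (limit_snake x)"

lemma space_resource [simp]: "space (resource \<mu> a p) = UNIV"
  by (simp add: resource_def space_pair_measure)

lemma prob_space_resource: "critical \<mu> \<Longrightarrow> prob_space (resource \<mu> a p)"
  unfolding resource_def by (intro prob_space_pair measure_pmf.prob_space_axioms prob_space_cond_star)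

lemma sets_resource_Times: "T \<in> sets tree_maps \<Longrightarrow> S \<times> T \<in> sets (resource \<mu> a p)"
  unfolding resource_def by (intro pair_measureI) (auto simp: sets_cond_star)

lemma measure_resource_Times:
  assumes "critical \<mu>" "T \<in> sets tree_maps"
  shows "measure (resource \<mu> a p) (S \<times> T) = measure_pmf.prob (doob \<mu> a (snd p)) S * measure (cond_star \<mu> (snd p)) T"
proof -
  interpret C: prob_space "cond_star \<mu> (snd p)" by (rule prob_space_cond_star[OF assms(1)])
  interpret R: prob_space "resource \<mu> a p" by (rule prob_space_resource[OF assms(1)])
  have "emeasure (resource \<mu> a p) (S \<times> T) = emeasure (measure_pmf (doob \<mu> a (snd p))) S * emeasure (cond_star \<mu> (snd p)) T"
    unfolding resource_def using assms by (intro C.emeasure_pair_measure_Times) (auto simp: sets_cond_star)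
  then show ?thesis
    by (simp add: R.emeasure_eq_measure C.emeasure_eq_measure measure_pmf.emeasure_eq_measure ennreal_mult''[symmetric])
qed

lemma product_prob_space_resource: "critical \<mu> \<Longrightarrow> product_prob_space (resource \<mu> a)"
  by (intro product_prob_space.intro product_prob_space_axioms.intro product_sigma_finite.intro
      prob_space_resource prob_space_imp_sigma_finite)

lemma AE_resource:
  assumes c: "critical \<mu>"
  shows "AE \<omega> in PiM UNIV (resource \<mu> a). \<forall>p. fst (\<omega> p) \<in> set_pmf (doob \<mu> a (snd p)) \<and> snd (\<omega> p) \<in> ok_trees (snd p)"
proof -
  interpret Pr: product_prob_space "resource \<mu> a" UNIV by (rule product_prob_space_resource[OF c])
  have "AE \<omega> in PiM UNIV (resource \<mu> a). fst (\<omega> p) \<in> set_pmf (doob \<mu> a (snd p)) \<and> snd (\<omega> p) \<in> ok_trees (snd p)" for p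
  proof (rule Pr.AE_component)
    have "measure (resource \<mu> a p) (set_pmf (doob \<mu> a (snd p)) \<times> ok_trees (snd p)) = 1"
      by (simp add: measure_resource_Times[OF c sets_ok_trees] measure_ok_trees[OF c] measure_pmf.prob_eq_1 AE_measure_pmf_iff)
    then have "AE q in resource \<mu> a p. q \<in> set_pmf (doob \<mu> a (snd p)) \<times> ok_trees (snd p)" by (rule prob_space.AE_prob_1[OF prob_space_resource[OF c]])
    then show "AE q in resource \<mu> a p. fst q \<in> set_pmf (doob \<mu> a (snd p)) \<and> snd q \<in> ok_trees (snd p)"
      by eventually_elim auto
  qed simp
  then show ?thesis by (subst AE_all_countable) blast
qed

lemma measurable_limit_snake: "limit_snake x \<in> measurable (PiM UNIV (resource \<mu> a)) snake_space"
proof -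
  let ?M = "PiM UNIV (resource \<mu> a)"
  have f: "(\<lambda>\<omega>. fst (\<omega> p)) \<in> measurable ?M (count_space UNIV)" for p
  proof -
    have "(\<lambda>\<omega>. \<omega> p) \<in> measurable ?M (resource \<mu> a p)" by (rule measurable_component_singleton) simp
    moreover have "fst \<in> measurable (resource \<mu> a p) (measure_pmf (doob \<mu> a (snd p)))" unfolding resource_def by (rule measurable_fst)
    ultimately have "(\<lambda>\<omega>. fst (\<omega> p)) \<in> measurable ?M (measure_pmf (doob \<mu> a (snd p)))" by (rule measurable_compose)
    then show ?thesis by (simp cong: measurable_cong_sets)
  qed
  have s: "(\<lambda>\<omega>. snd (\<omega> p) u) \<in> measurable ?M (count_space UNIV)" for p u
  proof -
    have "(\<lambda>\<omega>. \<omega> p) \<in> measurable ?M (resource \<mu> a p)" by (rule measurable_component_singleton) simp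
    moreover have "snd \<in> measurable (resource \<mu> a p) (cond_star \<mu> (snd p))" unfolding resource_def by (rule measurable_snd)
    ultimately have "(\<lambda>\<omega>. snd (\<omega> p)) \<in> measurable ?M (cond_star \<mu> (snd p))" by (rule measurable_compose)
    then have "(\<lambda>\<omega>. snd (\<omega> p)) \<in> measurable ?M tree_maps" by (simp cong: measurable_cong_sets add: sets_cond_star)
    from measurable_compose[OF this measurable_component_singleton] show ?thesis by simp
  qed
  have path: "(\<lambda>\<omega>. spine_path x \<omega> i) \<in> measurable ?M (count_space UNIV)" for i
  proof (induction i)
    case (Suc i)
    from measurable_compose_countable[OF f Suc] show ?case by simp
  qed simp
  show ?thesis
    unfolding snake_space_def
  proof (rule measurable_PiM_single')
    fix p :: vertex
    obtain i u where p: "p = (i, u)" by fastforce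
    have "(\<lambda>\<omega>. snd (\<omega> (i, spine_path x \<omega> i)) u) \<in> measurable ?M (count_space UNIV)"
      by (rule measurable_compose_countable[where f = "\<lambda>z \<omega>. snd (\<omega> (i, z)) u", OF s path])
    then show "(\<lambda>\<omega>. limit_snake x \<omega> p) \<in> measurable ?M (count_space UNIV)" by (simp add: limit_snake_def p)
  qed (auto simp: space_PiM)
qed

lemma prob_space_limit_law: "critical \<mu> \<Longrightarrow> prob_space (limit_law \<mu> a x)"
  unfolding limit_law_def
  by (intro prob_space.prob_space_distr prob_space_PiM prob_space_resource measurable_limit_snake)

lemma sets_limit_law [simp]: "sets (limit_law \<mu> a x) = sets snake_space"
  by (simp add: limit_law_def)

lemma space_limit_law [simp]: "space (limit_law \<mu> a x) = UNIV"
  by (simp add: limit_law_def)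

lemma bush_limit_snake: "bush (limit_snake x \<omega>) i = snd (\<omega> (i, spine_path x \<omega> i))"
  by (simp add: bush_def limit_snake_def)

lemma limit_law_cylinder:
  assumes c: "critical \<mu>" and x: "s 0 = x" and T: "\<And>i. i < n \<Longrightarrow> T i \<in> sets tree_maps"
  shows "measure (limit_law \<mu> a x) (cylinder n s T) =
    (\<Prod>i<n. pmf (doob \<mu> a (s i)) (s (Suc i)) * measure (cond_star \<mu> (s i)) (T i))"
proof -
  let ?M = "PiM UNIV (resource \<mu> a)"
  interpret Pr: product_prob_space "resource \<mu> a" UNIV by (rule product_prob_space_resource[OF c])
  have spM: "space ?M = UNIV" by (simp add: space_PiM PiE_def)
  \<comment> \<open>The time component keeps the indices distinct even when the path s returns to a
    site.\<close>
  define J where "J = (\<lambda>i. (i, s i)) ` {..<n}"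
  define X where "X p = {s (Suc (fst p))} \<times> T (fst p)" for p :: "nat \<times> site"
  have J: "finite J" by (simp add: J_def)
  have X: "X p \<in> sets (resource \<mu> a p)" if "p \<in> J" for p
    unfolding X_def using that T by (intro sets_resource_Times) (auto simp: J_def)
  have cyl: "cylinder n s T \<in> sets snake_space" by (rule sets_cylinder[OF T])
  have "measure (limit_law \<mu> a x) (cylinder n s T) = measure ?M (limit_snake x -` cylinder n s T \<inter> space ?M)"
    unfolding limit_law_def by (rule measure_distr[OF measurable_limit_snake cyl])
  also have "\<dots> = measure ?M {\<omega> \<in> space ?M. \<forall>p\<in>J. \<omega> p \<in> X p}"
  \<comment> \<open>The events agree only almost surely: the snake reads its spine positions at the
    roots of the sampled bushes, which have the right value outside a null set.\<close>
  proof (rule measure_eq_AE)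
    show "AE \<omega> in ?M. \<omega> \<in> limit_snake x -` cylinder n s T \<inter> space ?M \<longleftrightarrow> \<omega> \<in> {\<omega> \<in> space ?M. \<forall>p\<in>J. \<omega> p \<in> X p}"
      using AE_resource[OF c]
    proof eventually_elim
      case (elim \<omega>)
      have sp: "limit_snake x \<omega> (spine i) = Some (spine_path x \<omega> i)" for i
        using elim[rule_format, of "(i, spine_path x \<omega> i)"] by (simp add: limit_snake_def spine_def ok_trees_def)
      have "(\<forall>p\<in>J. \<omega> p \<in> X p) \<longleftrightarrow> (\<forall>i<n. fst (\<omega> (i, s i)) = s (Suc i) \<and> snd (\<omega> (i, s i)) \<in> T i)"
        by (auto simp: J_def X_def mem_Times_iff)
      also have "\<dots> \<longleftrightarrow> (\<forall>i\<le>n. spine_path x \<omega> i = s i) \<and> (\<forall>i<n. snd (\<omega> (i, spine_path x \<omega> i)) \<in> T i)"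
      proof
        assume h: "\<forall>i<n. fst (\<omega> (i, s i)) = s (Suc i) \<and> snd (\<omega> (i, s i)) \<in> T i"
        have "i \<le> n \<Longrightarrow> spine_path x \<omega> i = s i" for i
          by (induction i) (use h x in auto)
        then show "(\<forall>i\<le>n. spine_path x \<omega> i = s i) \<and> (\<forall>i<n. snd (\<omega> (i, spine_path x \<omega> i)) \<in> T i)" using h by simp
      next
        assume h: "(\<forall>i\<le>n. spine_path x \<omega> i = s i) \<and> (\<forall>i<n. snd (\<omega> (i, spine_path x \<omega> i)) \<in> T i)"
        show "\<forall>i<n. fst (\<omega> (i, s i)) = s (Suc i) \<and> snd (\<omega> (i, s i)) \<in> T i"
        proof (intro allI impI)
          fix i assume i: "i < n"
          then have 1: "spine_path x \<omega> i = s i" and 2: "spine_path x \<omega> (Suc i) = s (Suc i)"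
            using h by (metis less_imp_le, metis Suc_leI)
          have "fst (\<omega> (i, s i)) = s (Suc i)" using 2 unfolding spine_path_simps 1 .
          moreover have "snd (\<omega> (i, s i)) \<in> T i" using h i 1 by metis
          ultimately show "fst (\<omega> (i, s i)) = s (Suc i) \<and> snd (\<omega> (i, s i)) \<in> T i" ..
        qed
      qed
      also have "\<dots> \<longleftrightarrow> limit_snake x \<omega> \<in> cylinder n s T"
        by (simp add: cylinder_def sp bush_limit_snake)
      finally show ?case by (simp add: spM)
    qed
    show "limit_snake x -` cylinder n s T \<inter> space ?M \<in> sets ?M" by (rule measurable_sets[OF measurable_limit_snake cyl])
    show "{\<omega> \<in> space ?M. \<forall>p\<in>J. \<omega> p \<in> X p} \<in> sets ?M"
      using J X by (intro sets.sets_Collect_finite_All sets_Collect_single') auto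
  qed
  also have "\<dots> = (\<Prod>p\<in>J. measure (resource \<mu> a p) (X p))"
  proof -
    have "emeasure ?M {\<omega> \<in> space ?M. \<forall>p\<in>J. \<omega> p \<in> X p} = (\<Prod>p\<in>J. emeasure (resource \<mu> a p) (X p))"
      using J X by (intro Pr.emeasure_PiM_Collect) auto
    also have "\<dots> = ennreal (\<Prod>p\<in>J. measure (resource \<mu> a p) (X p))"
      by (simp add: Pr.M.emeasure_eq_measure prod_ennreal)
    finally show ?thesis by (simp add: measure_def prod_nonneg)
  qed
  also have "\<dots> = (\<Prod>i<n. measure (resource \<mu> a (i, s i)) ({s (Suc i)} \<times> T i))"
    unfolding J_def by (subst prod.reindex) (auto simp: inj_on_def X_def)
  also have "\<dots> = (\<Prod>i<n. pmf (doob \<mu> a (s i)) (s (Suc i)) * measure (cond_star \<mu> (s i)) (T i))"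
    by (intro prod.cong refl) (simp add: measure_resource_Times[OF c T] measure_pmf_single)
  finally show ?thesis .
qed

section \<open>The conditioned snake\<close>

lemma sets_singleton_tree_map: "{g} \<in> sets tree_maps"
proof -
  have "{g} = (\<Inter>u. {w :: nat list \<rightharpoonup> site. w u \<in> {g u}})" by (auto simp: fun_eq_iff)
  also have "\<dots> \<in> sets tree_maps"
    using sets.top[of tree_maps] by (intro sets.countable_INT'' sets_maps_component) (auto simp: space_PiM)
  finally show ?thesis .
qed

lemma sets_is_walk_on: "{w. is_walk_on w t y} \<in> sets tree_maps"
proof -
  have "{w. is_walk_on w t y} = {\<lambda>u. if u \<in> t then Some (y u) else None}"
    by (auto simp: is_walk_on_def fun_eq_iff dom_def split: if_splits)
  then show ?thesis using sets_singleton_tree_map by simp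
qed

lemma truncate_class_eq_cylinder:
  assumes "\<And>i. w (spine i) = Some (s i)"
  shows "{w'. truncate n w' = truncate n w} = cylinder n s (\<lambda>i. {bush w i})"
proof -
  have 1: "truncate n w' = truncate n w \<longleftrightarrow> (\<forall>i u. i < n \<or> i = n \<and> u = [] \<longrightarrow> w' (i, u) = w (i, u))" for w'
    unfolding truncate_def fun_eq_iff by auto
  have 2: "(\<forall>i u. i < n \<or> i = n \<and> u = [] \<longrightarrow> w' (i, u) = w (i, u)) \<longleftrightarrow> w' \<in> cylinder n s (\<lambda>i. {bush w i})" for w'
  proof
    assume h: "\<forall>i u. i < n \<or> i = n \<and> u = [] \<longrightarrow> w' (i, u) = w (i, u)"
    have "w' (spine i) = Some (s i)" if "i \<le> n" for i
      using h that assms[of i] by (auto simp: spine_def le_less)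
    then show "w' \<in> cylinder n s (\<lambda>i. {bush w i})" using h by (auto simp: cylinder_def bush_def fun_eq_iff)
  next
    assume h: "w' \<in> cylinder n s (\<lambda>i. {bush w i})"
    show "\<forall>i u. i < n \<or> i = n \<and> u = [] \<longrightarrow> w' (i, u) = w (i, u)"
    proof (intro allI impI)
      fix i :: nat and u :: "nat list" assume "i < n \<or> i = n \<and> u = []"
      then show "w' (i, u) = w (i, u)"
      proof
        assume "i < n"
        then have "bush w' i = bush w i" using h by (simp add: cylinder_def)
        then show ?thesis by (simp add: bush_def fun_eq_iff)
      next
        assume "i = n \<and> u = []"
        then show ?thesis using h assms[of n] by (simp add: cylinder_def spine_def)
      qed
    qed
  qed
  show ?thesis unfolding set_eq_iff mem_Collect_eq 1 2 by simp
qed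

lemma prod_ratio_telescope:
  fixes a :: "'a \<Rightarrow> real"
  assumes "\<And>i. i \<le> n \<Longrightarrow> a (s i) \<noteq> 0"
  shows "(\<Prod>i<n. a (s (Suc i)) / a (s i)) = a (s n) / a (s 0)"
  using assms by (induction n) auto

theorem theorem3p10:
  fixes \<Lambda> :: "nat \<Rightarrow> site set" and \<mu> :: "nat pmf"
  assumes "exhaustion \<Lambda>" and "critical \<mu>" and "finite_variance \<mu>"
  shows
    "(\<forall>x. x \<noteq> 0 \<longrightarrow>
        (\<exists>L. prob_space L \<and> sets L = sets snake_space \<and>
             (AE w in L. dom w \<in> infinite_trees) \<and>
             converges_in_distribution (\<lambda>R. conditioned_law \<mu> x (- \<Lambda> R)) L)) \<and>
     (\<exists>a :: site \<Rightarrow> real. (\<forall>z. z \<noteq> 0 \<longrightarrow> a z > 0) \<and>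
        (\<forall>(x :: site) (n :: nat) (s :: nat \<Rightarrow> site) (t :: nat \<Rightarrow> nat list set)
            (y :: nat \<Rightarrow> nat list \<Rightarrow> site).
           x \<noteq> 0 \<and> (\<forall>i\<le>n. s i \<noteq> 0) \<and>
           (\<forall>i<n. t i \<in> finite_trees \<and> (\<forall>u\<in>t i. y i u \<noteq> 0) \<and> y i [] = s i) \<longrightarrow>
           (\<lambda>R. \<P>(w in snake_law \<mu> x.
                  (\<forall>i\<le>n. w (spine i) = Some (s i)) \<and> (\<forall>i<n. is_walk_on (bush w i) (t i) (y i))
                  \<bar> hits_before_0 (- \<Lambda> R) w))
           \<longlonglongrightarrow> a (s n) / a (s 0)
               * pmf (trajectory (killed_kernel (killing \<mu>)) n (Some x)) (map (\<lambda>i. Some (s i)) [0..<Suc n])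
               * (\<Prod>i<n. \<P>(w in star_law \<mu> (s i). is_walk_on w (t i) (y i) \<bar> \<not> hits_0 w))))"
proof -
  define k where "k = killing \<mu>"
  define h where "h R = hit_prob \<mu> (- \<Lambda> R)" for R
  have inc: "incseq \<Lambda>" and fin: "\<And>R. finite (\<Lambda> R)" and cov: "(\<Union>R. \<Lambda> R) = UNIV"
    using assms(1) by (auto simp: exhaustion_def)
  have in\<Lambda>: "eventually (\<lambda>R. S \<subseteq> \<Lambda> R) sequentially" if "finite S" for S
    using that
  proof (induction S)
    case (insert z S)
    obtain R0 where "z \<in> \<Lambda> R0" using cov by blast
    then have "z \<in> \<Lambda> R" if "R \<ge> R0" for R using inc that by (auto simp: incseq_def)
    then have "eventually (\<lambda>R. z \<in> \<Lambda> R) sequentially" by (auto simp: eventually_sequentially)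
    with insert.IH show ?case by eventually_elim auto
  qed simp
  have kb: "0 \<le> k z \<and> k z \<le> 1" for z unfolding k_def by (rule killing_bounds)
  have k1: "k z < 1" if "z \<noteq> 0" for z unfolding k_def using assms(2) that by (rule killing_less_1)
  define \<kappa> where "\<kappa> = 56 * measure_pmf.expectation (root_offspring \<mu>) real"
  have k\<kappa>: "k z \<le> \<kappa> / nsq z" if "z \<noteq> 0" for z
    unfolding k_def \<kappa>_def by (rule killing_le[OF assms(2,3) that])
  have \<kappa>0: "0 \<le> \<kappa>" unfolding \<kappa>_def by (intro mult_nonneg_nonneg Bochner_Integration.integral_nonneg) auto
  have h0: "0 \<le> h R z" for R z by (simp add: h_def hit_prob_nonneg)
  have hpos: "0 < h R z" if "z \<noteq> 0" for R z unfolding h_def by (rule hit_prob_pos[OF assms(2) that fin])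
  have hz: "h R 0 = 0" for R by (simp add: h_def hit_prob_0)
  have hstep: "h R z = (1 - k z) * avg (h R) z" if "z \<in> \<Lambda> R" for R z
    unfolding h_def k_def using that by (intro hit_prob_step) auto
  have harm: "eventually (\<lambda>R. kharmonic k (h R) r) sequentially" for r
  proof -
    have "finite {z :: site. \<forall>j. \<bar>z $ j\<bar> \<le> r}" by (rule finite_coord_bounded)
    from in\<Lambda>[OF this] show ?thesis
      by eventually_elim (auto simp: kharmonic_def intro!: hstep elim!: subsetD intro: less_imp_le)
  qed
  obtain a0 :: "site \<Rightarrow> real" where a0: "\<And>z. z \<noteq> 0 \<Longrightarrow> a0 z > 0"
    "\<And>x y. x \<noteq> 0 \<Longrightarrow> y \<noteq> 0 \<Longrightarrow> (\<lambda>R. h R x / h R y) \<longlonglongrightarrow> a0 x / a0 y"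
    using ratio_limit[OF kb k\<kappa> \<kappa>0 h0 hpos harm] by blast
  \<comment> \<open>The value 0 at the origin matches h R 0 = 0. So the limit of ratios also holds
    with z = 0 in the numerator, which harmonicity at the neighbours of the origin requires.\<close>
  define a where "a z = (if z = 0 then 0 else a0 z)" for z
  have apos: "a z > 0" if "z \<noteq> 0" for z using a0(1) that by (simp add: a_def)
  have ann: "0 \<le> a z" for z using apos[of z] by (cases "z = 0") (auto simp: a_def)
  have alim: "(\<lambda>R. h R z / h R y) \<longlonglongrightarrow> a z / a y" if "y \<noteq> 0" for z y
    using a0(2)[of z y] that by (cases "z = 0") (auto simp: a_def hz)
  \<comment> \<open>Averages are finite sums, so they commute with the limit of h R y / h R z; for R
    with z in \<Lambda> R the averaged ratio is identically 1.\<close>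
  have aharm: "a z = (1 - k z) * avg a z" if z: "z \<noteq> 0" for z
  proof -
    have "(\<lambda>R. (1 - k z) * avg (\<lambda>y. h R y / h R z) z) \<longlonglongrightarrow> (1 - k z) * avg (\<lambda>y. a y / a z) z"
      unfolding avg_def using z by (intro tendsto_intros alim) auto
    moreover have f: "finite {z}" by simp
    have "eventually (\<lambda>R. (1 - k z) * avg (\<lambda>y. h R y / h R z) z = 1) sequentially"
      using in\<Lambda>[OF f]
    proof eventually_elim
      case (elim R)
      then have e: "h R z = (1 - k z) * avg (h R) z" by (intro hstep) auto
      have "avg (\<lambda>y. h R y / h R z) z = avg (h R) z / h R z"
        by (simp add: avg_def sum_divide_distrib mult.commute)
      then have "(1 - k z) * avg (\<lambda>y. h R y / h R z) z = ((1 - k z) * avg (h R) z) / h R z" by simp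
      also have "\<dots> = h R z / h R z" by (simp only: e[symmetric])
      also have "\<dots> = 1" using hpos[OF z, of R] by simp
      finally show ?case .
    qed
    then have "(\<lambda>R. (1 - k z) * avg (\<lambda>y. h R y / h R z) z) \<longlonglongrightarrow> 1" by (rule tendsto_eventually)
    ultimately have "(1 - k z) * avg (\<lambda>y. a y / a z) z = 1" by (rule LIMSEQ_unique)
    moreover have "avg (\<lambda>y. a y / a z) z = avg a z / a z" by (simp add: avg_def sum_divide_distrib mult.commute)
    ultimately show ?thesis using apos[OF z] by (simp add: field_simps)
  qed
  \<comment> \<open>Both conclusions rest on this limit, since dividing by h R x is conditioning on
    the hit. For large R the set \<Lambda> R contains s 0, ..., s (n - 1), as
    \<open>prob_cylinder_hits\<close> demands.\<close>
  have cyl_lim: "(\<lambda>R. measure (snake_law \<mu> x) (cylinder n s T \<inter> {w. hits_before_0 (- \<Lambda> R) w}) / h R x) \<longlonglongrightarrow>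
      (if x = s 0 then (\<Prod>i<n. pmf step_pmf (s (Suc i) - s i) * measure (star_law \<mu> (s i)) (T i)) * (a (s n) / a (s 0)) else 0)"
    if x: "x \<noteq> 0" and T: "\<And>i. i < n \<Longrightarrow> T i \<in> sets tree_maps" "\<And>i. i < n \<Longrightarrow> T i \<subseteq> {w. \<not> hits_0 w}" for x n s T
  proof -
    define W where "W = (\<Prod>i<n. pmf step_pmf (s (Suc i) - s i) * measure (star_law \<mu> (s i)) (T i))"
    have f: "finite (s ` {..<n})" by simp
    have "eventually (\<lambda>R. (if x = s 0 then W * (h R (s n) / h R x) else 0) =
        measure (snake_law \<mu> x) (cylinder n s T \<inter> {w. hits_before_0 (- \<Lambda> R) w}) / h R x) sequentially"
      using in\<Lambda>[OF f]
    proof eventually_elim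
      case (elim R)
      have "measure (snake_law \<mu> x) (cylinder n s T \<inter> {w. hits_before_0 (- \<Lambda> R) w}) = (if x = s 0 then W * h R (s n) else 0)"
        unfolding W_def h_def by (rule prob_cylinder_hits) (use elim T in auto)
      then show ?case by simp
    qed
    moreover have "(\<lambda>R. if x = s 0 then W * (h R (s n) / h R x) else 0) \<longlonglongrightarrow> (if x = s 0 then W * (a (s n) / a (s 0)) else 0)"
      using tendsto_mult[OF tendsto_const[of W] alim[OF x, of "s n"]]
      by (cases "x = s 0") (simp_all del: times_divide_eq_right)
    ultimately show ?thesis unfolding W_def[symmetric] by (rule Lim_transform_eventually[rotated])
  qed
  have limit_exists: "\<exists>L. prob_space L \<and> sets L = sets snake_space \<and> (AE w in L. dom w \<in> infinite_trees) \<and>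
      converges_in_distribution (\<lambda>R. conditioned_law \<mu> x (- \<Lambda> R)) L" if x: "x \<noteq> 0" for x
  proof -
    define L where "L = limit_law \<mu> a x"
    \<comment> \<open>Almost sure properties of the limit under which truncation classes are
      cylinders covered by \<open>cyl_lim\<close>: the spine is present and avoids 0, and the bushes
      are finite and avoid 0.\<close>
    define good where "good = {w :: vertex \<rightharpoonup> site. \<forall>i. (\<exists>z. w (spine i) = Some z \<and> z \<noteq> 0) \<and> dom (bush w i) \<in> finite_trees \<and> \<not> hits_0 (bush w i)}"
    have pd: "pmf (doob \<mu> a z) w = (1 - k z) * pmf step_pmf (w - z) * a w / a z" if "z \<noteq> 0" for z w
      unfolding k_def using that ann apos[OF that] aharm[OF that] by (intro pmf_doob) (auto simp: k_def)
    have d0: "0 \<notin> set_pmf (doob \<mu> a z)" if "z \<noteq> 0" for z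
      by (simp add: set_pmf_iff pd[OF that]) (simp add: a_def)
    have "AE \<omega> in PiM UNIV (resource \<mu> a). limit_snake x \<omega> \<in> good"
      using AE_resource[OF assms(2)]
    proof eventually_elim
      case (elim \<omega>)
      have p0: "spine_path x \<omega> i \<noteq> 0" for i
      proof (induction i)
        case (Suc i)
        show ?case using elim[rule_format, of "(i, spine_path x \<omega> i)"] d0[OF Suc] by auto
      qed (use x in simp)
      have ok: "bush (limit_snake x \<omega>) i \<in> ok_trees (spine_path x \<omega> i)" for i
        using elim[rule_format, of "(i, spine_path x \<omega> i)"] by (simp add: bush_limit_snake)
      have "limit_snake x \<omega> (spine i) = Some (spine_path x \<omega> i)" for i
        using ok[of i] by (simp add: ok_trees_def bush_def spine_def)
      then show ?case using ok p0 by (auto simp: good_def ok_trees_def)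
    qed
    then have AEgood: "AE w in L. w \<in> good"
      unfolding L_def limit_law_def
    proof (subst AE_distr_iff[OF measurable_limit_snake])
      have "good = (\<Inter>i. {w. w (spine i) \<in> Some ` (- {0})} \<inter> {w. bush w i \<in> {w. dom w \<in> finite_trees}} \<inter> {w. bush w i \<in> {w. \<not> hits_0 w}})"
        by (auto simp: good_def image_iff)
      also have "\<dots> \<in> sets snake_space"
      proof (rule sets.countable_INT''[OF sets_snake_UNIV countableI_type])
        fix i show "{w. w (spine i) \<in> Some ` (- {0})} \<inter> {w. bush w i \<in> {w. dom w \<in> finite_trees}} \<inter> {w. bush w i \<in> {w. \<not> hits_0 w}} \<in> sets snake_space"
          by (rule sets.Int[OF sets.Int[OF sets_snake_component sets_bush[OF sets_dom_finite_trees]] sets_bush[OF sets_not_hits_0]])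
      qed
      finally show "{w \<in> space snake_space. w \<in> good} \<in> sets snake_space" by simp
    qed
    have "AE w in L. dom w \<in> infinite_trees"
      using AEgood
    proof eventually_elim
      case (elim w)
      have "{u. (i, u) \<in> dom w} = dom (bush w i)" for i by (auto simp: bush_def dom_def)
      then show ?case using elim by (simp add: infinite_trees_iff good_def)
    qed
    moreover have "converges_in_distribution (\<lambda>R. conditioned_law \<mu> x (- \<Lambda> R)) L"
    proof (rule local_convergence[where good = good])
      show "prob_space L" "sets L = sets snake_space" unfolding L_def using prob_space_limit_law[OF assms(2)] by auto
      interpret S: prob_space "snake_law \<mu> x" by (rule prob_space_snake_law)
      have H: "emeasure (snake_law \<mu> x) {w \<in> space snake_space. hits_before_0 (- \<Lambda> R) w} = ennreal (h R x)" for R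
        by (simp add: S.emeasure_eq_measure h_def hit_prob_def)
      then have H': "emeasure (snake_law \<mu> x) {w \<in> space snake_space. hits_before_0 (- \<Lambda> R) w} \<noteq> 0"
        "emeasure (snake_law \<mu> x) {w \<in> space snake_space. hits_before_0 (- \<Lambda> R) w} \<noteq> \<infinity>" for R
        using hpos[OF x, of R] by simp_all
      show "prob_space (conditioned_law \<mu> x (- \<Lambda> R))" for R
        unfolding conditioned_law_def by (rule prob_space_uniform_measure[OF H'])
      show "sets (conditioned_law \<mu> x (- \<Lambda> R)) = sets snake_space" for R by (simp add: conditioned_law_def)
      show "AE w in L. w \<in> good" by (rule AEgood)
      show "finite (dom (bush w i))" if "w \<in> good" for w i using that by (auto simp: good_def finite_trees_def)
      fix n w assume w: "w \<in> good"
      then have "\<forall>i. \<exists>z. w (spine i) = Some z \<and> z \<noteq> 0" by (simp add: good_def)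
      then obtain s where s: "\<And>i. w (spine i) = Some (s i)" "\<And>i. s i \<noteq> 0" by metis
      define T where "T i = {bush w i}" for i
      have T: "T i \<in> sets tree_maps" "T i \<subseteq> {w. \<not> hits_0 w}" for i
        using w sets_singleton_tree_map by (auto simp: T_def good_def)
      have cls: "{w'. truncate n w' = truncate n w} = cylinder n s T"
        unfolding T_def by (rule truncate_class_eq_cylinder) (rule s(1))
      have cyl: "cylinder n s T \<in> sets snake_space" by (rule sets_cylinder[OF T(1)])
      have cp: "measure (conditioned_law \<mu> x (- \<Lambda> R)) (cylinder n s T) =
          measure (snake_law \<mu> x) (cylinder n s T \<inter> {w. hits_before_0 (- \<Lambda> R) w}) / h R x" for R
        unfolding conditioned_law_def using cyl H'[of R] by (subst measure_uniform_measure) (auto simp: h_def hit_prob_def Int_commute)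
      have "measure L (cylinder n s T) = (if x = s 0 then (\<Prod>i<n. pmf step_pmf (s (Suc i) - s i) * measure (star_law \<mu> (s i)) (T i)) * (a (s n) / a (s 0)) else 0)"
      proof (cases "x = s 0")
        case True
        have "measure L (cylinder n s T) = (\<Prod>i<n. pmf (doob \<mu> a (s i)) (s (Suc i)) * measure (cond_star \<mu> (s i)) (T i))"
          unfolding L_def by (rule limit_law_cylinder) (rule assms(2), rule True[symmetric], rule T(1))
        \<comment> \<open>The survival factor 1 - k (s i) of the Doob kernel cancels the
          normalisation of the conditioned bush, and the quotients of a are left to
          telescope.\<close>
        also have "\<dots> = (\<Prod>i<n. (pmf step_pmf (s (Suc i) - s i) * measure (star_law \<mu> (s i)) (T i)) * (a (s (Suc i)) / a (s i)))"
        proof (intro prod.cong refl)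
          fix i
          show "pmf (doob \<mu> a (s i)) (s (Suc i)) * measure (cond_star \<mu> (s i)) (T i) =
            (pmf step_pmf (s (Suc i) - s i) * measure (star_law \<mu> (s i)) (T i)) * (a (s (Suc i)) / a (s i))"
            using k1[OF s(2)[of i]] by (simp add: pd[OF s(2)] measure_cond_star[OF assms(2) s(2) T] k_def[symmetric])
        qed
        also have "\<dots> = (\<Prod>i<n. pmf step_pmf (s (Suc i) - s i) * measure (star_law \<mu> (s i)) (T i)) * (a (s n) / a (s 0))"
        proof -
          have "(\<Prod>i<n. a (s (Suc i)) / a (s i)) = a (s n) / a (s 0)"
          proof (rule prod_ratio_telescope)
            fix i show "a (s i) \<noteq> 0" using apos[OF s(2)[of i]] by linarith
          qed
          then show ?thesis unfolding prod.distrib[of "\<lambda>i. pmf step_pmf (s (Suc i) - s i) * measure (star_law \<mu> (s i)) (T i)"] by (simp only:)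
        qed
        finally show ?thesis using True by simp
      next
        \<comment> \<open>A cylinder not starting at x is null under L as well, matching the zero
          limit.\<close>
        case False
        have "AE w in L. w \<notin> cylinder n s T"
          unfolding L_def limit_law_def
        proof (subst AE_distr_iff[OF measurable_limit_snake])
          have "{w \<in> space snake_space. w \<notin> cylinder n s T} = space snake_space - cylinder n s T" by auto
          then show "{w \<in> space snake_space. w \<notin> cylinder n s T} \<in> sets snake_space"
            using sets.compl_sets[OF cyl] by (simp only:)
          show "AE \<omega> in PiM UNIV (resource \<mu> a). limit_snake x \<omega> \<notin> cylinder n s T"
            using AE_resource[OF assms(2)]
          proof eventually_elim
            case (elim \<omega>)
            have "limit_snake x \<omega> (spine 0) = Some x"
              using elim[rule_format, of "(0, x)"] by (simp add: limit_snake_def spine_def ok_trees_def)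
            then show ?case using False by (auto simp: cylinder_def)
          qed
        qed
        then have "emeasure L (cylinder n s T) = 0"
          using cyl by (subst (asm) AE_iff_measurable[of "cylinder n s T"]) (auto simp: L_def)
        then show ?thesis using False by (simp add: measure_def)
      qed
      then show "(\<lambda>R. measure (conditioned_law \<mu> x (- \<Lambda> R)) {w'. truncate n w' = truncate n w}) \<longlonglongrightarrow> measure L {w'. truncate n w' = truncate n w}"
        unfolding cls cp by (simp only:) (rule cyl_lim[OF x]; rule T)
    qed
    ultimately show ?thesis unfolding L_def using prob_space_limit_law[OF assms(2)] by (intro exI[of _ "limit_law \<mu> a x"]) auto
  qed
  have formula: "(\<lambda>R. \<P>(w in snake_law \<mu> x.
                  (\<forall>i\<le>n. w (spine i) = Some (s i)) \<and> (\<forall>i<n. is_walk_on (bush w i) (t i) (y i))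
                  \<bar> hits_before_0 (- \<Lambda> R) w))
           \<longlonglongrightarrow> a (s n) / a (s 0)
               * pmf (trajectory (killed_kernel (killing \<mu>)) n (Some x)) (map (\<lambda>i. Some (s i)) [0..<Suc n])
               * (\<Prod>i<n. \<P>(w in star_law \<mu> (s i). is_walk_on w (t i) (y i) \<bar> \<not> hits_0 w))"
    if x: "x \<noteq> 0" and s: "\<forall>i\<le>n. s i \<noteq> 0" and ty: "\<forall>i<n. t i \<in> finite_trees \<and> (\<forall>u\<in>t i. y i u \<noteq> 0) \<and> y i [] = s i"
    for x n s and t :: "nat \<Rightarrow> nat list set" and y
  proof -
    define T where "T i = {w. is_walk_on w (t i) (y i)}" for i
    have T: "T i \<in> sets tree_maps" for i unfolding T_def by (rule sets_is_walk_on)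
    have Th: "T i \<subseteq> {w. \<not> hits_0 w}" if "i < n" for i
    proof -
      have "\<not> hits_0 w" if w: "is_walk_on w (t i) (y i)" for w
      proof
        assume "hits_0 w"
        then obtain u where u: "w u = Some 0" by (auto simp: hits_0_def)
        then have "u \<in> t i" using w by (auto simp: is_walk_on_def)
        then show False using u w ty \<open>i < n\<close> by (auto simp: is_walk_on_def)
      qed
      then show ?thesis by (auto simp: T_def)
    qed
    have lhs: "\<P>(w in snake_law \<mu> x. (\<forall>i\<le>n. w (spine i) = Some (s i)) \<and> (\<forall>i<n. is_walk_on (bush w i) (t i) (y i))
        \<bar> hits_before_0 (- \<Lambda> R) w) = measure (snake_law \<mu> x) (cylinder n s T \<inter> {w. hits_before_0 (- \<Lambda> R) w}) / h R x" for R
    proof -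
      have "{w. ((\<forall>i\<le>n. w (spine i) = Some (s i)) \<and> (\<forall>i<n. is_walk_on (bush w i) (t i) (y i))) \<and> hits_before_0 (- \<Lambda> R) w}
        = cylinder n s T \<inter> {w. hits_before_0 (- \<Lambda> R) w}" by (auto simp: cylinder_def T_def)
      then show ?thesis by (simp add: cond_prob_def h_def hit_prob_def)
    qed
    have star: "\<P>(w in star_law \<mu> (s i). is_walk_on w (t i) (y i) \<bar> \<not> hits_0 w) = measure (star_law \<mu> (s i)) (T i) / (1 - k (s i))" if "i < n" for i
    proof -
      have "{w. is_walk_on w (t i) (y i) \<and> \<not> hits_0 w} = T i" using Th[OF that] by (auto simp: T_def)
      then show ?thesis by (simp add: cond_prob_def prob_not_hits_0 k_def)
    qed
    have kern: "pmf (killed_kernel (killing \<mu>) (Some z)) (Some w) = (1 - k z) * pmf step_pmf (w - z)" for z w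
      using pmf_killed_kernel[of k "Some z" "Some w"] kb
      by (cases "w - z \<in> unit_vectors") (simp_all add: k_def[symmetric] killed_transition_def pmf_step adjacent_iff)
    have traj: "pmf (trajectory (killed_kernel (killing \<mu>)) n (Some x)) (map (\<lambda>i. Some (s i)) [0..<Suc n]) =
        (if x = s 0 then (\<Prod>i<n. (1 - k (s i)) * pmf step_pmf (s (Suc i) - s i)) else 0)"
      unfolding pmf_trajectory kern by simp
    have "(if x = s 0 then (\<Prod>i<n. pmf step_pmf (s (Suc i) - s i) * measure (star_law \<mu> (s i)) (T i)) * (a (s n) / a (s 0)) else 0)
      = a (s n) / a (s 0) * (if x = s 0 then (\<Prod>i<n. (1 - k (s i)) * pmf step_pmf (s (Suc i) - s i)) else 0)
          * (\<Prod>i<n. \<P>(w in star_law \<mu> (s i). is_walk_on w (t i) (y i) \<bar> \<not> hits_0 w))"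
    proof -
      have "(\<Prod>i<n. (1 - k (s i)) * pmf step_pmf (s (Suc i) - s i)) * (\<Prod>i<n. \<P>(w in star_law \<mu> (s i). is_walk_on w (t i) (y i) \<bar> \<not> hits_0 w))
        = (\<Prod>i<n. ((1 - k (s i)) * pmf step_pmf (s (Suc i) - s i)) * \<P>(w in star_law \<mu> (s i). is_walk_on w (t i) (y i) \<bar> \<not> hits_0 w))"
        by (rule prod.distrib[symmetric])
      \<comment> \<open>Surviving at s i and then conditioning the bush not to hit 0 amounts to the
        unconditioned probability of the prescribed bush, which avoids 0.\<close>
      also have "\<dots> = (\<Prod>i<n. pmf step_pmf (s (Suc i) - s i) * measure (star_law \<mu> (s i)) (T i))"
      proof (intro prod.cong refl)
        fix i assume "i \<in> {..<n}"
        then have i: "i < n" "s i \<noteq> 0" using s by auto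
        show "((1 - k (s i)) * pmf step_pmf (s (Suc i) - s i)) * \<P>(w in star_law \<mu> (s i). is_walk_on w (t i) (y i) \<bar> \<not> hits_0 w)
          = pmf step_pmf (s (Suc i) - s i) * measure (star_law \<mu> (s i)) (T i)"
          unfolding star[OF i(1)] using k1[OF i(2)] by simp
      qed
      finally show ?thesis by (simp add: mult_ac)
    qed
    then show ?thesis unfolding lhs traj
      using cyl_lim[where x = x and n = n and s = s and T = T, OF x T Th] by (simp only:)
  qed
  show ?thesis
  proof (rule conjI)
    show "\<forall>x. x \<noteq> 0 \<longrightarrow> (\<exists>L. prob_space L \<and> sets L = sets snake_space \<and>
        (AE w in L. dom w \<in> infinite_trees) \<and>
        converges_in_distribution (\<lambda>R. conditioned_law \<mu> x (- \<Lambda> R)) L)"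
      by (intro allI impI) (rule limit_exists)
  next
    show "\<exists>a :: site \<Rightarrow> real. (\<forall>z. z \<noteq> 0 \<longrightarrow> a z > 0) \<and>
        (\<forall>(x :: site) (n :: nat) (s :: nat \<Rightarrow> site) (t :: nat \<Rightarrow> nat list set)
            (y :: nat \<Rightarrow> nat list \<Rightarrow> site).
           x \<noteq> 0 \<and> (\<forall>i\<le>n. s i \<noteq> 0) \<and>
           (\<forall>i<n. t i \<in> finite_trees \<and> (\<forall>u\<in>t i. y i u \<noteq> 0) \<and> y i [] = s i) \<longrightarrow>
           (\<lambda>R. \<P>(w in snake_law \<mu> x.
                  (\<forall>i\<le>n. w (spine i) = Some (s i)) \<and> (\<forall>i<n. is_walk_on (bush w i) (t i) (y i))
                  \<bar> hits_before_0 (- \<Lambda> R) w))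
           \<longlonglongrightarrow> a (s n) / a (s 0)
               * pmf (trajectory (killed_kernel (killing \<mu>)) n (Some x)) (map (\<lambda>i. Some (s i)) [0..<Suc n])
               * (\<Prod>i<n. \<P>(w in star_law \<mu> (s i). is_walk_on w (t i) (y i) \<bar> \<not> hits_0 w)))"
    proof (intro exI[of _ a] conjI allI impI)
      show "a z > 0" if "z \<noteq> 0" for z using that by (rule apos)
    qed (elim conjE, rule formula)
  qed
qed

end
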